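(* Assume the following. (i) There are positive constants $L_1,L_2,L_3$ such that for all $s,t\in[0,T]$ and all $x,y,x_1,x_2,y_1,y_2\in\mathbb R$: $|b(t,x,y)-b(s,x,y)|+|\sigma(t,x,y)-\sigma(s,x,y)|\le L_1|t-s|$, $|b(t,x_1,y_1)-b(t,x_2,y_2)|+|\sigma(t,x_1,y_1)-\sigma(t,x_2,y_2)|\le L_2(|x_1-x_2|+|y_1-y_2|)$, and $|b(t,x,y)|+|\sigma(t,x,y)|\le L_3(1+|x|+|y|)$. (ii) The functional $\hat\sigma(t,\xi)$ defined in the context is Fréchet differentiable in $\xi\in C_r$ and there are positive constants $M_1,M_2,M_3$ such that for all $\xi,\eta\in C_r$ and $s,t\in[0,T]$: $|D_\xi\hat\sigma(t,\xi)|_{\mathcal L(C_r,\mathbb R)}\le M_1$, $|D_\xi\hat\sigma(t,\xi)-D_\xi\hat\sigma(t,\eta)|_{\mathcal L(C_r,\mathbb R)}\le M_2\|\xi-\eta\|$, $|D_\xi\hat\sigma(t,\xi)-D_\xi\hat\sigma(s,\xi)|_{\mathcal L(C_r,\mathbb R)}\le M_3|t-s|$. (iii) $K(t,s,x)$ is differentiable in $x$ and there are positive constants $K_1,K_2,K_3$ such that for all $t,u\in[0,T]$, $s,v\in[-r,0]$, $x,y\in\mathbb R$: $|K(t,s,x)-K(u,v,x)|\le K_1(|t-u|+|s-v|)$, $|K(t,s,x)-K(t,s,y)|\le K_2|x-y|$, $|K(t,s,x)|\le K_3(1+|x|)$. Let $\beta\in(1-H,1/2)$. Then for any $\varepsilon>0$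 and all small enough $\rho>0$ there exist $h_0>0$ and $\Omega_{\varepsilon,h_0,\rho}\subset\Omega$ with $\mathbb P(\Omega_{\varepsilon,h_0,\rho})>1-\varepsilon$ such that for each $\omega\in\Omega_{\varepsilon,h_0,\rho}$ and each $h<h_0$, $$U_h:=\sup_{y\in[0,T]}\left(|X(y)-\tilde X^h(y)|+\int_0^{y}\frac{\Delta_{v,y}(X,\tilde X^h)}{(y-v)^{\beta+1}}\,dv+\int_0^{C_h(y)}\int_{-C_h(v)}^0\frac{\Delta_{v+s,y+s}(X,\tilde X^h)}{(y-v)^{\beta+1}}\,ds\,dv\right)\le C(\omega)\,h^{2H-1-\beta},$$ where $C(\omega)$ does not depend on $h$ and $\varepsilon$, but depends on $\rho$.
   Context: Let $(\Omega,\mathcal F,\{\mathcal F_t\}_{t\ge0},\mathbb P)$ be a complete filtered probability space satisfying the usual conditions, $r>0$, $T=r$, $H\in(1/2,1)$, and $B^H$ a fractional Brownian motion with Hurst parameter $H$. The functions $b,\sigma:[0,T]\times\mathbb R\times\mathbb R\to\mathbb R$ and $K:[0,T]\times[-r,0]\times\mathbb R\to\mathbb R$ are continuous. The initial condition $\phi:[-r,0]\to\mathbb R$ is $(H-\rho)$-Hölder continuous for every $0<\rho<H$, i.e. $|\phi(t)-\phi(s)|\le L|t-s|^{H-\rho}$ with a positive constant $L$. Stochastic integrals with respect to $B^H$ are pathwise generalized Lebesgue–Stieltjes integrals (in the sense of Zähle; for integrands Hölder of order $\nu$ with $\nu+H>1$ they exist and coincide with Young/Riemann–Stieltjes integrals).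 $X$ is the solution (with a.s. Hölder trajectories of some order $>1-H$) of $X(t)=X(0)+\int_0^t b(s,X(s),Y(s))\,ds+\int_0^t\sigma(s,X(s),Y(s))\,dB^H(s)$ for $t\in[0,T]$, $X(t)=\phi(t)$ for $t\in[-r,0]$, where $Y(t)=\int_{-r}^0K(t,s,X(t+s))\,ds$, $t\in[0,T]$. $C_r=C([-r,0])$ is the space of continuous functions $\xi:[-r,0]\to\mathbb R$ with the sup norm $\|\cdot\|$, $\mathcal L(C_r,\mathbb R)$ its space of bounded linear functionals, and $\hat\sigma(t,\xi):=\sigma\big(t,\xi(0),\int_{-r}^0K(t,s,\xi(s))\,ds\big)$ for $t\in[0,T]$, $\xi\in C_r$. Euler scheme: for $N\in\mathbb N$ put $h=T/N$, $t_n=nh$, $n=-N,\dots,N$, and $C_h(u)=\lfloor u/h\rfloor h$. Set $\tilde X^h(t)=\phi(t)$ for $t\in[-r,0]$, $\tilde Y(t)=\sum_{i=-N}^{-1}h\,K(t,t_i,\tilde X^h(t+t_i))$ for $t\in[0,T]$, and recursively for $t\in[t_n,t_{n+1}]$, $0\le n\le N-1$, $\tilde X^h(t)=\tilde X^h(t_n)+b(t_n,\tilde X^h(t_n),\tilde Y(t_n))(t-t_n)+\sigma(t_n,\tilde X^h(t_n),\tilde Y(t_n))(B^H(t)-B^H(t_n))$. The step size $h$ ranges over the values $T/N$. $\Delta_{u,s}(X,\tilde X^h)=|X(s)-\tilde X^h(s)-X(u)+\tilde X^h(u)|$. *)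

theory Defs
  imports "HOL-Probability.Probability"
begin

section \<open>Filtered probability spaces and fractional Brownian motion\<close>

definition usual_filtration :: "'a measure \<Rightarrow> (real \<Rightarrow> 'a measure) \<Rightarrow> bool" where
  "usual_filtration M F \<longleftrightarrow>
     (\<forall>t\<ge>0. subalgebra M (F t)) \<and>
     (\<forall>s t. 0 \<le> s \<and> s \<le> t \<longrightarrow> sets (F s) \<subseteq> sets (F t)) \<and>
     (\<forall>t\<ge>0. sets (F t) = (\<Inter>u\<in>{t<..}. sets (F u))) \<and>
     null_sets M \<subseteq> sets (F 0)"

text \<open>Degenerate (almost surely constant) variables count as Gaussian.\<close>

definition gaussian_rv :: "'a measure \<Rightarrow> ('a \<Rightarrow> real) \<Rightarrow> bool" where
  "gaussian_rv M Z \<longleftrightarrow>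
     (\<exists>\<mu> v. 0 < v \<and> distributed M lborel Z (normal_density \<mu> v)) \<or>
     (Z \<in> borel_measurable M \<and> (\<exists>\<mu>. AE \<omega> in M. Z \<omega> = \<mu>))"

text \<open>As usual, fractional Brownian motion means a version with continuous paths.\<close>

definition fractional_brownian_motion ::
    "'a measure \<Rightarrow> real \<Rightarrow> (real \<Rightarrow> 'a \<Rightarrow> real) \<Rightarrow> bool" where
  "fractional_brownian_motion M H B \<longleftrightarrow>
     (\<forall>J c. finite J \<and> J \<subseteq> {0..} \<longrightarrow> gaussian_rv M (\<lambda>\<omega>. \<Sum>t\<in>J. c t * B t \<omega>)) \<and>
     (\<forall>t\<ge>0. (\<integral>\<omega>. B t \<omega> \<partial>M) = 0) \<and>
     (\<forall>s\<ge>0. \<forall>t\<ge>0. (\<integral>\<omega>. B s \<omega> * B t \<omega> \<partial>M)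
        = (s powr (2 * H) + t powr (2 * H) - \<bar>t - s\<bar> powr (2 * H)) / 2) \<and>
     (AE \<omega> in M. continuous_on {0..} (\<lambda>t. B t \<omega>))"

definition hoelder_on :: "real set \<Rightarrow> real \<Rightarrow> (real \<Rightarrow> real) \<Rightarrow> bool" where
  "hoelder_on S \<nu> f \<longleftrightarrow> (\<exists>L>0. \<forall>s\<in>S. \<forall>t\<in>S. \<bar>f t - f s\<bar> \<le> L * \<bar>t - s\<bar> powr \<nu>)"

section \<open>Generalized Lebesgue-Stieltjes integral\<close>

text \<open>Fractional derivatives of order \<open>\<alpha>\<close> in Weyl-Marchaud form.  The right-sided one is
  taken without its customary phase factor \<open>(-1) powr \<alpha>\<close>.\<close>

definition frac_deriv_left :: "real \<Rightarrow> real \<Rightarrow> (real \<Rightarrow> real) \<Rightarrow> real \<Rightarrow> real" where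
  "frac_deriv_left \<alpha> a f x =
     (f x / (x - a) powr \<alpha> + \<alpha> * (LBINT u:{a..x}. (f x - f u) / (x - u) powr (\<alpha> + 1)))
       / Gamma (1 - \<alpha>)"

definition frac_deriv_right :: "real \<Rightarrow> real \<Rightarrow> (real \<Rightarrow> real) \<Rightarrow> real \<Rightarrow> real" where
  "frac_deriv_right \<alpha> b g x =
     (g x / (b - x) powr \<alpha> + \<alpha> * (LBINT u:{x..b}. (g x - g u) / (u - x) powr (\<alpha> + 1)))
       / Gamma (1 - \<alpha>)"

text \<open>The integral of \<open>f\<close> against \<open>g\<close> is the product integral of the left derivative of
  order \<open>\<alpha>\<close> of \<open>f\<close> and the right derivative of order \<open>1 - \<alpha>\<close> of \<open>g - g b\<close>.  The omitted phase
  factors, \<open>(-1) powr \<alpha>\<close> in front of the integral and \<open>(-1) powr (1 - \<alpha>)\<close> in the right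
  derivative, multiply to \<open>-1\<close>.\<close>

definition gls_value ::
    "real \<Rightarrow> (real \<Rightarrow> real) \<Rightarrow> (real \<Rightarrow> real) \<Rightarrow> real \<Rightarrow> real \<Rightarrow> real" where
  "gls_value \<alpha> f g a b =
     - (LBINT x:{a..b}. frac_deriv_left \<alpha> a f x * frac_deriv_right (1 - \<alpha>) b (\<lambda>u. g u - g b) x)"

text \<open>The last two conditions are finiteness of the norm of \<open>f\<close> in the fractional Sobolev-type
  space of order \<open>\<alpha>\<close> and exponent \<open>1\<close>, and of the seminorm of \<open>g\<close> of order \<open>1 - \<alpha>\<close> and
  exponent \<open>\<infinity>\<close>; then both derivatives exist and their product is Lebesgue integrable.\<close>

definition gls_admissible ::
    "real \<Rightarrow> (real \<Rightarrow> real) \<Rightarrow> (real \<Rightarrow> real) \<Rightarrow> real \<Rightarrow> real \<Rightarrow> bool" where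
  "gls_admissible \<alpha> f g a b \<longleftrightarrow>
     0 < \<alpha> \<and> \<alpha> < 1 \<and>
     set_borel_measurable lborel {a..b} f \<and> set_borel_measurable lborel {a..b} g \<and>
     (\<integral>\<^sup>+x\<in>{a..b}. (ennreal (\<bar>f x\<bar> / (x - a) powr \<alpha>)
        + (\<integral>\<^sup>+u\<in>{a..x}. ennreal (\<bar>f x - f u\<bar> / (x - u) powr (\<alpha> + 1)) \<partial>lborel)) \<partial>lborel) < \<infinity> \<and>
     (\<exists>C::real. \<forall>x y. a \<le> x \<and> x < y \<and> y \<le> b \<longrightarrow>
        ennreal (\<bar>g y - g x\<bar> / (y - x) powr (1 - \<alpha>))
        + (\<integral>\<^sup>+u\<in>{x..y}. ennreal (\<bar>g u - g x\<bar> / (u - x) powr (2 - \<alpha>)) \<partial>lborel) \<le> ennreal C)"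

text \<open>The value does not depend on the admissible order \<open>\<alpha>\<close>; quantifying over all of them
  makes uniqueness of the integral immediate.\<close>

definition has_gls_integral ::
    "(real \<Rightarrow> real) \<Rightarrow> (real \<Rightarrow> real) \<Rightarrow> real \<Rightarrow> real \<Rightarrow> real \<Rightarrow> bool" where
  "has_gls_integral f g a b I \<longleftrightarrow>
     (\<exists>\<alpha>. gls_admissible \<alpha> f g a b) \<and> (\<forall>\<alpha>. gls_admissible \<alpha> f g a b \<longrightarrow> gls_value \<alpha> f g a b = I)"

section \<open>The space of continuous functions on the delay interval\<close>

text \<open>Elements of \<open>C([-r,0])\<close> are represented by real functions continuous on \<open>{-r..0}\<close>; values
  outside are irrelevant.  In particular, a functional in \<open>seg_dual r\<close> cannot distinguish two
  functions that agree on \<open>{-r..0}\<close>.\<close>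

definition seg_space :: "real \<Rightarrow> (real \<Rightarrow> real) set" where
  "seg_space r = {\<xi>. continuous_on {-r..0} \<xi>}"

definition seg_norm :: "real \<Rightarrow> (real \<Rightarrow> real) \<Rightarrow> real" where
  "seg_norm r \<xi> = (SUP s\<in>{-r..0}. \<bar>\<xi> s\<bar>)"

definition seg_dual :: "real \<Rightarrow> ((real \<Rightarrow> real) \<Rightarrow> real) set" where
  "seg_dual r = {\<Lambda>.
     (\<forall>\<xi>\<in>seg_space r. \<forall>\<eta>\<in>seg_space r. \<Lambda> (\<lambda>s. \<xi> s + \<eta> s) = \<Lambda> \<xi> + \<Lambda> \<eta>) \<and>
     (\<forall>c. \<forall>\<xi>\<in>seg_space r. \<Lambda> (\<lambda>s. c * \<xi> s) = c * \<Lambda> \<xi>) \<and>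
     (\<exists>C. \<forall>\<xi>\<in>seg_space r. \<bar>\<Lambda> \<xi>\<bar> \<le> C * seg_norm r \<xi>)}"

definition seg_dual_norm :: "real \<Rightarrow> ((real \<Rightarrow> real) \<Rightarrow> real) \<Rightarrow> real" where
  "seg_dual_norm r \<Lambda> = (SUP \<xi>\<in>{\<xi>\<in>seg_space r. seg_norm r \<xi> \<le> 1}. \<bar>\<Lambda> \<xi>\<bar>)"

definition has_frechet_derivative_seg ::
    "real \<Rightarrow> ((real \<Rightarrow> real) \<Rightarrow> real) \<Rightarrow> ((real \<Rightarrow> real) \<Rightarrow> real) \<Rightarrow> (real \<Rightarrow> real) \<Rightarrow> bool" where
  "has_frechet_derivative_seg r G \<Lambda> \<xi> \<longleftrightarrow>
     \<Lambda> \<in> seg_dual r \<and>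
     (\<forall>e>0. \<exists>d>0. \<forall>\<eta>\<in>seg_space r. seg_norm r \<eta> < d \<longrightarrow>
        \<bar>G (\<lambda>s. \<xi> s + \<eta> s) - G \<xi> - \<Lambda> \<eta>\<bar> \<le> e * seg_norm r \<eta>)"

definition sigma_hat ::
    "real \<Rightarrow> (real \<Rightarrow> real \<Rightarrow> real \<Rightarrow> real) \<Rightarrow> (real \<Rightarrow> real \<Rightarrow> real \<Rightarrow> real)
      \<Rightarrow> real \<Rightarrow> (real \<Rightarrow> real) \<Rightarrow> real" where
  "sigma_hat r \<sigma> K t \<xi> = \<sigma> t (\<xi> 0) (LBINT s:{-r..0}. K t s (\<xi> s))"

section \<open>The delay equation\<close>

definition delay_term ::
    "real \<Rightarrow> (real \<Rightarrow> real \<Rightarrow> real \<Rightarrow> real) \<Rightarrow> (real \<Rightarrow> real) \<Rightarrow> real \<Rightarrow> real" where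
  "delay_term r K x t = (LBINT s:{-r..0}. K t s (x (t + s)))"

definition delay_sde_solution ::
    "'a measure \<Rightarrow> real \<Rightarrow> real \<Rightarrow> real \<Rightarrow> (real \<Rightarrow> real \<Rightarrow> real \<Rightarrow> real)
      \<Rightarrow> (real \<Rightarrow> real \<Rightarrow> real \<Rightarrow> real) \<Rightarrow> (real \<Rightarrow> real \<Rightarrow> real \<Rightarrow> real) \<Rightarrow> (real \<Rightarrow> real)
      \<Rightarrow> (real \<Rightarrow> 'a \<Rightarrow> real) \<Rightarrow> (real \<Rightarrow> 'a \<Rightarrow> real) \<Rightarrow> bool" where
  "delay_sde_solution M H r T b \<sigma> K \<phi> B X \<longleftrightarrow>
     (\<forall>t\<in>{-r..T}. X t \<in> borel_measurable M) \<and>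
     (AE \<omega> in M.
        (\<exists>\<nu>>1 - H. hoelder_on {-r..T} \<nu> (\<lambda>t. X t \<omega>)) \<and>
        (\<forall>t\<in>{-r..0}. X t \<omega> = \<phi> t) \<and>
        (\<forall>t\<in>{0..T}. \<exists>I.
           has_gls_integral (\<lambda>s. \<sigma> s (X s \<omega>) (delay_term r K (\<lambda>u. X u \<omega>) s)) (\<lambda>s. B s \<omega>) 0 t I \<and>
           X t \<omega> = X 0 \<omega> + (LBINT s:{0..t}. b s (X s \<omega>) (delay_term r K (\<lambda>u. X u \<omega>) s)) + I))"

section \<open>The Euler scheme\<close>

definition euler_delay ::
    "real \<Rightarrow> nat \<Rightarrow> (real \<Rightarrow> real \<Rightarrow> real \<Rightarrow> real) \<Rightarrow> (real \<Rightarrow> real) \<Rightarrow> real \<Rightarrow> real" where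
  "euler_delay h N K x t =
     (\<Sum>i\<in>{- int N..-1}. h * K t (of_int i * h) (x (t + of_int i * h)))"

text \<open>For \<open>t \<le> n * h\<close>, \<open>euler_upto b \<sigma> K \<phi> h N w n t\<close> is the value at \<open>t\<close> of the scheme driven by
  the path \<open>w\<close>; values at later times are irrelevant.\<close>

primrec euler_upto ::
    "(real \<Rightarrow> real \<Rightarrow> real \<Rightarrow> real) \<Rightarrow> (real \<Rightarrow> real \<Rightarrow> real \<Rightarrow> real)
      \<Rightarrow> (real \<Rightarrow> real \<Rightarrow> real \<Rightarrow> real) \<Rightarrow> (real \<Rightarrow> real) \<Rightarrow> real \<Rightarrow> nat \<Rightarrow> (real \<Rightarrow> real)
      \<Rightarrow> nat \<Rightarrow> real \<Rightarrow> real" where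
  "euler_upto b \<sigma> K \<phi> h N w 0 = \<phi>"
| "euler_upto b \<sigma> K \<phi> h N w (Suc n) =
     (let x = euler_upto b \<sigma> K \<phi> h N w n; tn = real n * h; y = euler_delay h N K x tn
      in (\<lambda>t. if t \<le> tn then x t
              else x tn + b tn (x tn) y * (t - tn) + \<sigma> tn (x tn) y * (w t - w tn)))"

definition euler_scheme ::
    "(real \<Rightarrow> real \<Rightarrow> real \<Rightarrow> real) \<Rightarrow> (real \<Rightarrow> real \<Rightarrow> real \<Rightarrow> real)
      \<Rightarrow> (real \<Rightarrow> real \<Rightarrow> real \<Rightarrow> real) \<Rightarrow> (real \<Rightarrow> real) \<Rightarrow> real \<Rightarrow> nat \<Rightarrow> (real \<Rightarrow> real)
      \<Rightarrow> real \<Rightarrow> real" where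
  "euler_scheme b \<sigma> K \<phi> T N w = euler_upto b \<sigma> K \<phi> (T / real N) N w N"

lemma euler_upto_stable:
  assumes "0 \<le> h" "n \<le> m" "t \<le> real n * h"
  shows "euler_upto b \<sigma> K \<phi> h N w m t = euler_upto b \<sigma> K \<phi> h N w n t"
  using assms(2)
proof (induction m rule: dec_induct)
  case (step m)
  have "t \<le> real m * h"
    using assms(1,3) step.hyps(1) mult_right_mono[of "real n" "real m" h] by simp
  then show ?case
    using step.IH by (simp add: Let_def)
qed simp

lemma euler_scheme_initial:
  assumes "0 < T" "t \<le> 0"
  shows "euler_scheme b \<sigma> K \<phi> T N w t = \<phi> t"
  using euler_upto_stable[of "T / real N" 0 N t] assms by (simp add: euler_scheme_def)

lemma euler_scheme_recursion:
  fixes N n :: nat and T t :: real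
    and b \<sigma> K :: "real \<Rightarrow> real \<Rightarrow> real \<Rightarrow> real" and \<phi> w :: "real \<Rightarrow> real"
  defines "h \<equiv> T / real N"
  defines "x \<equiv> euler_scheme b \<sigma> K \<phi> T N w"
  defines "tn \<equiv> real n * h"
  assumes "0 < T" "n < N" "t \<in> {tn..real (Suc n) * h}"
  shows "x t = x tn + b tn (x tn) (euler_delay h N K x tn) * (t - tn)
           + \<sigma> tn (x tn) (euler_delay h N K x tn) * (w t - w tn)"
proof -
  let ?u = "euler_upto b \<sigma> K \<phi> h N w"
  have h: "0 \<le> h" using \<open>0 < T\<close> by (simp add: h_def)
  have xn: "x s = ?u n s" if "s \<le> tn" for s
    using euler_upto_stable[OF h, of n N s] that \<open>n < N\<close>
    by (simp add: x_def euler_scheme_def h_def tn_def)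
  have "tn + of_int i * h \<le> tn" if "i \<le> -1" for i
    using that h by (simp add: mult_nonpos_nonneg)
  then have y: "euler_delay h N K x tn = euler_delay h N K (?u n) tn"
    unfolding euler_delay_def by (intro sum.cong refl) (simp add: xn)
  have "x t = ?u (Suc n) t"
    using euler_upto_stable[OF h, of "Suc n" N t] \<open>n < N\<close> assms(6)
    by (simp add: x_def euler_scheme_def h_def)
  then show ?thesis
    using assms(6) xn[of tn] y by (auto simp: Let_def tn_def)
qed

section \<open>The error functional\<close>

definition grid_floor :: "real \<Rightarrow> real \<Rightarrow> real" where
  "grid_floor h u = of_int \<lfloor>u / h\<rfloor> * h"

definition err_incr :: "(real \<Rightarrow> real) \<Rightarrow> (real \<Rightarrow> real) \<Rightarrow> real \<Rightarrow> real \<Rightarrow> real" where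
  "err_incr x z u s = \<bar>x s - z s - x u + z u\<bar>"

text \<open>The value lies in \<open>[0,\<infinity>]\<close>, so that a finite bound entails finiteness of the supremum and
  of all integrals.\<close>

definition euler_error ::
    "real \<Rightarrow> real \<Rightarrow> real \<Rightarrow> (real \<Rightarrow> real) \<Rightarrow> (real \<Rightarrow> real) \<Rightarrow> ennreal" where
  "euler_error T \<beta> h x z =
     (SUP y\<in>{0..T}. ennreal \<bar>x y - z y\<bar>
        + (\<integral>\<^sup>+v\<in>{0..y}. ennreal (err_incr x z v y / (y - v) powr (\<beta> + 1)) \<partial>lborel)
        + (\<integral>\<^sup>+v\<in>{0..grid_floor h y}. (\<integral>\<^sup>+s\<in>{- grid_floor h v..0}.
             ennreal (err_incr x z (v + s) (y + s) / (y - v) powr (\<beta> + 1)) \<partial>lborel) \<partial>lborel))"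

end

theory Submission
  imports Defs
begin

text \<open>The estimate is pathwise.  Almost every path of the driving process is Hoelder continuous of
  every order below \<open>H\<close>; for such a path one constant works for all step sizes, so the almost
  sure event on which the equation holds and the driver is regular serves every \<open>\<epsilon>\<close>.

  Fix such a path, put \<open>\<gamma> = \<beta> + \<delta>\<close> and \<open>\<mu> = H - \<delta>\<close> with a small \<open>\<delta> > 0\<close>, and let \<open>e\<close> be the
  difference of the solution and the Euler path.  Since \<open>\<gamma> > \<beta>\<close>, all three terms of the error
  functional are bounded by a multiple of the \<open>\<gamma>\<close>-Hoelder constant of \<open>e\<close>
  (\<open>euler_error_le\<close>), so it suffices that this constant is of order \<open>h powr (\<mu> - \<gamma>)\<close>: for small
  \<open>\<delta>\<close> the exponent \<open>\<mu> - \<gamma> = H - \<beta> - 2 * \<delta>\<close> is at least \<open>2 * H - 1 - \<beta>\<close>, while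
  \<open>\<gamma> + \<mu> = \<beta> + H > 1\<close> keeps all integrals in the Young regime.

  The stochastic integral enters only through the Young estimate
  \<open>gls_integral_young_estimate\<close>: over \<open>[s, t]\<close> it equals the integrand at \<open>s\<close> times the increment
  of the driver, up to \<open>(t - s) powr (\<nu> + \<mu>)\<close>.  That the integral over \<open>[s, t]\<close> is the difference
  of two integrals from \<open>0\<close> is not visible in its definition, because the fractional derivatives
  refer to both end points.  It is obtained by approximation with differentiable integrands, for
  which the integral is given by the integration by parts formula.

  Consequently the solution satisfies, on the grid, the recursion of the Euler scheme with a
  defect of order \<open>h powr (2 * \<mu>)\<close> per step, and \<open>e\<close> satisfies a discrete equation
  \<open>e (n + 1) = e n + \<beta> n * h + G n * (w (n + 1) - w n) + R n\<close> whose coefficients are differences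
  of those of the solution and of the scheme.  A discrete Gronwall lemma for such equations
  (\<open>discrete_young_gronwall\<close>) bounds their solutions in Hoelder norm, uniformly in the mesh, by
  the size \<open>a\<close> of the inhomogeneity.  It is used twice: with constant \<open>a\<close> for the scheme itself,
  whose Hoelder norm is thereby bounded uniformly in \<open>h\<close>, and with \<open>a\<close> of order
  \<open>h powr (\<mu> - \<gamma>)\<close> for the error.

  The second use needs the increments of \<open>G\<close> to be controlled by \<open>e\<close>, that is, a bound for a
  second-order difference of the diffusion coefficient.  This is where the Lipschitz continuous
  Frechet derivative enters (\<open>frechet_four_point\<close>), applied to segments obtained by piecewise
  linear interpolation of grid values.  Replacing the Riemann sums of the scheme by delay
  integrals costs an error of order \<open>h powr \<mu>\<close> at every node.  Distinct nodes being at least \<open>h\<close>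
  apart, such an error has increments at most \<open>h powr (\<mu> - \<gamma>)\<close> times the distance to the power
  \<open>\<gamma>\<close>: this loss determines the rate.  Between the nodes, solution and scheme are compared
  directly (\<open>cell_estimate\<close>).\<close>

section \<open>Power kernels and fractional derivatives of Hoelder functions\<close>

lemma powr_kernel_has_integral:
  fixes a x p :: real
  assumes "a \<le> x" "-1 < p"
  shows "((\<lambda>u. (x - u) powr p) has_integral ((x - a) powr (p + 1) / (p + 1))) {a..x}"
proof -
  have "((\<lambda>u. (x - u) powr p) has_integral
      (- ((x - x) powr (p + 1) / (p + 1)) - (- ((x - a) powr (p + 1) / (p + 1))))) {a..x}"
  proof (rule fundamental_theorem_of_calculus_interior)
    show "continuous_on {a..x} (\<lambda>u. - ((x - u) powr (p + 1) / (p + 1)))"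
      using assms by (intro continuous_intros continuous_on_powr') auto
    fix u assume u: "u \<in> {a<..<x}"
    have "((\<lambda>u. - ((x - u) powr (p + 1) / (p + 1))) has_real_derivative (x - u) powr p) (at u)"
      using u assms by (auto intro!: derivative_eq_intros simp: divide_simps powr_diff)
    then show "((\<lambda>u. - ((x - u) powr (p + 1) / (p + 1))) has_vector_derivative (x - u) powr p) (at u)"
      by (simp add: has_real_derivative_iff_has_vector_derivative)
  qed (use assms in auto)
  then show ?thesis using assms by simp
qed

lemma nn_integral_powr_kernel:
  fixes a x p :: real
  assumes "a \<le> x" "-1 < p"
  shows "(\<integral>\<^sup>+u\<in>{a..x}. ennreal ((x - u) powr p) \<partial>lborel) = ennreal ((x - a) powr (p + 1) / (p + 1))"
proof -
  have "(\<integral>\<^sup>+u. ennreal (indicator {a..x} u * (x - u) powr p) \<partial>lborel) = ennreal ((x - a) powr (p + 1) / (p + 1))"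
  proof (rule nn_integral_has_integral_lborel)
    have "(\<lambda>u. indicator {a..x} u * (x - u) powr p) = (\<lambda>u. if u \<in> {a..x} then (x - u) powr p else 0)"
      by auto
    then show "((\<lambda>u. indicator {a..x} u * (x - u) powr p) has_integral (x - a) powr (p + 1) / (p + 1)) UNIV"
      using powr_kernel_has_integral[OF assms] by (simp only: has_integral_restrict_UNIV)
  qed auto
  moreover have "(\<integral>\<^sup>+u\<in>{a..x}. ennreal ((x - u) powr p) \<partial>lborel)
     = (\<integral>\<^sup>+u. ennreal (indicator {a..x} u * (x - u) powr p) \<partial>lborel)"
    by (intro nn_integral_cong) (auto split: split_indicator)
  ultimately show ?thesis by simp
qed

lemma has_bochner_powr_kernel:
  fixes a x p :: real
  assumes "a \<le> x" "-1 < p"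
  shows "has_bochner_integral lborel (\<lambda>u. indicator {a..x} u *\<^sub>R (x - u) powr p)
           ((x - a) powr (p + 1) / (p + 1))"
proof (rule has_bochner_integral_nn_integral)
  have "(\<integral>\<^sup>+u. ennreal (indicator {a..x} u *\<^sub>R (x - u) powr p) \<partial>lborel)
     = (\<integral>\<^sup>+u\<in>{a..x}. ennreal ((x - u) powr p) \<partial>lborel)"
    by (intro nn_integral_cong) (auto split: split_indicator)
  then show "(\<integral>\<^sup>+u. ennreal (indicator {a..x} u *\<^sub>R (x - u) powr p) \<partial>lborel)
     = ennreal ((x - a) powr (p + 1) / (p + 1))"
    using nn_integral_powr_kernel[OF assms] by simp
qed (use assms in auto)

lemma set_integrable_powr_kernel:
  fixes a x p :: real
  assumes "a \<le> x" "-1 < p"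
  shows "set_integrable lborel {a..x} (\<lambda>u. (x - u) powr p)"
    and "(LBINT u:{a..x}. (x - u) powr p) = (x - a) powr (p + 1) / (p + 1)"
  using has_bochner_powr_kernel[OF assms]
  by (auto simp: set_integrable_def set_lebesgue_integral_def has_bochner_integral_iff)

lemma set_integrable_powr_kernel':
  fixes a x p :: real
  assumes "a \<le> x" "-1 < p"
  shows "set_integrable lborel {a..x} (\<lambda>u. (u - a) powr p)"
    and "(LBINT u:{a..x}. (u - a) powr p) = (x - a) powr (p + 1) / (p + 1)"
proof -
  have *: "{u. a \<le> - u \<and> - u \<le> x} = {-x..-a}" and **: "- a - u = - u - a" for u by auto
  show "(LBINT u:{a..x}. (u - a) powr p) = (x - a) powr (p + 1) / (p + 1)"
    using set_integrable_powr_kernel(2)[of "-x" "-a" p, unfolded **] assms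
    by (subst set_integral_reflect) (simp add: * add.commute)
  show "set_integrable lborel {a..x} (\<lambda>u. (u - a) powr p)"
    using set_integrable_powr_kernel(1)[of "-x" "-a" p] assms
    unfolding set_integrable_def
    by (subst (asm) lborel_integrable_real_affine_iff[of "-1" _ 0, symmetric])
       (auto simp: indicator_def algebra_simps conj_commute)
qed

text \<open>The condition is imposed on the whole line and carries its constant: Steklov means of the
  function then keep the constant without any boundary correction, and dominated convergence has
  its uniform majorant.  Functions on an interval are extended by clamping the argument
  (\<open>hoelder_const_clamp\<close>), which also keeps the constant.\<close>

definition hoelder_const :: "real \<Rightarrow> real \<Rightarrow> (real \<Rightarrow> real) \<Rightarrow> bool" where
  "hoelder_const L \<nu> f \<longleftrightarrow> (\<forall>s t. \<bar>f t - f s\<bar> \<le> L * \<bar>t - s\<bar> powr \<nu>)"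

lemma hoelder_constD: "hoelder_const L \<nu> f \<Longrightarrow> \<bar>f t - f s\<bar> \<le> L * \<bar>t - s\<bar> powr \<nu>"
  by (simp add: hoelder_const_def)

lemma hoelder_const_nonneg:
  assumes "hoelder_const L \<nu> f" shows "0 \<le> L"
  using hoelder_constD[OF assms, of 1 0] by simp

lemma hoelder_const_continuous:
  assumes "hoelder_const L \<nu> f" "0 < \<nu>"
  shows "continuous_on UNIV f"
proof -
  have "(f \<longlongrightarrow> f x) (at x)" for x
  proof -
    have "((\<lambda>t. L * \<bar>t - x\<bar> powr \<nu>) \<longlongrightarrow> L * 0) (at x)"
      using assms(2) by (intro tendsto_mult tendsto_const tendsto_zero_powrI)
        (auto intro!: tendsto_eq_intros)
    then have l: "((\<lambda>t. L * \<bar>t - x\<bar> powr \<nu>) \<longlongrightarrow> 0) (at x)" by simp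
    have "((\<lambda>t. f t - f x) \<longlongrightarrow> 0) (at x)"
      by (rule Lim_null_comparison[OF _ l]) (simp add: hoelder_constD[OF assms(1)])
    then show ?thesis by (simp add: LIM_zero_iff)
  qed
  then show ?thesis by (simp add: continuous_on_def)
qed

lemma hoelder_const_measurable:
  assumes "hoelder_const L \<nu> f" "0 < \<nu>"
  shows "f \<in> borel_measurable borel"
  using borel_measurable_continuous_onI[OF hoelder_const_continuous[OF assms]] .

lemma hoelder_quotient:
  assumes "hoelder_const L \<nu> f" "0 < \<nu>" "u \<le> x"
  shows "\<bar>f x - f u\<bar> / (x - u) powr (\<alpha> + 1) \<le> L * (x - u) powr (\<nu> - \<alpha> - 1)"
proof (cases "u = x")
  case False
  then have "\<bar>f x - f u\<bar> / (x - u) powr (\<alpha> + 1) \<le> L * (x - u) powr \<nu> / (x - u) powr (\<alpha> + 1)"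
    using hoelder_constD[OF assms(1), of x u] assms by (intro divide_right_mono) auto
  also have "\<dots> = L * (x - u) powr (\<nu> - \<alpha> - 1)"
    using False assms by (simp add: powr_diff powr_add)
  finally show ?thesis .
qed simp

lemma frac_integrand_integrable:
  assumes f: "hoelder_const L \<nu> f" "0 < \<nu>" and "\<alpha> < \<nu>" "a \<le> x"
  shows "set_integrable lborel {a..x} (\<lambda>u. (f x - f u) / (x - u) powr (\<alpha> + 1))"
    and "\<bar>LBINT u:{a..x}. (f x - f u) / (x - u) powr (\<alpha> + 1)\<bar> \<le> L * (x - a) powr (\<nu> - \<alpha>) / (\<nu> - \<alpha>)"
proof -
  have m[measurable]: "f \<in> borel_measurable borel" using hoelder_const_measurable[OF f] .
  have k: "set_integrable lborel {a..x} (\<lambda>u. L * (x - u) powr (\<nu> - \<alpha> - 1))"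
    using set_integrable_powr_kernel(1)[of a x "\<nu> - \<alpha> - 1"] assms by auto
  show i: "set_integrable lborel {a..x} (\<lambda>u. (f x - f u) / (x - u) powr (\<alpha> + 1))"
    by (rule set_integrable_bound[OF k])
       (use hoelder_quotient[OF f] hoelder_const_nonneg[OF f(1)] in \<open>auto simp: set_borel_measurable_def abs_mult\<close>)
  have "\<bar>LBINT u:{a..x}. (f x - f u) / (x - u) powr (\<alpha> + 1)\<bar>
      \<le> (LBINT u:{a..x}. \<bar>(f x - f u) / (x - u) powr (\<alpha> + 1)\<bar>)"
    using set_integral_norm_bound[OF i] by simp
  also have "\<dots> \<le> (LBINT u:{a..x}. L * (x - u) powr (\<nu> - \<alpha> - 1))"
    using hoelder_quotient[OF f] k set_integrable_abs[OF i] by (intro set_integral_mono) auto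
  also have "\<dots> = L * (x - a) powr (\<nu> - \<alpha>) / (\<nu> - \<alpha>)"
    using set_integrable_powr_kernel(2)[of a x "\<nu> - \<alpha> - 1"] assms by (simp add: set_integral_mult_right)
  finally show "\<bar>LBINT u:{a..x}. (f x - f u) / (x - u) powr (\<alpha> + 1)\<bar> \<le> L * (x - a) powr (\<nu> - \<alpha>) / (\<nu> - \<alpha>)" .
qed

text \<open>The Marchaud integrand is at most \<open>L * (x - u) powr (\<nu> - \<alpha> - 1)\<close>, an integrable kernel as
  \<open>\<nu> > \<alpha>\<close>.  The two summands of the bound matter separately: when \<open>f a = 0\<close> the derivative
  vanishes at \<open>a\<close> at the rate \<open>\<nu> - \<alpha>\<close>, which makes the Young estimate possible.\<close>

lemma frac_deriv_left_bound:
  assumes f: "hoelder_const L \<nu> f" "0 < \<nu>" and \<alpha>: "0 < \<alpha>" "\<alpha> < \<nu>" "\<alpha> < 1" and "a < x"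
  shows "\<bar>frac_deriv_left \<alpha> a f x\<bar>
    \<le> (\<bar>f a\<bar> * (x - a) powr (-\<alpha>) + L * (\<nu> / (\<nu> - \<alpha>)) * (x - a) powr (\<nu> - \<alpha>)) / Gamma (1 - \<alpha>)"
proof -
  have "\<bar>f x\<bar> \<le> \<bar>f a\<bar> + L * (x - a) powr \<nu>"
    using hoelder_constD[OF f(1), of x a] assms by simp
  then have "\<bar>f x\<bar> / (x - a) powr \<alpha> \<le> (\<bar>f a\<bar> + L * (x - a) powr \<nu>) / (x - a) powr \<alpha>"
    by (intro divide_right_mono) auto
  also have "\<dots> = \<bar>f a\<bar> * (x - a) powr (-\<alpha>) + L * (x - a) powr (\<nu> - \<alpha>)"
    using assms by (simp add: powr_diff powr_minus divide_simps)
  finally have 1: "\<bar>f x\<bar> / (x - a) powr \<alpha> \<le> \<bar>f a\<bar> * (x - a) powr (-\<alpha>) + L * (x - a) powr (\<nu> - \<alpha>)" .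
  let ?I = "LBINT u:{a..x}. (f x - f u) / (x - u) powr (\<alpha> + 1)"
  have 2: "\<alpha> * \<bar>?I\<bar> \<le> \<alpha> * (L * (x - a) powr (\<nu> - \<alpha>) / (\<nu> - \<alpha>))"
    using frac_integrand_integrable(2)[OF f, of \<alpha> a x] assms by (intro mult_left_mono) auto
  have "\<bar>f x / (x - a) powr \<alpha> + \<alpha> * ?I\<bar> \<le> \<bar>f x\<bar> / (x - a) powr \<alpha> + \<alpha> * \<bar>?I\<bar>"
    using \<alpha> by (intro order_trans[OF abs_triangle_ineq]) (simp add: abs_mult)
  also have "\<dots> \<le> \<bar>f a\<bar> * (x - a) powr (-\<alpha>) + L * (x - a) powr (\<nu> - \<alpha>) + \<alpha> * (L * (x - a) powr (\<nu> - \<alpha>) / (\<nu> - \<alpha>))"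
    using 1 2 by linarith
  also have "\<dots> = \<bar>f a\<bar> * (x - a) powr (-\<alpha>) + L * (\<nu> / (\<nu> - \<alpha>)) * (x - a) powr (\<nu> - \<alpha>)"
    using \<alpha> by (simp add: field_simps)
  finally have 3: "\<bar>f x / (x - a) powr \<alpha> + \<alpha> * ?I\<bar> \<le> \<dots>" .
  have "0 < Gamma (1 - \<alpha>)" using \<alpha> by (intro Gamma_real_pos) auto
  then show ?thesis unfolding frac_deriv_left_def using 3
    by (simp add: abs_mult divide_right_mono)
qed

text \<open>Time reversal exchanges the two derivatives; every fact about the right-sided one is inherited
  from its left-sided counterpart.\<close>

lemma frac_deriv_right_reflect:
  "frac_deriv_right \<alpha> b g x = frac_deriv_left \<alpha> (-b) (\<lambda>u. g (-u)) (-x)"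
proof -
  have *: "{u. x \<le> - u \<and> - u \<le> b} = {-b..-x}" by auto
  have "(LBINT u:{x..b}. (g x - g u) / (u - x) powr (\<alpha> + 1)) =
     (LBINT u:{-b..-x}. (g x - g (-u)) / (-x - u) powr (\<alpha> + 1))"
    by (subst set_integral_reflect) (simp add: * minus_diff_commute)
  then show ?thesis
    unfolding frac_deriv_right_def frac_deriv_left_def
    by simp
qed

lemma hoelder_const_reflect:
  "hoelder_const L \<nu> g \<Longrightarrow> hoelder_const L \<nu> (\<lambda>u. g (-u))"
  unfolding hoelder_const_def
proof (intro allI)
  fix s t assume "\<forall>s t. \<bar>g t - g s\<bar> \<le> L * \<bar>t - s\<bar> powr \<nu>"
  from this[rule_format, of "-t" "-s"] show "\<bar>g (- t) - g (- s)\<bar> \<le> L * \<bar>t - s\<bar> powr \<nu>"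
    by (simp add: abs_minus_commute)
qed

lemma hoelder_const_shift:
  "hoelder_const L \<nu> g \<Longrightarrow> hoelder_const L \<nu> (\<lambda>u. g u - c)"
  by (simp add: hoelder_const_def)

lemma frac_deriv_right_bound:
  assumes g: "hoelder_const L \<mu> g" "0 < \<mu>" and \<alpha>: "0 < \<alpha>" "1 - \<alpha> < \<mu>" "\<alpha> < 1" and "x < b"
  shows "\<bar>frac_deriv_right (1 - \<alpha>) b (\<lambda>u. g u - g b) x\<bar>
    \<le> L * (\<mu> / (\<mu> + \<alpha> - 1)) / Gamma \<alpha> * (b - x) powr (\<mu> + \<alpha> - 1)"
  unfolding frac_deriv_right_reflect
  using frac_deriv_left_bound[OF hoelder_const_reflect[OF hoelder_const_shift[OF g(1), of "g b"]] g(2), of "1 - \<alpha>" "-b" "-x"] assms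
  by (simp add: algebra_simps)

lemma frac_deriv_left_measurable:
  assumes [measurable]: "f \<in> borel_measurable borel"
  shows "frac_deriv_left \<alpha> a f \<in> borel_measurable borel"
proof -
  have eq: "(LBINT u:{a..x}. (f x - f u) / (x - u) powr (\<alpha> + 1)) =
     (LINT u|lborel. (if a \<le> u \<and> u \<le> x then (f x - f u) / (x - u) powr (\<alpha> + 1) else 0))" for x
    unfolding set_lebesgue_integral_def by (intro Bochner_Integration.integral_cong) auto
  have [measurable]: "(\<lambda>x. LINT u|lborel. (if a \<le> u \<and> u \<le> x then (f x - f u) / (x - u) powr (\<alpha> + 1) else 0)) \<in> borel_measurable borel"
    by (rule lborel.borel_measurable_lebesgue_integral) measurable
  show ?thesis unfolding frac_deriv_left_def eq by measurable
qed

lemma frac_deriv_right_measurable: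
  assumes [measurable]: "f \<in> borel_measurable borel"
  shows "frac_deriv_right \<alpha> b f \<in> borel_measurable borel"
proof -
  have [measurable]: "frac_deriv_left \<alpha> (-b) (\<lambda>u. f (-u)) \<in> borel_measurable borel"
    by (rule frac_deriv_left_measurable) measurable
  show ?thesis unfolding frac_deriv_right_reflect[abs_def] by measurable
qed

lemma frac_deriv_left_at [simp]: "frac_deriv_left \<alpha> a f a = 0"
proof -
  have "(LBINT u:{a..a}. (f a - f u) / (a - u) powr (\<alpha> + 1)) = (LBINT u:{a..a}. 0)"
    by (intro set_lebesgue_integral_cong) auto
  then show ?thesis by (simp add: frac_deriv_left_def)
qed

lemma frac_deriv_right_at [simp]: "frac_deriv_right \<alpha> b g b = 0"
  by (simp add: frac_deriv_right_reflect)

context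
  fixes \<alpha> \<nu> \<mu> L L' a b :: real and f g :: "real \<Rightarrow> real"
  assumes \<alpha>: "0 < \<alpha>" "\<alpha> < 1" "\<alpha> < \<nu>" "1 - \<alpha> < \<mu>"
    and f: "hoelder_const L \<nu> f" and g: "hoelder_const L' \<mu> g"
begin

lemma gls_integrand_bound:
  assumes x: "x \<in> {a..b}"
  shows "\<bar>frac_deriv_left \<alpha> a f x * frac_deriv_right (1 - \<alpha>) b (\<lambda>u. g u - g b) x\<bar>
    \<le> (\<bar>f a\<bar> * (x - a) powr (-\<alpha>) + L * (\<nu> / (\<nu> - \<alpha>)) * (b - a) powr (\<nu> - \<alpha>)) / Gamma (1 - \<alpha>)
      * (L' * (\<mu> / (\<mu> + \<alpha> - 1)) / Gamma \<alpha> * (b - a) powr (\<mu> + \<alpha> - 1))"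
proof -
  have G: "0 < Gamma (1 - \<alpha>)" "0 < Gamma \<alpha>" using \<alpha> by (auto intro!: Gamma_real_pos)
  have L: "0 \<le> L" "0 \<le> L'" using f g hoelder_const_nonneg by auto
  have 1: "\<bar>frac_deriv_left \<alpha> a f x\<bar> \<le> (\<bar>f a\<bar> * (x - a) powr (-\<alpha>) + L * (\<nu> / (\<nu> - \<alpha>)) * (b - a) powr (\<nu> - \<alpha>)) / Gamma (1 - \<alpha>)"
  proof (cases "x = a")
    case False
    have "(x - a) powr (\<nu> - \<alpha>) \<le> (b - a) powr (\<nu> - \<alpha>)"
      using x \<alpha> by (intro powr_mono2) auto
    then have "L * (\<nu> / (\<nu> - \<alpha>)) * (x - a) powr (\<nu> - \<alpha>) \<le> L * (\<nu> / (\<nu> - \<alpha>)) * (b - a) powr (\<nu> - \<alpha>)"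
      using L \<alpha> by (intro mult_left_mono) auto
    then show ?thesis
      using frac_deriv_left_bound[OF f, of \<alpha> a x] \<alpha> x False G
      by (smt (verit) divide_right_mono atLeastAtMost_iff)
  qed (use L G \<alpha> in auto)
  have 2: "\<bar>frac_deriv_right (1 - \<alpha>) b (\<lambda>u. g u - g b) x\<bar> \<le> L' * (\<mu> / (\<mu> + \<alpha> - 1)) / Gamma \<alpha> * (b - a) powr (\<mu> + \<alpha> - 1)"
  proof (cases "x = b")
    case False
    have "(b - x) powr (\<mu> + \<alpha> - 1) \<le> (b - a) powr (\<mu> + \<alpha> - 1)"
      using x \<alpha> by (intro powr_mono2) auto
    then have "L' * (\<mu> / (\<mu> + \<alpha> - 1)) / Gamma \<alpha> * (b - x) powr (\<mu> + \<alpha> - 1) \<le> L' * (\<mu> / (\<mu> + \<alpha> - 1)) / Gamma \<alpha> * (b - a) powr (\<mu> + \<alpha> - 1)"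
      using L \<alpha> G by (intro mult_left_mono) auto
    then show ?thesis
      using frac_deriv_right_bound[OF g, of \<alpha> x b] \<alpha> x False G by force
  qed (use L G \<alpha> in auto)
  show ?thesis unfolding abs_mult using 1 2 by (intro mult_mono) auto
qed

lemma gls_integrand_dominating:
  "set_integrable lborel {a..b} (\<lambda>x. (A * (x - a) powr (-\<alpha>) + B) / C * (D :: real))"
proof (cases "a \<le> b")
  case True
  have "set_integrable lborel {a..b} (\<lambda>x. (x - a) powr (-\<alpha>))"
    using set_integrable_powr_kernel'(1)[of a b "-\<alpha>"] \<alpha> True by auto
  moreover have "set_integrable lborel {a..b} (\<lambda>x. B)"
    by (intro borel_integrable_atLeastAtMost' continuous_intros)
  ultimately show ?thesis by (intro set_integrable_mult_left set_integrable_divide set_integral_add set_integrable_mult_right) auto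
qed simp

lemma gls_integrable:
  "set_integrable lborel {a..b} (\<lambda>x. frac_deriv_left \<alpha> a f x * frac_deriv_right (1 - \<alpha>) b (\<lambda>u. g u - g b) x)"
proof -
  have [measurable]: "f \<in> borel_measurable borel" "g \<in> borel_measurable borel"
    using hoelder_const_measurable[OF f] hoelder_const_measurable[OF g] \<alpha> by auto
  have [measurable]: "frac_deriv_left \<alpha> a f \<in> borel_measurable borel"
     "frac_deriv_right (1 - \<alpha>) b (\<lambda>u. g u - g b) \<in> borel_measurable borel"
    by (intro frac_deriv_left_measurable frac_deriv_right_measurable; measurable)+
  show ?thesis
  proof (rule set_integrable_bound[OF gls_integrand_dominating])
    show "AE x in lborel. x \<in> {a..b} \<longrightarrow>
        norm (frac_deriv_left \<alpha> a f x * frac_deriv_right (1 - \<alpha>) b (\<lambda>u. g u - g b) x)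
        \<le> norm ((\<bar>f a\<bar> * (x - a) powr (-\<alpha>) + L * (\<nu> / (\<nu> - \<alpha>)) * (b - a) powr (\<nu> - \<alpha>)) / Gamma (1 - \<alpha>)
           * (L' * (\<mu> / (\<mu> + \<alpha> - 1)) / Gamma \<alpha> * (b - a) powr (\<mu> + \<alpha> - 1)))"
      unfolding real_norm_def by (intro AE_I2 impI order_trans[OF gls_integrand_bound abs_ge_self])
  qed (simp add: set_borel_measurable_def)
qed

text \<open>The factors of the integrand contribute the exponents \<open>\<nu> - \<alpha>\<close> and \<open>\<mu> + \<alpha> - 1\<close>, the length of the
  interval contributes \<open>1\<close>, so the order \<open>\<alpha>\<close> cancels.  This is the estimate for the remainder of a
  Young integral.\<close>

lemma gls_value_bound:
  assumes "f a = 0" "a \<le> b"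
  shows "\<bar>gls_value \<alpha> f g a b\<bar>
    \<le> (\<nu> / (\<nu> - \<alpha>)) / Gamma (1 - \<alpha>) * ((\<mu> / (\<mu> + \<alpha> - 1)) / Gamma \<alpha>) * L * L' * (b - a) powr (\<nu> + \<mu>)"
proof -
  let ?c = "(L * (\<nu> / (\<nu> - \<alpha>)) * (b - a) powr (\<nu> - \<alpha>)) / Gamma (1 - \<alpha>)
      * (L' * (\<mu> / (\<mu> + \<alpha> - 1)) / Gamma \<alpha> * (b - a) powr (\<mu> + \<alpha> - 1))"
  let ?F = "\<lambda>x. frac_deriv_left \<alpha> a f x * frac_deriv_right (1 - \<alpha>) b (\<lambda>u. g u - g b) x"
  have "\<bar>LBINT x:{a..b}. ?F x\<bar> \<le> (LBINT x:{a..b}. \<bar>?F x\<bar>)"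
    using set_integral_norm_bound[OF gls_integrable] by simp
  also have "\<dots> \<le> (LBINT x:{a..b}. ?c)"
  proof (rule set_integral_mono[OF set_integrable_abs[OF gls_integrable]])
    show "set_integrable lborel {a..b} (\<lambda>x. ?c)"
      by (intro borel_integrable_atLeastAtMost' continuous_on_const)
    show "\<bar>?F x\<bar> \<le> ?c" if "x \<in> {a..b}" for x
      using gls_integrand_bound[OF that] assms(1) by simp
  qed
  also have "\<dots> = ?c * (b - a)" using assms by (simp add: set_lebesgue_integral_def)
  also have "\<dots> = (\<nu> / (\<nu> - \<alpha>)) / Gamma (1 - \<alpha>) * ((\<mu> / (\<mu> + \<alpha> - 1)) / Gamma \<alpha>) * L * L' * 
      ((b - a) powr (\<nu> - \<alpha>) * (b - a) powr (\<mu> + \<alpha> - 1) * (b - a) powr 1)"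
    using assms(2) by simp
  also have "(b - a) powr (\<nu> - \<alpha>) * (b - a) powr (\<mu> + \<alpha> - 1) * (b - a) powr 1 = (b - a) powr (\<nu> + \<mu>)"
    unfolding powr_add[symmetric] by simp
  finally show ?thesis by (simp add: gls_value_def)
qed

end

section \<open>Approximation and fractional integration by parts\<close>

lemma frac_deriv_left_tendsto:
  assumes f: "\<And>n. hoelder_const L \<nu> (fn n)" "hoelder_const L \<nu> f" "0 < \<nu>" and \<alpha>: "\<alpha> < \<nu>" and "a \<le> x"
    and lim: "\<And>x. (\<lambda>n. fn n x) \<longlonglongrightarrow> f x"
  shows "(\<lambda>n. frac_deriv_left \<alpha> a (fn n) x) \<longlonglongrightarrow> frac_deriv_left \<alpha> a f x"
proof -
  have m[measurable]: "f \<in> borel_measurable borel" "fn n \<in> borel_measurable borel" for n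
    using hoelder_const_measurable f by blast+
  have k: "set_integrable lborel {a..x} (\<lambda>u. L * (x - u) powr (\<nu> - \<alpha> - 1))"
    using set_integrable_powr_kernel(1)[of a x "\<nu> - \<alpha> - 1"] assms by auto
  have "(\<lambda>n. LBINT u:{a..x}. (fn n x - fn n u) / (x - u) powr (\<alpha> + 1)) \<longlonglongrightarrow> (LBINT u:{a..x}. (f x - f u) / (x - u) powr (\<alpha> + 1))"
    unfolding set_lebesgue_integral_def
  proof (rule integral_dominated_convergence[where w="\<lambda>u. indicator {a..x} u *\<^sub>R (L * (x - u) powr (\<nu> - \<alpha> - 1))"])
    show "AE u in lborel. (\<lambda>n. indicator {a..x} u *\<^sub>R ((fn n x - fn n u) / (x - u) powr (\<alpha> + 1)))
          \<longlonglongrightarrow> indicator {a..x} u *\<^sub>R ((f x - f u) / (x - u) powr (\<alpha> + 1))"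
      unfolding divide_inverse by (intro AE_I2 tendsto_scaleR tendsto_mult tendsto_diff tendsto_const lim)
    show "AE u in lborel. norm (indicator {a..x} u *\<^sub>R ((fn n x - fn n u) / (x - u) powr (\<alpha> + 1)))
           \<le> indicator {a..x} u *\<^sub>R (L * (x - u) powr (\<nu> - \<alpha> - 1))" for n
      using hoelder_quotient[OF f(1) f(3)] by (intro AE_I2) (simp split: split_indicator)
  qed (use k in \<open>auto simp: set_integrable_def\<close>)
  then show ?thesis
    unfolding frac_deriv_left_def divide_inverse by (intro tendsto_mult tendsto_add tendsto_const lim)
qed

lemma frac_deriv_right_tendsto:
  assumes "\<And>n. hoelder_const L \<nu> (fn n)" "hoelder_const L \<nu> f" "0 < \<nu>" and "\<alpha> < \<nu>" and "x \<le> b"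
    and "\<And>x. (\<lambda>n. fn n x) \<longlonglongrightarrow> f x"
  shows "(\<lambda>n. frac_deriv_right \<alpha> b (fn n) x) \<longlonglongrightarrow> frac_deriv_right \<alpha> b f x"
  unfolding frac_deriv_right_reflect
  using assms by (intro frac_deriv_left_tendsto[of L \<nu>] hoelder_const_reflect) auto

text \<open>The common Hoelder constants give a common integrable majorant.  Identities for the integral thus
  need to be verified for differentiable functions only.\<close>

lemma gls_value_tendsto:
  assumes \<alpha>: "0 < \<alpha>" "\<alpha> < 1" "\<alpha> < \<nu>" "1 - \<alpha> < \<mu>"
    and f: "\<And>n. hoelder_const L \<nu> (fn n)" "hoelder_const L \<nu> f" "\<And>x. (\<lambda>n. fn n x) \<longlonglongrightarrow> f x"
    and g: "\<And>n. hoelder_const L' \<mu> (gn n)" "hoelder_const L' \<mu> g" "\<And>x. (\<lambda>n. gn n x) \<longlonglongrightarrow> g x"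
  shows "(\<lambda>n. gls_value \<alpha> (fn n) (gn n) a b) \<longlonglongrightarrow> gls_value \<alpha> f g a b"
proof -
  obtain A where A: "\<bar>fn n a\<bar> \<le> A" for n
    using convergent_imp_Bseq[of "\<lambda>n. fn n a"] f(3)[of a] by (auto simp: convergent_def Bseq_def)
  have G: "0 < Gamma (1 - \<alpha>)" "0 < Gamma \<alpha>" using \<alpha> by (auto intro!: Gamma_real_pos)
  have L: "0 \<le> L" "0 \<le> L'" using f(2) g(2) hoelder_const_nonneg by auto
  let ?F = "\<lambda>f g x. frac_deriv_left \<alpha> a f x * frac_deriv_right (1 - \<alpha>) b (\<lambda>u. g u - g b) x"
  let ?w = "\<lambda>x. (A * (x - a) powr (-\<alpha>) + L * (\<nu> / (\<nu> - \<alpha>)) * (b - a) powr (\<nu> - \<alpha>)) / Gamma (1 - \<alpha>)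
      * (L' * (\<mu> / (\<mu> + \<alpha> - 1)) / Gamma \<alpha> * (b - a) powr (\<mu> + \<alpha> - 1))"
  have "(\<lambda>n. LBINT x:{a..b}. ?F (fn n) (gn n) x) \<longlonglongrightarrow> (LBINT x:{a..b}. ?F f g x)"
    unfolding set_lebesgue_integral_def
  proof (rule integral_dominated_convergence[where w="\<lambda>x. indicator {a..b} x *\<^sub>R ?w x"])
    have "(\<lambda>n. ?F (fn n) (gn n) x) \<longlonglongrightarrow> ?F f g x" if "x \<in> {a..b}" for x
      using that \<alpha> f g
      by (intro tendsto_mult frac_deriv_left_tendsto[of L \<nu>] frac_deriv_right_tendsto[of L' \<mu>] hoelder_const_shift tendsto_diff) auto
    then show "AE x in lborel. (\<lambda>n. indicator {a..b} x *\<^sub>R ?F (fn n) (gn n) x) \<longlonglongrightarrow> indicator {a..b} x *\<^sub>R ?F f g x"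
      by (intro AE_I2) (auto split: split_indicator)
    show "AE x in lborel. norm (indicator {a..b} x *\<^sub>R ?F (fn n) (gn n) x) \<le> indicator {a..b} x *\<^sub>R ?w x" for n
    proof (intro AE_I2)
      fix x
      show "norm (indicator {a..b} x *\<^sub>R ?F (fn n) (gn n) x) \<le> indicator {a..b} x *\<^sub>R ?w x"
      proof (cases "x \<in> {a..b}")
        case True
        have "\<bar>?F (fn n) (gn n) x\<bar> \<le> (\<bar>fn n a\<bar> * (x - a) powr (-\<alpha>) + L * (\<nu> / (\<nu> - \<alpha>)) * (b - a) powr (\<nu> - \<alpha>)) / Gamma (1 - \<alpha>)
      * (L' * (\<mu> / (\<mu> + \<alpha> - 1)) / Gamma \<alpha> * (b - a) powr (\<mu> + \<alpha> - 1))"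
          by (rule gls_integrand_bound[OF \<alpha> f(1) g(1) True])
        also have "\<dots> \<le> ?w x"
          using A[of n] L G \<alpha> by (intro mult_right_mono divide_right_mono add_right_mono) auto
        finally show ?thesis using True by simp
      qed simp
    qed
    show "integrable lborel (\<lambda>x. indicator {a..b} x *\<^sub>R ?w x)"
      using gls_integrand_dominating[OF \<alpha> f(2) g(2)] by (simp add: set_integrable_def)
    show "(\<lambda>x. indicator {a..b} x *\<^sub>R ?F f g x) \<in> borel_measurable lborel"
      using gls_integrable[OF \<alpha> f(2) g(2)] unfolding set_integrable_def by (rule borel_measurable_integrable)
    show "(\<lambda>x. indicator {a..b} x *\<^sub>R ?F (fn n) (gn n) x) \<in> borel_measurable lborel" for n
      using gls_integrable[OF \<alpha> f(1) g(1)] unfolding set_integrable_def by (rule borel_measurable_integrable)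
  qed
  then show ?thesis unfolding gls_value_def by (rule tendsto_minus)
qed

text \<open>Integration by parts turns the Marchaud form into the Riemann-Liouville form.  The boundary term
  at \<open>u = x\<close> is \<open>(f x - f u) * (x - u) powr (-\<alpha>)\<close>, which tends to \<open>0\<close> because \<open>\<nu> > \<alpha>\<close>.\<close>

lemma frac_integral_by_parts:
  assumes f: "hoelder_const L \<nu> f" and \<alpha>: "0 < \<alpha>" "\<alpha> < 1" "\<alpha> < \<nu>" and "a < x"
    and f': "\<And>u. (f has_real_derivative f' u) (at u)" and cont: "continuous_on UNIV f'"
  shows "set_integrable lborel {a..x} (\<lambda>u. f' u * (x - u) powr (-\<alpha>))"
    and "\<alpha> * (LBINT u:{a..x}. (f x - f u) / (x - u) powr (\<alpha> + 1))
      = (LBINT u:{a..x}. f' u * (x - u) powr (-\<alpha>)) - (f x - f a) * (x - a) powr (-\<alpha>)"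
proof -
  have [measurable]: "f' \<in> borel_measurable borel" using cont by (rule borel_measurable_continuous_onI)
  have "compact (f' ` {a..x})" using cont by (intro compact_continuous_image) (auto intro: continuous_on_subset)
  then obtain C where C: "\<And>u. u \<in> {a..x} \<Longrightarrow> \<bar>f' u\<bar> \<le> C"
    using compact_imp_bounded[of "f' ` {a..x}"] unfolding bounded_iff by (metis imageI real_norm_def)
  have k: "set_integrable lborel {a..x} (\<lambda>u. C * (x - u) powr (-\<alpha>))"
    using set_integrable_powr_kernel(1)[of a x "-\<alpha>"] \<alpha> \<open>a < x\<close> by auto
  show i1: "set_integrable lborel {a..x} (\<lambda>u. f' u * (x - u) powr (-\<alpha>))"
  proof (rule set_integrable_bound[OF k])
    show "AE u in lborel. u \<in> {a..x} \<longrightarrow> norm (f' u * (x - u) powr (-\<alpha>)) \<le> norm (C * (x - u) powr (-\<alpha>))"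
    proof (intro AE_I2 impI)
      fix u assume "u \<in> {a..x}"
      then have "\<bar>f' u\<bar> * (x - u) powr (-\<alpha>) \<le> \<bar>C\<bar> * (x - u) powr (-\<alpha>)"
        using C[of u] by (intro mult_right_mono) auto
      then show "norm (f' u * (x - u) powr (-\<alpha>)) \<le> norm (C * (x - u) powr (-\<alpha>))"
        by (simp add: abs_mult)
    qed
  qed (simp add: set_borel_measurable_def)
  have i2: "set_integrable lborel {a..x} (\<lambda>u. (f x - f u) / (x - u) powr (\<alpha> + 1))"
    using frac_integrand_integrable(1)[OF f, of \<alpha> a x] \<alpha> \<open>a < x\<close> by auto
  define P where "P u = (f x - f u) * (x - u) powr (-\<alpha>)" for u
  have "((\<lambda>u. \<alpha> * ((f x - f u) / (x - u) powr (\<alpha> + 1)) - f' u * (x - u) powr (-\<alpha>)) has_integral (P x - P a)) {a..x}"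
  proof (rule fundamental_theorem_of_calculus_interior)
    fix u assume u: "u \<in> {a<..<x}"
    have "(P has_real_derivative \<alpha> * ((f x - f u) / (x - u) powr (\<alpha> + 1)) - f' u * (x - u) powr (-\<alpha>)) (at u)"
      unfolding P_def using u
      by (auto intro!: derivative_eq_intros f' simp: powr_diff powr_minus powr_add field_simps)
    then show "(P has_vector_derivative \<alpha> * ((f x - f u) / (x - u) powr (\<alpha> + 1)) - f' u * (x - u) powr (-\<alpha>)) (at u)"
      by (simp add: has_real_derivative_iff_has_vector_derivative)
  next
    have P_le: "\<bar>P u\<bar> \<le> L * \<bar>u - x\<bar> powr (\<nu> - \<alpha>)" if "u \<in> {a..x}" for u
    proof (cases "u = x")
      case False
      have "\<bar>P u\<bar> = \<bar>f x - f u\<bar> * (x - u) powr (-\<alpha>)" by (simp add: P_def abs_mult)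
      also have "\<dots> \<le> (L * (x - u) powr \<nu>) * (x - u) powr (-\<alpha>)"
        using hoelder_constD[OF f, of x u] that by (intro mult_right_mono) auto
      also have "\<dots> = L * \<bar>u - x\<bar> powr (\<nu> - \<alpha>)"
      proof -
        have "\<bar>u - x\<bar> = x - u" using that by auto
        then show ?thesis by (simp only: mult.assoc powr_add[symmetric]) simp
      qed
      finally show ?thesis .
    qed (simp add: P_def)
    show "continuous_on {a..x} P"
      unfolding continuous_on_def
    proof
      fix y assume y: "y \<in> {a..x}"
      show "(P \<longlongrightarrow> P y) (at y within {a..x})"
      proof (cases "y = x")
        case True
        have "((\<lambda>u. \<bar>u - x\<bar>) \<longlongrightarrow> 0) (at x within {a..x})"
          using tendsto_rabs_zero[of "\<lambda>u. u - x"] by (simp add: LIM_zero)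
        then have "((\<lambda>u. L * \<bar>u - x\<bar> powr (\<nu> - \<alpha>)) \<longlongrightarrow> L * 0) (at x within {a..x})"
          using \<alpha> by (intro tendsto_mult tendsto_const tendsto_zero_powrI[OF _ tendsto_const]) auto
        then have l: "((\<lambda>u. L * \<bar>u - x\<bar> powr (\<nu> - \<alpha>)) \<longlongrightarrow> 0) (at x within {a..x})" by simp
        have "(P \<longlongrightarrow> 0) (at x within {a..x})"
          by (rule Lim_null_comparison[OF _ l])
             (use P_le in \<open>auto simp: eventually_at_filter intro!: always_eventually\<close>)
        then show ?thesis using True by (simp add: P_def)
      next
        case False
        then have "isCont P y" using y unfolding P_def
          by (intro continuous_intros DERIV_isCont[OF f']) auto
        then show ?thesis by (simp add: continuous_at tendsto_within_subset[of _ _ _ UNIV])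
      qed
    qed
  qed (use \<open>a < x\<close> in auto)
  then have "((\<lambda>u. \<alpha> * ((f x - f u) / (x - u) powr (\<alpha> + 1)) - f' u * (x - u) powr (-\<alpha>)) has_integral
      - ((f x - f a) * (x - a) powr (-\<alpha>))) {a..x}"
    by (simp add: P_def)
  moreover have i3: "set_integrable lborel {a..x} (\<lambda>u. \<alpha> * ((f x - f u) / (x - u) powr (\<alpha> + 1)) - f' u * (x - u) powr (-\<alpha>))"
    using i1 i2 by (intro set_integral_diff set_integrable_mult_right) auto
  ultimately have "(LBINT u:{a..x}. \<alpha> * ((f x - f u) / (x - u) powr (\<alpha> + 1)) - f' u * (x - u) powr (-\<alpha>))
      = - ((f x - f a) * (x - a) powr (-\<alpha>))"
    using set_borel_integral_eq_integral(2)[OF i3] by (simp add: integral_unique)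
  then show "\<alpha> * (LBINT u:{a..x}. (f x - f u) / (x - u) powr (\<alpha> + 1))
      = (LBINT u:{a..x}. f' u * (x - u) powr (-\<alpha>)) - (f x - f a) * (x - a) powr (-\<alpha>)"
    unfolding set_integral_diff(2)[OF set_integrable_mult_right[OF i2] i1] set_integral_mult_right by linarith
qed

lemma frac_deriv_left_C1:
  assumes f: "hoelder_const L \<nu> f" and \<alpha>: "0 < \<alpha>" "\<alpha> < 1" "\<alpha> < \<nu>" and "a \<le> x"
    and f': "\<And>u. (f has_real_derivative f' u) (at u)" and cont: "continuous_on UNIV f'"
  shows "frac_deriv_left \<alpha> a f x
    = (f a * (x - a) powr (-\<alpha>) + (LBINT u:{a..x}. f' u * (x - u) powr (-\<alpha>))) / Gamma (1 - \<alpha>)"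
proof (cases "a = x")
  case True
  have "(LBINT u:{x..x}. f' u * (x - u) powr (-\<alpha>)) = (LBINT u:{x..x}. 0)"
    by (intro set_lebesgue_integral_cong) auto
  then show ?thesis using True by simp
next
  case False
  have "f x / (x - a) powr \<alpha> = f x * (x - a) powr (-\<alpha>)" by (simp add: powr_minus divide_inverse)
  then show ?thesis
    unfolding frac_deriv_left_def using frac_integral_by_parts(2)[OF f \<alpha> _ f' cont, of a x] False \<open>a \<le> x\<close>
    by (simp add: algebra_simps)
qed

lemma frac_deriv_right_C1:
  assumes g: "hoelder_const L \<mu> g" and \<beta>: "0 < \<beta>" "\<beta> < 1" "\<beta> < \<mu>" and "x \<le> b"
    and g': "\<And>u. (g has_real_derivative g' u) (at u)" and cont: "continuous_on UNIV g'"
  shows "frac_deriv_right \<beta> b (\<lambda>u. g u - g b) x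
    = - (LBINT u:{x..b}. g' u * (u - x) powr (-\<beta>)) / Gamma (1 - \<beta>)"
proof -
  have d: "((\<lambda>u. g (-u) - g b) has_real_derivative - g' (-u)) (at u)" for u
    using DERIV_chain'[OF DERIV_minus[OF DERIV_ident] g'] by (auto intro!: derivative_eq_intros)
  have c: "continuous_on UNIV (\<lambda>u. - g' (-u))"
    by (intro continuous_on_minus continuous_on_compose2[OF cont]) auto
  have *: "{u. x \<le> - u \<and> - u \<le> b} = {-b..-x}" by auto
  have "(LBINT u:{x..b}. g' u * (u - x) powr (-\<beta>)) = (LBINT u:{-b..-x}. g' (-u) * (- x - u) powr (-\<beta>))"
    by (subst set_integral_reflect) (simp add: * minus_diff_commute)
  then show ?thesis
    unfolding frac_deriv_right_reflect
    using frac_deriv_left_C1[OF hoelder_const_reflect[OF hoelder_const_shift[OF g, of "g b"]] \<beta> _ d c, of "-b" "-x"] \<open>x \<le> b\<close>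
    by (simp add: set_lebesgue_integral_def)
qed

text \<open>The kernels of the fractional integrals of complementary orders compose to a constant; this is what
  makes the derivatives of orders \<open>\<alpha>\<close> and \<open>1 - \<alpha>\<close> recombine to an ordinary integral.\<close>

lemma Beta_kernel:
  assumes \<alpha>: "0 < \<alpha>" "\<alpha> < 1" and "a < (w::real)"
  shows "has_bochner_integral lborel (\<lambda>x. indicator {a..w} x *\<^sub>R ((x - a) powr (-\<alpha>) * (w - x) powr (\<alpha> - 1)))
    (Gamma (1 - \<alpha>) * Gamma \<alpha>)"
proof -
  let ?k = "\<lambda>t::real. indicator {0..1} t *\<^sub>R (t powr (1 - \<alpha> - 1) * (1 - t) powr (\<alpha> - 1))"
  have i: "set_integrable lborel {0..1} (\<lambda>t::real. t powr (1 - \<alpha> - 1) * (1 - t) powr (\<alpha> - 1))"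
    using \<alpha> by (intro integrable_Beta) auto
  have "((\<lambda>t. t powr (1 - \<alpha> - 1) * (1 - t) powr (\<alpha> - 1)) has_integral Beta (1 - \<alpha>) \<alpha>) {0..1}"
    using \<alpha> by (intro has_integral_Beta_real) auto
  then have "has_bochner_integral lborel ?k (Beta (1 - \<alpha>) \<alpha>)"
    using i set_borel_integral_eq_integral(2)[OF i]
    by (simp add: has_bochner_integral_iff set_integrable_def set_lebesgue_integral_def integral_unique)
  then have "has_bochner_integral lborel (\<lambda>x. ?k (- a / (w - a) + 1 / (w - a) * x)) (Beta (1 - \<alpha>) \<alpha> /\<^sub>R \<bar>1 / (w - a)\<bar>)"
    using \<open>a < w\<close> by (subst (asm) lborel_has_bochner_integral_real_affine_iff[of "1 / (w - a)" _ _ "- a / (w - a)"]) auto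
  then have "has_bochner_integral lborel (\<lambda>x. (1 / (w - a)) * ?k (- a / (w - a) + 1 / (w - a) * x)) ((1 / (w - a)) * (Beta (1 - \<alpha>) \<alpha> /\<^sub>R \<bar>1 / (w - a)\<bar>))"
    by (intro has_bochner_integral_mult_right)
  moreover have "(1 / (w - a)) * (Beta (1 - \<alpha>) \<alpha> /\<^sub>R \<bar>1 / (w - a)\<bar>) = Gamma (1 - \<alpha>) * Gamma \<alpha>"
    using \<open>a < w\<close> by (simp add: Beta_def Gamma_eq_zero_iff divide_simps)
  moreover have "(1 / (w - a)) * ?k (- a / (w - a) + 1 / (w - a) * x)
      = indicator {a..w} x *\<^sub>R ((x - a) powr (-\<alpha>) * (w - x) powr (\<alpha> - 1))" for x
  proof -
    have e: "- a / (w - a) + 1 / (w - a) * x = (x - a) / (w - a)"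
      by (simp add: divide_simps)
    have e2: "1 - (x - a) / (w - a) = (w - x) / (w - a)" using \<open>a < w\<close> by (simp add: field_simps)
    have m: "(x - a) / (w - a) \<in> {0..1} \<longleftrightarrow> x \<in> {a..w}" using \<open>a < w\<close> by (auto simp: field_simps)
    show ?thesis
    proof (cases "x \<in> {a..w}")
      case True
      have "(1 / (w - a)) * (((x - a) / (w - a)) powr (1 - \<alpha> - 1) * ((w - x) / (w - a)) powr (\<alpha> - 1))
         = (x - a) powr (-\<alpha>) * (w - x) powr (\<alpha> - 1) * (1 / ((w - a) * ((w - a) powr (-\<alpha>) * (w - a) powr (\<alpha> - 1))))"
        using True \<open>a < w\<close> by (simp add: powr_divide)
      also have "(w - a) powr (-\<alpha>) * (w - a) powr (\<alpha> - 1) = 1 / (w - a)"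
        using \<open>a < w\<close> unfolding powr_add[symmetric] by (simp add: powr_minus_divide)
      finally show ?thesis using True \<open>a < w\<close> m unfolding e e2 by simp
    next
      case False
      then show ?thesis using m unfolding e by (simp add: indicator_def del: atLeastAtMost_iff)
    qed
  qed
  ultimately show ?thesis by simp
qed

lemma frac_deriv_left_const: "frac_deriv_left \<alpha> a (\<lambda>_. c) x = c * (x - a) powr (-\<alpha>) / Gamma (1 - \<alpha>)"
  by (simp add: frac_deriv_left_def powr_minus divide_inverse)

text \<open>For a differentiable integrator the right derivative is a fractional integral of \<open>g'\<close>.
  After exchanging the integrals the inner one is a Beta integral, and what remains is the integral
  of \<open>g'\<close>.\<close>

lemma gls_value_one_C1:
  assumes g: "hoelder_const L' \<mu> g" and \<alpha>: "0 < \<alpha>" "\<alpha> < 1" "1 - \<alpha> < \<mu>" and "a \<le> b"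
    and g': "\<And>u. (g has_real_derivative g' u) (at u)" and cont: "continuous_on UNIV g'"
  shows "gls_value \<alpha> (\<lambda>_. 1) g a b = g b - g a"
proof -
  have [measurable]: "g' \<in> borel_measurable borel" using cont by (rule borel_measurable_continuous_onI)
  define \<Gamma> where "\<Gamma> = Gamma (1 - \<alpha>) * Gamma \<alpha>"
  have G: "0 < Gamma (1 - \<alpha>)" "0 < Gamma \<alpha>" using \<alpha> by (auto intro!: Gamma_real_pos)
  define k where "k w x = (if a \<le> x \<and> x \<le> w \<and> w \<le> b then g' w * ((x - a) powr (-\<alpha>) * (w - x) powr (\<alpha> - 1)) else 0)" for w x
  have k_m[measurable]: "(\<lambda>p. k (fst p) (snd p)) \<in> borel_measurable (lborel \<Otimes>\<^sub>M lborel)"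
    unfolding k_def by measurable
  have inner: "has_bochner_integral lborel (k w) (indicator {a<..b} w * g' w * \<Gamma>)" for w
  proof (cases "a < w \<and> w \<le> b")
    case True
    then have "has_bochner_integral lborel (\<lambda>x. g' w * (indicator {a..w} x *\<^sub>R ((x - a) powr (-\<alpha>) * (w - x) powr (\<alpha> - 1)))) (g' w * \<Gamma>)"
      unfolding \<Gamma>_def by (intro has_bochner_integral_mult_right Beta_kernel \<alpha>) auto
    moreover have "(\<lambda>x. g' w * (indicator {a..w} x *\<^sub>R ((x - a) powr (-\<alpha>) * (w - x) powr (\<alpha> - 1)))) = k w"
      using True by (auto simp: k_def fun_eq_iff)
    ultimately show ?thesis using True by simp
  next
    case False
    then have "k w = (\<lambda>_. 0)" by (auto simp: k_def fun_eq_iff)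
    then show ?thesis using False by (simp add: has_bochner_integral_zero)
  qed
  have innern: "(LINT x|lborel. norm (k w x)) = indicator {a<..b} w * \<bar>g' w\<bar> * \<Gamma>" for w
  proof (cases "a < w \<and> w \<le> b")
    case True
    then have "has_bochner_integral lborel (\<lambda>x. \<bar>g' w\<bar> * (indicator {a..w} x *\<^sub>R ((x - a) powr (-\<alpha>) * (w - x) powr (\<alpha> - 1)))) (\<bar>g' w\<bar> * \<Gamma>)"
      unfolding \<Gamma>_def by (intro has_bochner_integral_mult_right Beta_kernel \<alpha>) auto
    moreover have "(\<lambda>x. \<bar>g' w\<bar> * (indicator {a..w} x *\<^sub>R ((x - a) powr (-\<alpha>) * (w - x) powr (\<alpha> - 1)))) = (\<lambda>x. norm (k w x))"
      using True by (auto simp: k_def fun_eq_iff abs_mult)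
    ultimately have "has_bochner_integral lborel (\<lambda>x. norm (k w x)) (\<bar>g' w\<bar> * \<Gamma>)" by (simp only:)
    then show ?thesis using True by (simp add: has_bochner_integral_integral_eq)
  next
    case False
    then have "k w = (\<lambda>_. 0)" by (auto simp: k_def fun_eq_iff)
    then show ?thesis using False by auto
  qed
  have g'_int: "set_integrable lborel {a..b} g'"
    using cont by (intro borel_integrable_atLeastAtMost') (auto intro: continuous_on_subset)
  have "integrable lborel (\<lambda>w. indicator {a<..b} w *\<^sub>R g' w)"
    using set_integrable_subset[OF g'_int, of "{a<..b}"] by (auto simp: set_integrable_def greaterThanAtMost_subseteq_atLeastAtMost_iff)
  then have "integrable lborel (\<lambda>w. norm (indicator {a<..b} w *\<^sub>R g' w) * \<Gamma>)"
    by (intro integrable_mult_left integrable_norm)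
  then have ni: "integrable lborel (\<lambda>w. indicator {a<..b} w * \<bar>g' w\<bar> * \<Gamma>)"
    by (simp add: abs_mult)
  have "integrable (lborel \<Otimes>\<^sub>M lborel) (\<lambda>(w,x). k w x)"
    by (rule lborel_pair.Fubini_integrable)
       (use inner ni in \<open>auto simp: innern[unfolded real_norm_def] has_bochner_integral_iff case_prod_beta\<close>)
  from lborel_pair.Fubini_integral[OF this]
  have fub: "(LINT x|lborel. LINT w|lborel. k w x) = (LINT w|lborel. LINT x|lborel. k w x)" .
  have "(LINT w|lborel. LINT x|lborel. k w x) = (LINT w|lborel. indicator {a<..b} w * g' w * \<Gamma>)"
    using inner by (simp add: has_bochner_integral_iff)
  also have "\<dots> = (LINT w|lborel. indicator {a..b} w *\<^sub>R g' w) * \<Gamma>"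
  proof (subst integral_mult_left_zero[symmetric], rule integral_cong_AE)
    show "AE w in lborel. indicator {a<..b} w * g' w * \<Gamma> = (indicator {a..b} w *\<^sub>R g' w) * \<Gamma>"
      using AE_lborel_singleton[of a] by eventually_elim (auto split: split_indicator)
  qed measurable
  also have "(LINT w|lborel. indicator {a..b} w *\<^sub>R g' w) = g b - g a"
    using g' \<open>a \<le> b\<close> cont
    by (intro integral_FTC_Icc)
       (auto simp: has_real_derivative_iff_has_vector_derivative[symmetric] intro: has_field_derivative_at_within continuous_on_subset)
  finally have rhs: "(LINT x|lborel. LINT w|lborel. k w x) = (g b - g a) * \<Gamma>" using fub by simp
  have r: "frac_deriv_right (1 - \<alpha>) b (\<lambda>u. g u - g b) x = - (LBINT w:{x..b}. g' w * (w - x) powr (\<alpha> - 1)) / Gamma \<alpha>" if "x \<le> b" for x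
    using frac_deriv_right_C1[OF g _ _ _ that g' cont, of "1 - \<alpha>"] \<alpha> by simp
  have "gls_value \<alpha> (\<lambda>_. 1) g a b = (LBINT x:{a..b}. (x - a) powr (-\<alpha>) / Gamma (1 - \<alpha>) * ((LBINT w:{x..b}. g' w * (w - x) powr (\<alpha> - 1)) / Gamma \<alpha>))"
  proof -
    have "(LBINT x:{a..b}. frac_deriv_left \<alpha> a (\<lambda>_. 1) x * frac_deriv_right (1 - \<alpha>) b (\<lambda>u. g u - g b) x)
      = (LBINT x:{a..b}. (-1) * ((x - a) powr (-\<alpha>) / Gamma (1 - \<alpha>) * ((LBINT w:{x..b}. g' w * (w - x) powr (\<alpha> - 1)) / Gamma \<alpha>)))"
      unfolding frac_deriv_left_const by (intro set_lebesgue_integral_cong) (auto simp: r)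
    then show ?thesis unfolding gls_value_def set_integral_mult_right by linarith
  qed
  also have "\<dots> = (LINT x|lborel. (LINT w|lborel. k w x) / \<Gamma>)"
    unfolding set_lebesgue_integral_def
  proof (rule Bochner_Integration.integral_cong[OF refl])
    fix x
    show "indicator {a..b} x *\<^sub>R ((x - a) powr - \<alpha> / Gamma (1 - \<alpha>) * ((LINT w|lborel. indicator {x..b} w *\<^sub>R (g' w * (w - x) powr (\<alpha> - 1))) / Gamma \<alpha>))
        = (LINT w|lborel. k w x) / \<Gamma>"
    proof (cases "x \<in> {a..b}")
      case True
      have "(LINT w|lborel. k w x) = (LINT w|lborel. (x - a) powr - \<alpha> * (indicator {x..b} w *\<^sub>R (g' w * (w - x) powr (\<alpha> - 1))))"
        using True by (intro Bochner_Integration.integral_cong) (auto simp: k_def)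
      then show ?thesis using True by (simp add: \<Gamma>_def)
    next
      case False
      then have "(\<lambda>w. k w x) = (\<lambda>_. 0)" by (auto simp: k_def fun_eq_iff)
      then show ?thesis using False by simp
    qed
  qed
  also have "\<dots> = g b - g a"
    using rhs G by (simp add: \<Gamma>_def)
  finally show ?thesis .
qed

text \<open>Steklov means \<open>(F (x + d) - F x) / d\<close> of \<open>f\<close>, where \<open>F' = f\<close>.  By the mean value theorem applied
  to \<open>\<theta> \<mapsto> F (t + \<theta>) - F (s + \<theta>)\<close>, an increment of the mean is an increment of \<open>f\<close> over
  a translate of the same interval, so the Hoelder constant is preserved exactly.\<close>

lemma steklov_approximation:
  assumes f: "hoelder_const L \<nu> f" and "0 < \<nu>"
  obtains fn fn' :: "nat \<Rightarrow> real \<Rightarrow> real" where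
    "\<And>n. hoelder_const L \<nu> (fn n)" "\<And>x. (\<lambda>n. fn n x) \<longlonglongrightarrow> f x"
    "\<And>n u. (fn n has_real_derivative fn' n u) (at u)" "\<And>n. continuous_on UNIV (fn' n)"
proof -
  have cont: "continuous_on UNIV f" using hoelder_const_continuous[OF assms] .
  have "\<exists>F. \<forall>x::real. -\<infinity> < ereal x \<longrightarrow> ereal x < \<infinity> \<longrightarrow> (F has_vector_derivative f x) (at x)"
    using cont by (intro einterval_antiderivative) (auto simp: continuous_on_eq_continuous_at)
  then obtain F where F: "\<And>x. (F has_real_derivative f x) (at x)"
    by (auto simp: has_real_derivative_iff_has_vector_derivative)
  define d where "d n = 1 / real (Suc n)" for n
  have d: "0 < d n" for n by (simp add: d_def)
  define fn where "fn n x = (F (x + d n) - F x) / d n" for n x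
  define fn' where "fn' n x = (f (x + d n) - f x) / d n" for n x
  have dF: "((\<lambda>u. F (u + c)) has_real_derivative f (u + c)) (at u)" for u c
    using DERIV_shift[of F "f (u + c)" u c] F by (simp add: add.commute)
  show ?thesis
  proof
    fix n :: nat
    show "(fn n has_real_derivative fn' n u) (at u)" for u
      unfolding fn_def fn'_def using d[of n] by (auto intro!: derivative_eq_intros dF F)
    show "continuous_on UNIV (fn' n)"
      unfolding fn'_def using d[of n] by (intro continuous_intros continuous_on_compose2[OF cont]) auto
    have "\<bar>fn n t - fn n s\<bar> \<le> L * \<bar>t - s\<bar> powr \<nu>" for s t
    proof -
      have "\<exists>z>0. z < d n \<and> (F (t + d n) - F (s + d n)) - (F (t + 0) - F (s + 0)) = (d n - 0) * (f (t + z) - f (s + z))"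
        using d[of n] by (intro MVT2) (auto intro!: derivative_eq_intros DERIV_chain'[OF _ F])
      then obtain z where "(F (t + d n) - F (s + d n)) - (F t - F s) = d n * (f (t + z) - f (s + z))"
        by auto
      moreover have "F (t + d n) - F t - (F (s + d n) - F s) = (F (t + d n) - F (s + d n)) - (F t - F s)" by simp
      ultimately have e: "F (t + d n) - F t - (F (s + d n) - F s) = d n * (f (t + z) - f (s + z))" by simp
      have "fn n t - fn n s = f (t + z) - f (s + z)"
        unfolding fn_def diff_divide_distrib[symmetric] e using d[of n] by simp
      then show ?thesis using hoelder_constD[OF f, of "t + z" "s + z"] by simp
    qed
    then show "hoelder_const L \<nu> (fn n)" by (simp add: hoelder_const_def)
  next
    fix x
    have b: "\<bar>fn n x - f x\<bar> \<le> L * d n powr \<nu>" for n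
    proof -
      have "\<exists>z>x. z < x + d n \<and> F (x + d n) - F x = (x + d n - x) * f z"
        using d[of n] by (intro MVT2) (auto intro: F)
      then obtain z where z: "x < z" "z < x + d n" "fn n x = f z" using d[of n] by (auto simp: fn_def)
      have "\<bar>f z - f x\<bar> \<le> L * \<bar>z - x\<bar> powr \<nu>" using hoelder_constD[OF f] .
      also have "\<dots> \<le> L * d n powr \<nu>"
        using z hoelder_const_nonneg[OF f] assms(2) by (intro mult_left_mono powr_mono2) auto
      finally show ?thesis using z by simp
    qed
    have "(\<lambda>n. L * d n powr \<nu>) \<longlonglongrightarrow> L * 0"
      unfolding d_def using \<open>0 < \<nu>\<close> LIMSEQ_inverse_real_of_nat
      by (intro tendsto_mult tendsto_const tendsto_zero_powrI) (auto simp: inverse_eq_divide)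
    then have l: "(\<lambda>n. L * d n powr \<nu>) \<longlonglongrightarrow> 0" by simp
    have "(\<lambda>n. fn n x - f x) \<longlonglongrightarrow> 0"
      by (rule Lim_null_comparison[OF _ l]) (simp add: b)
    then show "(\<lambda>n. fn n x) \<longlonglongrightarrow> f x" by (simp add: LIM_zero_iff)
  qed
qed

lemma gls_value_one:
  assumes g: "hoelder_const L' \<mu> g" and \<alpha>: "0 < \<alpha>" "\<alpha> < 1" "1 - \<alpha> < \<mu>" and "a \<le> b"
  shows "gls_value \<alpha> (\<lambda>_. 1) g a b = g b - g a"
proof -
  obtain gn gn' where gn: "\<And>n. hoelder_const L' \<mu> (gn n)" "\<And>x. (\<lambda>n. gn n x) \<longlonglongrightarrow> g x"
    "\<And>n u. (gn n has_real_derivative gn' n u) (at u)" "\<And>n. continuous_on UNIV (gn' n)"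
    using steklov_approximation[OF g] \<alpha> by auto
  have "(\<lambda>n. gls_value \<alpha> (\<lambda>_. 1) (gn n) a b) \<longlonglongrightarrow> gls_value \<alpha> (\<lambda>_. 1) g a b"
    using \<alpha> gn g by (intro gls_value_tendsto[where \<nu> = 2 and \<mu> = \<mu> and L = 0 and L' = L']) (auto simp: hoelder_const_def)
  moreover have "gls_value \<alpha> (\<lambda>_. 1) (gn n) a b = gn n b - gn n a" for n
    by (rule gls_value_one_C1[OF gn(1) \<alpha> \<open>a \<le> b\<close> gn(3,4)])
  moreover have "(\<lambda>n. gn n b - gn n a) \<longlonglongrightarrow> g b - g a"
    by (intro tendsto_diff gn)
  ultimately show ?thesis by (simp add: LIMSEQ_unique)
qed

text \<open>Since \<open>f x = f a + (integral of f' over [a, x])\<close>, a differentiable integrand is a superposition of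
  indicators of \<open>[u, b]\<close>, and the integral of each of these is an increment of \<open>g\<close> by
  \<open>gls_value_one\<close>; Fubini's theorem adds them up.  The point of the formula is that its right-hand
  side is additive in the interval.\<close>

lemma gls_value_C1:
  assumes f: "hoelder_const L \<nu> f" and g: "hoelder_const L' \<mu> g"
    and \<alpha>: "0 < \<alpha>" "\<alpha> < 1" "\<alpha> < \<nu>" "1 - \<alpha> < \<mu>" and "a \<le> b"
    and f': "\<And>u. (f has_real_derivative f' u) (at u)" and cont: "continuous_on UNIV f'"
  shows "gls_value \<alpha> f g a b = f b * g b - f a * g a - (LBINT u:{a..b}. f' u * g u)"
proof -
  have f'_m[measurable]: "f' \<in> borel_measurable borel" using cont by (rule borel_measurable_continuous_onI)
  have g_cont: "continuous_on UNIV g" using hoelder_const_continuous[OF g] \<alpha> by auto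
  have [measurable]: "g \<in> borel_measurable borel" using hoelder_const_measurable[OF g] \<alpha> by auto
  define R where "R = frac_deriv_right (1 - \<alpha>) b (\<lambda>u. g u - g b)"
  have R_m[measurable]: "R \<in> borel_measurable borel"
    unfolding R_def by (intro frac_deriv_right_measurable) measurable
  have G: "0 < Gamma (1 - \<alpha>)" "0 < Gamma \<alpha>" using \<alpha> by (auto intro!: Gamma_real_pos)
  have L': "0 \<le> L'" using g hoelder_const_nonneg by auto
  define C where "C = L' * (\<mu> / (\<mu> + \<alpha> - 1)) / Gamma \<alpha> * (b - a) powr (\<mu> + \<alpha> - 1)"
  have C0: "0 \<le> C" unfolding C_def using L' \<alpha> G by auto
  have R_le: "\<bar>R x\<bar> \<le> C" if "a \<le> x" "x \<le> b" for x
  proof (cases "x = b")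
    case False
    have "(b - x) powr (\<mu> + \<alpha> - 1) \<le> (b - a) powr (\<mu> + \<alpha> - 1)"
      using that \<alpha> by (intro powr_mono2) auto
    then have "L' * (\<mu> / (\<mu> + \<alpha> - 1)) / Gamma \<alpha> * (b - x) powr (\<mu> + \<alpha> - 1) \<le> C"
      unfolding C_def using L' \<alpha> G by (intro mult_left_mono) auto
    then show ?thesis
      using frac_deriv_right_bound[OF g, of \<alpha> x b] \<alpha> that False unfolding R_def by force
  qed (use C0 in \<open>simp add: R_def\<close>)
  have ker: "set_integrable lborel {u..b} (\<lambda>x. (x - u) powr (-\<alpha>) * R x)" if "a \<le> u" for u
  proof (cases "u \<le> b")
    case True
    have k: "set_integrable lborel {u..b} (\<lambda>x. C * (x - u) powr (-\<alpha>))"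
      using set_integrable_powr_kernel'(1)[of u b "-\<alpha>"] \<alpha> True by auto
    show ?thesis
    proof (rule set_integrable_bound[OF k])
      show "AE x in lborel. x \<in> {u..b} \<longrightarrow> norm ((x - u) powr (-\<alpha>) * R x) \<le> norm (C * (x - u) powr (-\<alpha>))"
      proof (intro AE_I2 impI)
        fix x assume "x \<in> {u..b}"
        then show "norm ((x - u) powr (-\<alpha>) * R x) \<le> norm (C * (x - u) powr (-\<alpha>))"
          using R_le[of x] C0 that by (simp add: abs_mult mult.commute mult_right_mono)
      qed
    qed (simp add: set_borel_measurable_def)
  qed simp
  have ker_val: "(LBINT x:{u..b}. (x - u) powr (-\<alpha>) * R x) = - (g b - g u) * Gamma (1 - \<alpha>)" if "u \<le> b" for u
  proof -
    have "g b - g u = - (LBINT x:{u..b}. (x - u) powr (-\<alpha>) / Gamma (1 - \<alpha>) * R x)"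
      using gls_value_one[OF g \<alpha>(1,2,4) that] unfolding gls_value_def frac_deriv_left_const R_def by simp
    also have "\<dots> = - (LBINT x:{u..b}. (x - u) powr (-\<alpha>) * R x) / Gamma (1 - \<alpha>)"
      by (simp add: set_lebesgue_integral_def)
    finally show ?thesis using G by (simp add: field_simps)
  qed
  have ker_abs: "(LBINT x:{u..b}. \<bar>(x - u) powr (-\<alpha>) * R x\<bar>) \<le> C * ((b - a) powr (1 - \<alpha>) / (1 - \<alpha>))" if "a \<le> u" "u \<le> b" for u
  proof -
    have "(LBINT x:{u..b}. \<bar>(x - u) powr (-\<alpha>) * R x\<bar>) \<le> (LBINT x:{u..b}. C * (x - u) powr (-\<alpha>))"
    proof (rule set_integral_mono[OF set_integrable_abs[OF ker]])
      show "set_integrable lborel {u..b} (\<lambda>x. C * (x - u) powr (-\<alpha>))"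
        using set_integrable_powr_kernel'(1)[of u b "-\<alpha>"] \<alpha> that by auto
    qed (use that R_le in \<open>auto simp: abs_mult mult.commute intro!: mult_right_mono\<close>)
    also have "\<dots> = C * ((b - u) powr (1 - \<alpha>) / (1 - \<alpha>))"
      using set_integrable_powr_kernel'(2)[of u b "-\<alpha>"] \<alpha> that by simp
    also have "\<dots> \<le> C * ((b - a) powr (1 - \<alpha>) / (1 - \<alpha>))"
      using C0 \<alpha> that by (intro mult_left_mono divide_right_mono powr_mono2) auto
    finally show ?thesis .
  qed
  define k where "k u x = (if a \<le> u \<and> u \<le> x \<and> x \<le> b then f' u * ((x - u) powr (-\<alpha>) * R x) else 0)" for u x
  have k_m[measurable]: "(\<lambda>p. k (fst p) (snd p)) \<in> borel_measurable (lborel \<Otimes>\<^sub>M lborel)"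
    unfolding k_def by measurable
  have k_eq: "k u x = indicator {a..b} u * f' u * (indicator {u..b} x *\<^sub>R ((x - u) powr (-\<alpha>) * R x))" for u x
    by (auto simp: k_def)
  have k_eq2: "k u x = indicator {a..b} x * R x * (indicator {a..x} u *\<^sub>R (f' u * (x - u) powr (-\<alpha>)))" for u x
    by (auto simp: k_def)
  have inner: "integrable lborel (k u)" for u
    using ker[of u] unfolding k_eq set_integrable_def by (cases "u \<in> {a..b}") auto
  have f'_int: "set_integrable lborel {a..b} f'"
    using cont by (intro borel_integrable_atLeastAtMost') (auto intro: continuous_on_subset)
  have n_eq: "norm (k u x) = \<bar>indicator {a..b} u * f' u\<bar> * (indicator {u..b} x *\<^sub>R \<bar>(x - u) powr (-\<alpha>) * R x\<bar>)" for u x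
    unfolding k_eq by (auto simp: abs_mult split: split_indicator)
  have "integrable (lborel \<Otimes>\<^sub>M lborel) (\<lambda>(u,x). k u x)"
  proof (rule lborel_pair.Fubini_integrable)
    have "integrable lborel (\<lambda>u. norm (indicator {a..b} u *\<^sub>R f' u) * (C * ((b - a) powr (1 - \<alpha>) / (1 - \<alpha>))))"
      using f'_int unfolding set_integrable_def by (intro integrable_mult_left integrable_norm)
    then show "integrable lborel (\<lambda>u. LINT x|lborel. norm ((\<lambda>(u,x). k u x) (u, x)))"
    proof (rule Bochner_Integration.integrable_bound)
      show "AE u in lborel. norm (LINT x|lborel. norm ((\<lambda>(u,x). k u x) (u, x)))
          \<le> norm (norm (indicator {a..b} u *\<^sub>R f' u) * (C * ((b - a) powr (1 - \<alpha>) / (1 - \<alpha>))))"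
      proof (rule AE_I2)
        fix u
        have "(LINT x|lborel. norm (k u x)) = \<bar>indicator {a..b} u * f' u\<bar> * (LBINT x:{u..b}. \<bar>(x - u) powr (-\<alpha>) * R x\<bar>)"
          unfolding n_eq set_lebesgue_integral_def by simp
        also have "\<dots> \<le> \<bar>indicator {a..b} u * f' u\<bar> * (C * ((b - a) powr (1 - \<alpha>) / (1 - \<alpha>)))"
          using mult_left_mono[OF ker_abs[of u], of "\<bar>f' u\<bar>"] by (cases "u \<in> {a..b}") auto
        also have "\<dots> \<le> norm (norm (indicator {a..b} u *\<^sub>R f' u) * (C * ((b - a) powr (1 - \<alpha>) / (1 - \<alpha>))))"
          unfolding real_norm_def real_scaleR_def by (rule abs_ge_self)
        finally have "(LINT x|lborel. norm (k u x)) \<le> norm (norm (indicator {a..b} u *\<^sub>R f' u) * (C * ((b - a) powr (1 - \<alpha>) / (1 - \<alpha>))))" .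
        moreover have "norm (LINT x|lborel. norm (k u x)) = (LINT x|lborel. norm (k u x))" by simp
        ultimately show "norm (LINT x|lborel. norm ((\<lambda>(u,x). k u x) (u, x)))
          \<le> norm (norm (indicator {a..b} u *\<^sub>R f' u) * (C * ((b - a) powr (1 - \<alpha>) / (1 - \<alpha>))))"
          by (simp only: case_prod_conv)
      qed
    qed measurable
  qed (use inner k_m in \<open>auto simp: case_prod_beta\<close>)
  from lborel_pair.Fubini_integral[OF this] lborel_pair.integrable_snd[OF this]
  have fub: "(LINT x|lborel. LINT u|lborel. k u x) = (LINT u|lborel. LINT x|lborel. k u x)"
    and k_snd: "integrable lborel (\<lambda>x. LINT u|lborel. k u x)" by auto
  have kx: "(LINT u|lborel. k u x) = indicator {a..b} x *\<^sub>R ((LBINT u:{a..x}. f' u * (x - u) powr (-\<alpha>)) * R x)" for x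
    unfolding k_eq2 set_lebesgue_integral_def by simp
  have "(LINT u|lborel. LINT x|lborel. k u x) = (LBINT u:{a..b}. f' u * (- (g b - g u) * Gamma (1 - \<alpha>)))"
    unfolding set_lebesgue_integral_def
  proof (rule Bochner_Integration.integral_cong[OF refl])
    fix u
    have "(LINT x|lborel. k u x) = indicator {a..b} u * f' u * (LBINT x:{u..b}. (x - u) powr (-\<alpha>) * R x)"
      unfolding k_eq set_lebesgue_integral_def by simp
    then show "(LINT x|lborel. k u x) = indicator {a..b} u *\<^sub>R (f' u * (- (g b - g u) * Gamma (1 - \<alpha>)))"
      using ker_val[of u] by (cases "u \<in> {a..b}") auto
  qed
  also have "\<dots> = Gamma (1 - \<alpha>) * ((LBINT u:{a..b}. f' u * g u) - (LBINT u:{a..b}. f' u) * g b)"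
  proof -
    have i1: "set_integrable lborel {a..b} (\<lambda>u. f' u * g u)"
      using cont g_cont by (intro borel_integrable_atLeastAtMost' continuous_on_mult) (auto intro: continuous_on_subset)
    have "(LBINT u:{a..b}. f' u * (- (g b - g u) * Gamma (1 - \<alpha>))) = (LBINT u:{a..b}. Gamma (1 - \<alpha>) * (f' u * g u - f' u * g b))"
      by (intro set_lebesgue_integral_cong) (auto simp: algebra_simps)
    also have "\<dots> = Gamma (1 - \<alpha>) * ((LBINT u:{a..b}. f' u * g u) - (LBINT u:{a..b}. f' u * g b))"
      using i1 f'_int by (simp add: set_integral_diff(2))
    finally show ?thesis by simp
  qed
  also have "(LBINT u:{a..b}. f' u) = f b - f a"
    unfolding set_lebesgue_integral_def using f' \<open>a \<le> b\<close> cont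
    by (intro integral_FTC_Icc)
       (auto simp: has_real_derivative_iff_has_vector_derivative[symmetric] intro: has_field_derivative_at_within continuous_on_subset)
  finally have main: "(LINT x|lborel. LINT u|lborel. k u x) = Gamma (1 - \<alpha>) * ((LBINT u:{a..b}. f' u * g u) - (f b - f a) * g b)"
    using fub by simp
  have "(LBINT x:{a..b}. frac_deriv_left \<alpha> a f x * R x)
     = (LBINT x:{a..b}. (f a / Gamma (1 - \<alpha>)) * ((x - a) powr (-\<alpha>) * R x) + (1 / Gamma (1 - \<alpha>)) * ((LBINT u:{a..x}. f' u * (x - u) powr (-\<alpha>)) * R x))"
    using frac_deriv_left_C1[OF f \<alpha>(1-3) _ f' cont] by (intro set_lebesgue_integral_cong) (auto simp: add_divide_distrib algebra_simps)
  also have "\<dots> = (f a / Gamma (1 - \<alpha>)) * (LBINT x:{a..b}. (x - a) powr (-\<alpha>) * R x)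
      + (1 / Gamma (1 - \<alpha>)) * (LBINT x:{a..b}. (LBINT u:{a..x}. f' u * (x - u) powr (-\<alpha>)) * R x)"
    using ker[of a] k_snd
    by (subst set_integral_add(2)) (auto simp: kx set_integrable_def[of _ _ "\<lambda>x. (LBINT u:{a..x}. f' u * (x - u) powr (-\<alpha>)) * R x"])
  also have "(LBINT x:{a..b}. (LBINT u:{a..x}. f' u * (x - u) powr (-\<alpha>)) * R x) = (LINT x|lborel. LINT u|lborel. k u x)"
    unfolding kx by (simp add: set_lebesgue_integral_def)
  finally have "(LBINT x:{a..b}. frac_deriv_left \<alpha> a f x * R x)
      = f a * (- (g b - g a)) + ((LBINT u:{a..b}. f' u * g u) - (f b - f a) * g b)"
    using ker_val[OF \<open>a \<le> b\<close>] main G by simp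
  then show ?thesis unfolding gls_value_def R_def by (simp add: algebra_simps)
qed

text \<open>The integrand on \<open>[b, c]\<close> of the left-hand side differs from that of the second summand, since the
  fractional derivatives depend on the end points; the identity passes to the limit from
  \<open>gls_value_C1\<close>.\<close>

lemma gls_value_additive:
  assumes f: "hoelder_const L \<nu> f" and g: "hoelder_const L' \<mu> g"
    and \<alpha>: "0 < \<alpha>" "\<alpha> < 1" "\<alpha> < \<nu>" "1 - \<alpha> < \<mu>" and "a \<le> b" "b \<le> c"
  shows "gls_value \<alpha> f g a c = gls_value \<alpha> f g a b + gls_value \<alpha> f g b c"
proof -
  have g_cont: "continuous_on UNIV g" using hoelder_const_continuous[OF g] \<alpha> by auto
  obtain fn fn' where fn: "\<And>n. hoelder_const L \<nu> (fn n)" "\<And>x. (\<lambda>n. fn n x) \<longlonglongrightarrow> f x"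
    "\<And>n u. (fn n has_real_derivative fn' n u) (at u)" "\<And>n. continuous_on UNIV (fn' n)"
    using steklov_approximation[OF f] \<alpha> by auto
  have lim: "(\<lambda>n. gls_value \<alpha> (fn n) g s t) \<longlonglongrightarrow> gls_value \<alpha> f g s t" for s t
    using \<alpha> fn g f by (intro gls_value_tendsto[where \<nu> = \<nu> and \<mu> = \<mu> and L = L and L' = L']) auto
  have "gls_value \<alpha> (fn n) g a c = gls_value \<alpha> (fn n) g a b + gls_value \<alpha> (fn n) g b c" for n
  proof -
    have eq: "gls_value \<alpha> (fn n) g s t = fn n t * g t - fn n s * g s - (LBINT u:{s..t}. fn' n u * g u)" if "s \<le> t" for s t
      by (rule gls_value_C1[OF fn(1) g \<alpha> that fn(3,4)])
    have i: "set_integrable lborel {s..t} (\<lambda>u. fn' n u * g u)" for s t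
      using fn(4) g_cont by (intro borel_integrable_atLeastAtMost' continuous_on_mult) (auto intro: continuous_on_subset)
    have "(LBINT u:{a..c}. fn' n u * g u) = (LBINT u:{a..b}. fn' n u * g u) + (LBINT u:{b..c}. fn' n u * g u)"
      using set_borel_integral_eq_integral[OF i] Henstock_Kurzweil_Integration.integral_combine[OF assms(7,8), of "\<lambda>u. fn' n u * g u"]
      by simp
    then show ?thesis using assms(7,8) by (simp add: eq)
  qed
  then have "(\<lambda>n. gls_value \<alpha> (fn n) g a c) \<longlonglongrightarrow> gls_value \<alpha> f g a b + gls_value \<alpha> f g b c"
    by (simp add: tendsto_add lim)
  with lim show ?thesis by (rule LIMSEQ_unique)
qed

section \<open>The generalized Lebesgue-Stieltjes integral as a Young integral\<close>

lemma nn_set_integral_eq: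
  assumes "set_integrable lborel A f" "\<And>x. 0 \<le> f x"
  shows "(\<integral>\<^sup>+x\<in>A. ennreal (f x) \<partial>lborel) = ennreal (LBINT x:A. f x)"
proof -
  have "(\<integral>\<^sup>+x\<in>A. ennreal (f x) \<partial>lborel) = (\<integral>\<^sup>+x. ennreal (indicator A x *\<^sub>R f x) \<partial>lborel)"
    by (intro nn_integral_cong) (auto split: split_indicator)
  also have "\<dots> = ennreal (LBINT x:A. f x)"
    using assms unfolding set_integrable_def set_lebesgue_integral_def
    by (intro nn_integral_eq_integral) auto
  finally show ?thesis .
qed

text \<open>The integral is required to be the value for every admissible order, so exhibiting one admissible
  order identifies it.\<close>

lemma gls_admissible_hoelder:
  assumes \<alpha>: "0 < \<alpha>" "\<alpha> < 1" "\<alpha> < \<nu>" "1 - \<alpha> < \<mu>"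
    and f: "hoelder_const L \<nu> f" and g: "hoelder_const L' \<mu> g" and "a \<le> b"
  shows "gls_admissible \<alpha> f g a b"
  unfolding gls_admissible_def
proof (intro conjI \<alpha>)
  have m[measurable]: "f \<in> borel_measurable borel" "g \<in> borel_measurable borel"
    using hoelder_const_measurable[OF f] hoelder_const_measurable[OF g] \<alpha> by auto
  have L: "0 \<le> L" "0 \<le> L'" using f g hoelder_const_nonneg by auto
  show "set_borel_measurable lborel {a..b} f" "set_borel_measurable lborel {a..b} g"
    by (auto simp: set_borel_measurable_def)
  define A where "A = \<bar>f a\<bar> + L * (b - a) powr \<nu>"
  have A: "0 \<le> A" using L by (simp add: A_def)
  define K where "K = L * (b - a) powr (\<nu> - \<alpha>) / (\<nu> - \<alpha>)"
  have K: "0 \<le> K" using L \<alpha> by (simp add: K_def)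
  have i: "set_integrable lborel {a..b} (\<lambda>x. A * (x - a) powr (-\<alpha>) + K)"
  proof (intro set_integral_add(1) set_integrable_mult_right)
    show "set_integrable lborel {a..b} (\<lambda>x. (x - a) powr (-\<alpha>))"
      using set_integrable_powr_kernel'(1)[of a b "-\<alpha>"] \<alpha> \<open>a \<le> b\<close> by auto
  qed (intro borel_integrable_atLeastAtMost' continuous_on_const)
  have "(\<integral>\<^sup>+x\<in>{a..b}. (ennreal (\<bar>f x\<bar> / (x - a) powr \<alpha>)
        + (\<integral>\<^sup>+u\<in>{a..x}. ennreal (\<bar>f x - f u\<bar> / (x - u) powr (\<alpha> + 1)) \<partial>lborel)) \<partial>lborel)
      \<le> (\<integral>\<^sup>+x\<in>{a..b}. ennreal (A * (x - a) powr (-\<alpha>) + K) \<partial>lborel)"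
  proof (rule nn_integral_mono)
    fix x
    show "(ennreal (\<bar>f x\<bar> / (x - a) powr \<alpha>)
        + (\<integral>\<^sup>+u\<in>{a..x}. ennreal (\<bar>f x - f u\<bar> / (x - u) powr (\<alpha> + 1)) \<partial>lborel)) * indicator {a..b} x
       \<le> ennreal (A * (x - a) powr (-\<alpha>) + K) * indicator {a..b} x"
    proof (cases "x \<in> {a..b}")
      case True
      have "\<bar>f x\<bar> \<le> \<bar>f a\<bar> + L * (x - a) powr \<nu>"
        using hoelder_constD[OF f, of x a] True by simp
      also have "L * (x - a) powr \<nu> \<le> L * (b - a) powr \<nu>"
        using True L \<alpha> by (intro mult_left_mono powr_mono2) auto
      finally have "\<bar>f x\<bar> \<le> A" by (simp add: A_def)
      then have 1: "\<bar>f x\<bar> / (x - a) powr \<alpha> \<le> A * (x - a) powr (-\<alpha>)"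
        by (simp add: powr_minus divide_inverse mult_right_mono)
      have "(\<integral>\<^sup>+u\<in>{a..x}. ennreal (\<bar>f x - f u\<bar> / (x - u) powr (\<alpha> + 1)) \<partial>lborel)
          \<le> (\<integral>\<^sup>+u\<in>{a..x}. ennreal (L * (x - u) powr (\<nu> - \<alpha> - 1)) \<partial>lborel)"
        using hoelder_quotient[OF f] \<alpha> by (intro nn_integral_mono) (auto split: split_indicator intro!: ennreal_leI)
      also have "\<dots> = ennreal (LBINT u:{a..x}. L * (x - u) powr (\<nu> - \<alpha> - 1))"
        using set_integrable_powr_kernel(1)[of a x "\<nu> - \<alpha> - 1"] True \<alpha> L by (intro nn_set_integral_eq) auto
      also have "(LBINT u:{a..x}. L * (x - u) powr (\<nu> - \<alpha> - 1)) = L * (x - a) powr (\<nu> - \<alpha>) / (\<nu> - \<alpha>)"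
        using set_integrable_powr_kernel(2)[of a x "\<nu> - \<alpha> - 1"] True \<alpha> by simp
      also have "\<dots> \<le> K" unfolding K_def
        using L True \<alpha> by (intro divide_right_mono mult_left_mono powr_mono2) auto
      finally have 2: "(\<integral>\<^sup>+u\<in>{a..x}. ennreal (\<bar>f x - f u\<bar> / (x - u) powr (\<alpha> + 1)) \<partial>lborel) \<le> ennreal K"
        by (simp add: ennreal_leI)
      have "ennreal (\<bar>f x\<bar> / (x - a) powr \<alpha>)
        + (\<integral>\<^sup>+u\<in>{a..x}. ennreal (\<bar>f x - f u\<bar> / (x - u) powr (\<alpha> + 1)) \<partial>lborel) \<le> ennreal (A * (x - a) powr (-\<alpha>)) + ennreal K"
        using 1 2 by (intro add_mono ennreal_leI) auto
      then show ?thesis using True A K by (simp add: ennreal_plus)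
    qed simp
  qed
  also have "\<dots> = ennreal (LBINT x:{a..b}. A * (x - a) powr (-\<alpha>) + K)"
    using A K by (intro nn_set_integral_eq i) auto
  also have "\<dots> < \<infinity>" by simp
  finally show "(\<integral>\<^sup>+x\<in>{a..b}. (ennreal (\<bar>f x\<bar> / (x - a) powr \<alpha>)
        + (\<integral>\<^sup>+u\<in>{a..x}. ennreal (\<bar>f x - f u\<bar> / (x - u) powr (\<alpha> + 1)) \<partial>lborel)) \<partial>lborel) < \<infinity>" .
  define C where "C = L' * (b - a) powr (\<mu> + \<alpha> - 1) + L' * (b - a) powr (\<mu> + \<alpha> - 1) / (\<mu> + \<alpha> - 1)"
  show "\<exists>C::real. \<forall>x y. a \<le> x \<and> x < y \<and> y \<le> b \<longrightarrow>
        ennreal (\<bar>g y - g x\<bar> / (y - x) powr (1 - \<alpha>))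
        + (\<integral>\<^sup>+u\<in>{x..y}. ennreal (\<bar>g u - g x\<bar> / (u - x) powr (2 - \<alpha>)) \<partial>lborel) \<le> ennreal C"
  proof (intro exI[of _ C] allI impI)
    fix x y assume xy: "a \<le> x \<and> x < y \<and> y \<le> b"
    have q: "\<bar>g u - g x\<bar> / (u - x) powr e \<le> L' * (u - x) powr (\<mu> - e)" if "x \<le> u" for u e
    proof -
      have "\<bar>g u - g x\<bar> / (u - x) powr e \<le> L' * (u - x) powr \<mu> / (u - x) powr e"
        using hoelder_constD[OF g, of u x] that by (intro divide_right_mono) auto
      then show ?thesis by (simp add: powr_diff)
    qed
    have p: "L' * (y - x) powr (\<mu> + \<alpha> - 1) \<le> L' * (b - a) powr (\<mu> + \<alpha> - 1)"
      using xy \<alpha> L by (intro mult_left_mono powr_mono2) auto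
    have 1: "\<bar>g y - g x\<bar> / (y - x) powr (1 - \<alpha>) \<le> L' * (b - a) powr (\<mu> + \<alpha> - 1)"
      using q[of y "1 - \<alpha>"] p xy by (simp add: algebra_simps)
    have "(\<integral>\<^sup>+u\<in>{x..y}. ennreal (\<bar>g u - g x\<bar> / (u - x) powr (2 - \<alpha>)) \<partial>lborel)
        \<le> (\<integral>\<^sup>+u\<in>{x..y}. ennreal (L' * (u - x) powr (\<mu> - (2 - \<alpha>))) \<partial>lborel)"
      using q by (intro nn_integral_mono) (auto split: split_indicator intro!: ennreal_leI)
    also have "\<dots> = ennreal (LBINT u:{x..y}. L' * (u - x) powr (\<mu> - (2 - \<alpha>)))"
      using set_integrable_powr_kernel'(1)[of x y "\<mu> - (2 - \<alpha>)"] xy \<alpha> L by (intro nn_set_integral_eq) auto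
    also have "(LBINT u:{x..y}. L' * (u - x) powr (\<mu> - (2 - \<alpha>))) = L' * (y - x) powr (\<mu> + \<alpha> - 1) / (\<mu> + \<alpha> - 1)"
      using set_integrable_powr_kernel'(2)[of x y "\<mu> - (2 - \<alpha>)"] xy \<alpha> by (simp add: algebra_simps)
    also have "\<dots> \<le> L' * (b - a) powr (\<mu> + \<alpha> - 1) / (\<mu> + \<alpha> - 1)"
      using p \<alpha> by (intro divide_right_mono) auto
    finally have 2: "(\<integral>\<^sup>+u\<in>{x..y}. ennreal (\<bar>g u - g x\<bar> / (u - x) powr (2 - \<alpha>)) \<partial>lborel)
        \<le> ennreal (L' * (b - a) powr (\<mu> + \<alpha> - 1) / (\<mu> + \<alpha> - 1))" by (simp add: ennreal_leI)
    show "ennreal (\<bar>g y - g x\<bar> / (y - x) powr (1 - \<alpha>))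
        + (\<integral>\<^sup>+u\<in>{x..y}. ennreal (\<bar>g u - g x\<bar> / (u - x) powr (2 - \<alpha>)) \<partial>lborel) \<le> ennreal C"
      unfolding C_def using L \<alpha> 2 by (subst ennreal_plus) (auto intro!: add_mono ennreal_leI 1)
  qed
qed

lemma gls_admissible_cong:
  assumes "\<And>x. x \<in> {a..b} \<Longrightarrow> f x = f' x" "\<And>x. x \<in> {a..b} \<Longrightarrow> g x = g' x"
  shows "gls_admissible \<alpha> f g a b \<longleftrightarrow> gls_admissible \<alpha> f' g' a b"
proof -
  have 1: "set_borel_measurable lborel {a..b} f \<longleftrightarrow> set_borel_measurable lborel {a..b} f'"
    "set_borel_measurable lborel {a..b} g \<longleftrightarrow> set_borel_measurable lborel {a..b} g'"
    unfolding set_borel_measurable_def using assms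
    by (auto intro!: measurable_cong split: split_indicator)
  have 2: "(\<integral>\<^sup>+x\<in>{a..b}. (ennreal (\<bar>f x\<bar> / (x - a) powr \<alpha>)
        + (\<integral>\<^sup>+u\<in>{a..x}. ennreal (\<bar>f x - f u\<bar> / (x - u) powr (\<alpha> + 1)) \<partial>lborel)) \<partial>lborel) =
      (\<integral>\<^sup>+x\<in>{a..b}. (ennreal (\<bar>f' x\<bar> / (x - a) powr \<alpha>)
        + (\<integral>\<^sup>+u\<in>{a..x}. ennreal (\<bar>f' x - f' u\<bar> / (x - u) powr (\<alpha> + 1)) \<partial>lborel)) \<partial>lborel)"
  proof (rule nn_integral_cong)
    fix x
    have "(\<integral>\<^sup>+u\<in>{a..x}. ennreal (\<bar>f x - f u\<bar> / (x - u) powr (\<alpha> + 1)) \<partial>lborel) =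
      (\<integral>\<^sup>+u\<in>{a..x}. ennreal (\<bar>f' x - f' u\<bar> / (x - u) powr (\<alpha> + 1)) \<partial>lborel)" if "x \<in> {a..b}"
      using assms that by (intro nn_integral_cong) (auto split: split_indicator)
    then show "(ennreal (\<bar>f x\<bar> / (x - a) powr \<alpha>)
        + (\<integral>\<^sup>+u\<in>{a..x}. ennreal (\<bar>f x - f u\<bar> / (x - u) powr (\<alpha> + 1)) \<partial>lborel)) * indicator {a..b} x =
      (ennreal (\<bar>f' x\<bar> / (x - a) powr \<alpha>)
        + (\<integral>\<^sup>+u\<in>{a..x}. ennreal (\<bar>f' x - f' u\<bar> / (x - u) powr (\<alpha> + 1)) \<partial>lborel)) * indicator {a..b} x"
      using assms by (cases "x \<in> {a..b}") auto
  qed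
  have 3: "ennreal (\<bar>g y - g x\<bar> / (y - x) powr (1 - \<alpha>))
        + (\<integral>\<^sup>+u\<in>{x..y}. ennreal (\<bar>g u - g x\<bar> / (u - x) powr (2 - \<alpha>)) \<partial>lborel)
      = ennreal (\<bar>g' y - g' x\<bar> / (y - x) powr (1 - \<alpha>))
        + (\<integral>\<^sup>+u\<in>{x..y}. ennreal (\<bar>g' u - g' x\<bar> / (u - x) powr (2 - \<alpha>)) \<partial>lborel)"
    if "a \<le> x \<and> x < y \<and> y \<le> b" for x y
    using assms that by (intro arg_cong2[where f=plus] nn_integral_cong) (auto split: split_indicator)
  show ?thesis unfolding gls_admissible_def 1 2 using 3 by (auto cong: conj_cong)
qed

lemma gls_value_cong:
  assumes "\<And>x. x \<in> {a..b} \<Longrightarrow> f x = f' x" "\<And>x. x \<in> {a..b} \<Longrightarrow> g x = g' x"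
  shows "gls_value \<alpha> f g a b = gls_value \<alpha> f' g' a b"
proof -
  have l: "frac_deriv_left \<alpha> a f x = frac_deriv_left \<alpha> a f' x" if "x \<in> {a..b}" for x
  proof -
    have "(LBINT u:{a..x}. (f x - f u) / (x - u) powr (\<alpha> + 1)) = (LBINT u:{a..x}. (f' x - f' u) / (x - u) powr (\<alpha> + 1))"
      using assms that by (intro set_lebesgue_integral_cong) auto
    then show ?thesis using assms that by (simp add: frac_deriv_left_def)
  qed
  have r: "frac_deriv_right (1 - \<alpha>) b (\<lambda>u. g u - g b) x = frac_deriv_right (1 - \<alpha>) b (\<lambda>u. g' u - g' b) x" if "x \<in> {a..b}" for x
  proof -
    have "(LBINT u:{x..b}. (g x - g b - (g u - g b)) / (u - x) powr (1 - \<alpha> + 1)) = (LBINT u:{x..b}. (g' x - g' b - (g' u - g' b)) / (u - x) powr (1 - \<alpha> + 1))"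
      using assms that by (intro set_lebesgue_integral_cong) auto
    then show ?thesis using assms that by (simp add: frac_deriv_right_def)
  qed
  show ?thesis unfolding gls_value_def using l r
    by (intro arg_cong[where f=uminus] set_lebesgue_integral_cong) auto
qed

text \<open>Subtracting from the integrand its value at the left end point makes \<open>gls_value_bound\<close> applicable.\<close>

lemma gls_value_add_const:
  assumes f: "hoelder_const L \<nu> f" and g: "hoelder_const L' \<mu> g"
    and \<alpha>: "0 < \<alpha>" "\<alpha> < 1" "\<alpha> < \<nu>" "1 - \<alpha> < \<mu>" and "a \<le> b"
  shows "gls_value \<alpha> f g a b = gls_value \<alpha> (\<lambda>x. f x - c) g a b + c * (g b - g a)"
proof -
  let ?R = "frac_deriv_right (1 - \<alpha>) b (\<lambda>u. g u - g b)"
  have D: "frac_deriv_left \<alpha> a f x = frac_deriv_left \<alpha> a (\<lambda>x. f x - c) x + c * frac_deriv_left \<alpha> a (\<lambda>_. 1) x" for x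
    unfolding frac_deriv_left_const by (simp add: frac_deriv_left_def powr_minus field_simps add_divide_distrib diff_divide_distrib)
  have i1: "set_integrable lborel {a..b} (\<lambda>x. frac_deriv_left \<alpha> a (\<lambda>x. f x - c) x * ?R x)"
    by (rule gls_integrable[OF \<alpha> hoelder_const_shift[OF f] g])
  have "hoelder_const 0 \<nu> (\<lambda>_. 1::real)" by (simp add: hoelder_const_def)
  from gls_integrable[OF \<alpha> this g]
  have i2: "set_integrable lborel {a..b} (\<lambda>x. frac_deriv_left \<alpha> a (\<lambda>_. 1) x * ?R x)" .
  have "(LBINT x:{a..b}. frac_deriv_left \<alpha> a f x * ?R x)
     = (LBINT x:{a..b}. frac_deriv_left \<alpha> a (\<lambda>x. f x - c) x * ?R x + c * (frac_deriv_left \<alpha> a (\<lambda>_. 1) x * ?R x))"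
    unfolding D by (simp add: algebra_simps)
  also have "\<dots> = (LBINT x:{a..b}. frac_deriv_left \<alpha> a (\<lambda>x. f x - c) x * ?R x) + c * (LBINT x:{a..b}. frac_deriv_left \<alpha> a (\<lambda>_. 1) x * ?R x)"
    unfolding set_integral_add(2)[OF i1 set_integrable_mult_right[OF i2]] set_integral_mult_right by simp
  finally have "gls_value \<alpha> f g a b = gls_value \<alpha> (\<lambda>x. f x - c) g a b + c * gls_value \<alpha> (\<lambda>_. 1) g a b"
    by (simp add: gls_value_def)
  then show ?thesis using gls_value_one[OF g \<alpha>(1,2,4) \<open>a \<le> b\<close>] by simp
qed

text \<open>The bounds below must be uniform in the step size, so the constant hidden in \<open>hoelder_on\<close> is made
  a parameter.\<close>

definition hoelder_bound :: "real set \<Rightarrow> real \<Rightarrow> real \<Rightarrow> (real \<Rightarrow> real) \<Rightarrow> bool" where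
  "hoelder_bound S L \<nu> f \<longleftrightarrow> (\<forall>s\<in>S. \<forall>t\<in>S. \<bar>f t - f s\<bar> \<le> L * \<bar>t - s\<bar> powr \<nu>)"

lemma hoelder_boundD:
  "hoelder_bound S L \<nu> f \<Longrightarrow> s \<in> S \<Longrightarrow> t \<in> S \<Longrightarrow> \<bar>f t - f s\<bar> \<le> L * \<bar>t - s\<bar> powr \<nu>"
  by (auto simp: hoelder_bound_def)

lemma hoelder_const_clamp:
  assumes f: "hoelder_bound {a..b} L \<nu> f" and "a \<le> b" "0 \<le> L" "0 \<le> \<nu>"
  shows "hoelder_const L \<nu> (\<lambda>x. f (max a (min b x)))"
  unfolding hoelder_const_def
proof (intro allI)
  fix s t
  have "\<bar>f (max a (min b t)) - f (max a (min b s))\<bar> \<le> L * \<bar>max a (min b t) - max a (min b s)\<bar> powr \<nu>"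
    using assms(2) by (intro hoelder_boundD[OF f]) auto
  also have "\<dots> \<le> L * \<bar>t - s\<bar> powr \<nu>"
    using assms by (intro mult_left_mono powr_mono2) auto
  finally show "\<bar>f (max a (min b t)) - f (max a (min b s))\<bar> \<le> L * \<bar>t - s\<bar> powr \<nu>" .
qed

text \<open>All that is used of the integral later on.  The interval \<open>[s, t]\<close> is reached by additivity from
  the integrals starting at \<open>0\<close>.\<close>

theorem gls_integral_young_estimate:
  assumes f: "hoelder_bound {0..T} L \<nu> f" and g: "hoelder_bound {0..T} L' \<mu> g"
    and pos: "0 < \<nu>" "0 < \<mu>" "1 < \<nu> + \<mu>" "0 \<le> L" "0 \<le> L'"
    and I: "\<And>t. t \<in> {0..T} \<Longrightarrow> has_gls_integral f g 0 t (I t)"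
  obtains C where "0 \<le> C"
    "\<And>s t. 0 \<le> s \<Longrightarrow> s \<le> t \<Longrightarrow> t \<le> T \<Longrightarrow> \<bar>I t - I s - f s * (g t - g s)\<bar> \<le> C * (t - s) powr (\<nu> + \<mu>)"
proof (cases "0 \<le> T")
  case True
  \<comment> \<open>Any order in \<open>(0, 1)\<close> strictly between \<open>1 - \<mu>\<close> and \<open>\<nu>\<close> is admissible.\<close>
  obtain \<alpha> where \<alpha>': "max 0 (1 - \<mu>) < \<alpha>" "\<alpha> < min 1 \<nu>"
    using dense[of "max 0 (1 - \<mu>)" "min 1 \<nu>"] pos by auto
  then have \<alpha>: "0 < \<alpha>" "\<alpha> < 1" "\<alpha> < \<nu>" "1 - \<alpha> < \<mu>" by auto
  define f' where "f' x = f (max 0 (min T x))" for x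
  define g' where "g' x = g (max 0 (min T x))" for x
  have f': "hoelder_const L \<nu> f'" unfolding f'_def using hoelder_const_clamp[OF f] pos True by auto
  have g': "hoelder_const L' \<mu> g'" unfolding g'_def using hoelder_const_clamp[OF g] pos True by auto
  have eq: "f' x = f x" "g' x = g x" if "x \<in> {0..T}" for x using that by (auto simp: f'_def g'_def)
  have val: "I t = gls_value \<alpha> f' g' 0 t" if t: "t \<in> {0..T}" for t
  proof -
    have "gls_admissible \<alpha> f' g' 0 t" using gls_admissible_hoelder[OF \<alpha> f' g'] t by auto
    then have "gls_admissible \<alpha> f g 0 t"
      using gls_admissible_cong[of 0 t f f' g g' \<alpha>] eq t by auto
    then have "gls_value \<alpha> f g 0 t = I t" using I[OF t] by (auto simp: has_gls_integral_def)
    then show ?thesis using gls_value_cong[of 0 t f f' g g' \<alpha>] eq t by auto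
  qed
  define C where "C = (\<nu> / (\<nu> - \<alpha>)) / Gamma (1 - \<alpha>) * ((\<mu> / (\<mu> + \<alpha> - 1)) / Gamma \<alpha>) * L * L'"
  show thesis
  proof
    have "0 < Gamma (1 - \<alpha>)" "0 < Gamma \<alpha>" using \<alpha> by (auto intro!: Gamma_real_pos)
    then show "0 \<le> C" using \<alpha> pos by (simp add: C_def)
    fix s t assume st: "0 \<le> s" "s \<le> t" "t \<le> T"
    have "I t - I s = gls_value \<alpha> f' g' s t"
      using gls_value_additive[OF f' g' \<alpha> st(1,2)] val st by simp
    also have "\<dots> = gls_value \<alpha> (\<lambda>x. f' x - f' s) g' s t + f' s * (g' t - g' s)"
      by (rule gls_value_add_const[OF f' g' \<alpha> st(2)])
    finally have "I t - I s - f s * (g t - g s) = gls_value \<alpha> (\<lambda>x. f' x - f' s) g' s t"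
      using eq st by simp
    also have "\<bar>\<dots>\<bar> \<le> C * (t - s) powr (\<nu> + \<mu>)"
      unfolding C_def using st by (intro gls_value_bound[OF \<alpha> hoelder_const_shift[OF f'] g']) auto
    finally show "\<bar>I t - I s - f s * (g t - g s)\<bar> \<le> C * (t - s) powr (\<nu> + \<mu>)" .
  qed
next
  case False
  show thesis by (rule that[of 0]) (use False in auto)
qed

section \<open>Hoelder continuity of fractional Brownian motion\<close>

text \<open>Kolmogorov's chaining argument in deterministic form.  Each point is the limit of its dyadic
  approximations from below, whose successive increments are bounded by a geometric series; at the
  level comparable to \<open>t - s\<close> the approximations of \<open>s\<close> and \<open>t\<close> are equal or adjacent.\<close>

lemma dyadic_chaining:
  fixes x :: "real \<Rightarrow> real"
  assumes cont: "continuous_on {0..1} x" and "0 < \<mu>" "0 \<le> c"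
    and inc: "\<And>n j::nat. j < 2^n \<Longrightarrow> \<bar>x ((real j + 1) / 2^n) - x (real j / 2^n)\<bar> \<le> c * (1 / 2^n) powr \<mu>"
  obtains C where "0 \<le> C" "hoelder_bound {0..1} C \<mu> x"
proof -
  define q :: real where "q = (1/2) powr \<mu>"
  have q: "0 < q" "q < 1"
    unfolding q_def using \<open>0 < \<mu>\<close> powr_less_mono2[of \<mu> "1/2" 1] by auto
  have qn: "(1 / 2^n) powr \<mu> = q ^ n" for n
  proof -
    have "(1 / 2^n) powr \<mu> = ((1/2) powr real n) powr \<mu>" by (simp add: powr_realpow power_one_over)
    also have "\<dots> = q powr real n" by (simp add: q_def powr_powr mult.commute)
    finally show ?thesis using q by (simp add: powr_realpow)
  qed
  define k where "k n s = nat \<lfloor>2^n * s\<rfloor>" for n :: nat and s :: real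
  \<comment> \<open>The dyadic approximation of \<open>s\<close> from below at level \<open>n\<close>.\<close>
  define p where "p n s = real (k n s) / 2^n" for n s
  have k: "real (k n s) \<le> 2^n * s" "2^n * s < real (k n s) + 1" if "0 \<le> s" for n s
  proof -
    have "0 \<le> \<lfloor>2^n * s\<rfloor>" using that by simp
    then show "real (k n s) \<le> 2^n * s" "2^n * s < real (k n s) + 1" unfolding k_def by linarith+
  qed
  have p_mem: "p n s \<in> {0..1}" if "s \<in> {0..1}" for n s
  proof -
    have "2^n * s \<le> 2^n * (1::real)" using that by (intro mult_left_mono) auto
    moreover have "real (k n s) \<le> 2^n * s" using k(1)[of s n] that by simp
    ultimately have "real (k n s) \<le> 2^n" by linarith
    then show ?thesis by (simp add: p_def)
  qed
  have step: "\<bar>x (p n t) - x (p n s)\<bar> \<le> c * q ^ n"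
    if "s \<in> {0..1}" "t \<in> {0..1}" "k n t = k n s \<or> k n t = k n s + 1" for n s t
    using that(3)
  proof
    assume "k n t = k n s"
    then show ?thesis using q \<open>0 \<le> c\<close> by (simp add: p_def)
  next
    assume e: "k n t = k n s + 1"
    have "2^n * t \<le> 2^n * (1::real)" using that by (intro mult_left_mono) auto
    moreover have "real (k n s + 1) \<le> 2^n * t" using k(1)[of t n] that e by simp
    ultimately have "real (k n s + 1) \<le> 2^n" by linarith
    then have "real (k n s) < 2^n" by linarith
    then have "k n s < 2^n" using of_nat_less_iff[where 'a=real, of "k n s" "2^n"] by simp
    from inc[OF this] show ?thesis using e by (simp add: p_def qn add.commute)
  qed
  have refine: "\<bar>x (p (Suc n) s) - x (p n s)\<bar> \<le> c * q ^ Suc n" if s: "s \<in> {0..1}" for n s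
  proof -
    define s' where "s' = p n s"
    have s': "s' \<in> {0..1}" unfolding s'_def by (rule p_mem[OF s])
    have "(2::real) ^ Suc n * s' = real (2 * k n s)" by (simp add: s'_def p_def)
    then have ks: "k (Suc n) s' = 2 * k n s" unfolding k_def[of "Suc n" s'] by (simp only: floor_of_nat nat_int)
    have "p (Suc n) s' = p n s" unfolding p_def[of "Suc n"] ks by (simp add: p_def)
    moreover have "k (Suc n) s = k (Suc n) s' \<or> k (Suc n) s = k (Suc n) s' + 1"
    proof -
      have 1: "real (k n s) \<le> 2^n * s" "2^n * s < real (k n s) + 1" using k s by auto
      have 2: "real (k (Suc n) s) \<le> 2 * (2^n * s)" "2 * (2^n * s) < real (k (Suc n) s) + 1"
        using k[of s "Suc n"] s by (simp_all add: mult.assoc)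
      have "real (2 * k n s) < real (k (Suc n) s + 1)" using 1 2 by simp
      moreover have "real (k (Suc n) s) < real (2 * k n s + 2)" using 1 2 by simp
      ultimately show ?thesis unfolding ks by (simp only: of_nat_less_iff) linarith
    qed
    ultimately show ?thesis using step[OF s' s, of "Suc n"] by simp
  qed
  have tail: "\<bar>x (p (m + i) s) - x (p m s)\<bar> \<le> c * q ^ m / (1 - q) * (1 - q ^ i)" if s: "s \<in> {0..1}" for m i s
  proof (induction i)
    case (Suc i)
    have "\<bar>x (p (m + Suc i) s) - x (p m s)\<bar> \<le> \<bar>x (p (m + i) s) - x (p m s)\<bar> + \<bar>x (p (Suc (m + i)) s) - x (p (m + i) s)\<bar>" by simp
    also have "\<dots> \<le> c * q ^ m / (1 - q) * (1 - q ^ i) + c * q ^ Suc (m + i)" using Suc refine[OF s, of "m + i"] by linarith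
    also have "c * q ^ Suc (m + i) \<le> c * q ^ (m + i)" using q \<open>0 \<le> c\<close> by (intro mult_left_mono power_decreasing) auto
    also have "c * q ^ m / (1 - q) * (1 - q ^ i) + c * q ^ (m + i) = c * q ^ m / (1 - q) * (1 - q ^ Suc i)"
      using q by (simp add: field_simps power_add)
    finally show ?case by simp
  qed simp
  have lim: "\<bar>x s - x (p m s)\<bar> \<le> c * q ^ m / (1 - q)" if s: "s \<in> {0..1}" for m s
  proof -
    have "\<bar>p n s - s\<bar> \<le> (1/2)^n" for n
    proof -
      have "real (k n s) / 2^n \<le> s" using k(1)[of s n] s by (simp add: divide_le_eq mult.commute)
      moreover have "s \<le> (real (k n s) + 1) / 2^n" using k(2)[of s n] s by (simp add: le_divide_eq mult.commute)
      ultimately show ?thesis by (simp add: p_def add_divide_distrib power_one_over abs_le_iff)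
    qed
    then have ev: "\<forall>\<^sub>F n in sequentially. norm (p n s - s) \<le> (1/2)^n" by simp
    have "(\<lambda>n. p n s - s) \<longlonglongrightarrow> 0"
      by (rule Lim_null_comparison[OF ev]) (rule LIMSEQ_power_zero, simp)
    then have "(\<lambda>n. p n s) \<longlonglongrightarrow> s" by (simp add: LIM_zero_iff)
    then have "(\<lambda>n. x (p n s)) \<longlonglongrightarrow> x s"
      by (rule continuous_on_tendsto_compose[OF cont _ s]) (intro always_eventually allI p_mem[OF s])
    then have "(\<lambda>i. x (p (m + i) s)) \<longlonglongrightarrow> x s" using LIMSEQ_ignore_initial_segment[of "\<lambda>n. x (p n s)" "x s" m] by (simp add: add.commute)
    then have "(\<lambda>i. \<bar>x (p (m + i) s) - x (p m s)\<bar>) \<longlonglongrightarrow> \<bar>x s - x (p m s)\<bar>"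
      by (intro tendsto_rabs tendsto_diff tendsto_const)
    moreover have "\<bar>x (p (m + i) s) - x (p m s)\<bar> \<le> c * q ^ m / (1 - q)" for i
    proof -
      have "c * q ^ m / (1 - q) * (1 - q ^ i) \<le> c * q ^ m / (1 - q) * 1"
        using q \<open>0 \<le> c\<close> by (intro mult_left_mono) auto
      then show ?thesis using tail[OF s, of m i] by simp
    qed
    ultimately show ?thesis by (intro LIMSEQ_le_const2) auto
  qed
  define C where "C = c * (1 + 2 / (1 - q)) / q"
  have C0: "0 \<le> C" using q \<open>0 \<le> c\<close> by (simp add: C_def)
  have main: "\<bar>x t - x s\<bar> \<le> C * (t - s) powr \<mu>" if s: "s \<in> {0..1}" and t: "t \<in> {0..1}" and "s < t" for s t
  proof -
    \<comment> \<open>The preceding level is the last one whose spacing is at least \<open>t - s\<close>.\<close>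
    define n where "n = (LEAST n. (1/2)^n < t - s)"
    have ex: "\<exists>n. (1/2)^n < t - s" using \<open>s < t\<close> real_arch_pow_inv[of "t - s" "1/2"] by auto
    have n: "(1/2)^n < t - s" unfolding n_def by (rule LeastI_ex[OF ex])
    then have "n \<noteq> 0" using s t by (cases "n = 0") auto
    then obtain m where m: "n = Suc m" by (cases n) auto
    have "\<not> (1/2)^m < t - s" using not_less_Least[of m "\<lambda>n. (1/2)^n < t - s"] m n_def by auto
    then have tm: "2^m * t \<le> 2^m * s + 1" by (simp add: field_simps power_one_over)
    have "k m t = k m s \<or> k m t = k m s + 1"
    proof -
      have "2^m * s \<le> 2^m * t" using \<open>s < t\<close> by simp
      moreover have "real (k m s) \<le> 2^m * s" "2^m * s < real (k m s) + 1" using k[of s m] s by simp_all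
      moreover have "real (k m t) \<le> 2^m * t" "2^m * t < real (k m t) + 1" using k[of t m] t by simp_all
      ultimately have "real (k m s) < real (k m t) + 1" "real (k m t) < real (k m s) + 2" using tm by linarith+
      then have "real (k m s) < real (k m t + 1)" "real (k m t) < real (k m s + 2)" by simp_all
      then show ?thesis by (simp only: of_nat_less_iff) linarith
    qed
    from step[OF s t this] have "\<bar>x (p m t) - x (p m s)\<bar> \<le> c * q ^ m" .
    then have "\<bar>x t - x s\<bar> \<le> c * q ^ m / (1 - q) + c * q ^ m + c * q ^ m / (1 - q)"
      using lim[OF s, of m] lim[OF t, of m] by linarith
    also have "\<dots> = c * (1 + 2 / (1 - q)) * q ^ m" by (simp add: algebra_simps)
    also have "\<dots> = C * q ^ n" using q by (simp add: C_def m)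
    also have "q ^ n = ((1/2)^n) powr \<mu>" using qn[of n] by (simp add: power_one_over)
    also have "C * ((1/2)^n) powr \<mu> \<le> C * (t - s) powr \<mu>"
      using C0 n \<open>0 < \<mu>\<close> by (intro mult_left_mono powr_mono2) auto
    finally show ?thesis .
  qed
  have "hoelder_bound {0..1} C \<mu> x"
    unfolding hoelder_bound_def
  proof (intro ballI)
    fix s t :: real assume st: "s \<in> {0..1}" "t \<in> {0..1}"
    consider "s < t" | "t < s" | "s = t" by linarith
    then show "\<bar>x t - x s\<bar> \<le> C * \<bar>t - s\<bar> powr \<mu>"
    proof cases
      case 1 then show ?thesis using main[OF st] by simp
    next
      case 2 then show ?thesis using main[OF st(2,1)] by (simp add: abs_minus_commute)
    qed simp
  qed
  with C0 show thesis by (rule that)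
qed

lemma (in prob_space) gaussian_rv_square_integrable:
  assumes "gaussian_rv M Z"
  shows "integrable M (\<lambda>\<omega>. (Z \<omega>)\<^sup>2)" and "Z \<in> borel_measurable M"
proof -
  have "Z \<in> borel_measurable M \<and> integrable M (\<lambda>\<omega>. (Z \<omega>)\<^sup>2)"
    using assms unfolding gaussian_rv_def
  proof (elim disjE exE conjE)
    fix m v :: real assume v: "0 < v" and D: "distributed M lborel Z (normal_density m v)"
    have Z: "Z \<in> borel_measurable M" using distributed_measurable[OF D] by simp
    have "integrable lborel (\<lambda>x. normal_density m v x * (x - m)^2 + 2 * m * (normal_density m v x * (x - m)^1) + m^2 * (normal_density m v x * (x - m)^0))"
      using v by (intro Bochner_Integration.integrable_add integrable_mult_right integrable_normal_moment)
    also have "(\<lambda>x. normal_density m v x * (x - m)^2 + 2 * m * (normal_density m v x * (x - m)^1) + m^2 * (normal_density m v x * (x - m)^0)) = (\<lambda>x. normal_density m v x * x^2)"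
      by (simp add: power2_eq_square algebra_simps)
    finally have "integrable M (\<lambda>\<omega>. (Z \<omega>)^2)"
      using distributed_integrable[OF D, of "\<lambda>x. x^2"] by simp
    with Z show ?thesis by simp
  next
    fix m assume Z: "Z \<in> borel_measurable M" and c: "AE \<omega> in M. Z \<omega> = m"
    have "integrable M (\<lambda>\<omega>. (Z \<omega>)^2) \<longleftrightarrow> integrable M (\<lambda>\<omega>. m^2)"
      using Z c by (intro integrable_cong_AE) auto
    with Z show ?thesis by simp
  qed
  then show "integrable M (\<lambda>\<omega>. (Z \<omega>)\<^sup>2)" "Z \<in> borel_measurable M" by auto
qed

text \<open>A positive variance excludes the degenerate Gaussian variables.\<close>

lemma (in prob_space) centered_gaussian_moment:
  assumes Z: "gaussian_rv M Z" and E: "expectation Z = 0" and V: "expectation (\<lambda>\<omega>. (Z \<omega>)\<^sup>2) = V" "0 < V"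
  shows "(\<integral>\<^sup>+\<omega>. ennreal ((Z \<omega>) ^ (2 * k)) \<partial>M) = ennreal (fact (2 * k) / ((2 / V) ^ k * fact k))"
  using Z unfolding gaussian_rv_def
proof (elim disjE exE conjE)
  fix m v :: real assume v: "0 < v" and D: "distributed M lborel Z (normal_density m v)"
  have m0: "m = 0" using normal_distributed_expectation[OF v D] E by simp
  have vV: "v\<^sup>2 = V" using normal_distributed_variance[OF v D] E V by simp
  have b: "has_bochner_integral lborel (\<lambda>x. normal_density 0 v x * (x - 0) ^ (2 * k)) (fact (2 * k) / ((2 / v\<^sup>2) ^ k * fact k))"
    using normal_moment_even[OF v, of 0 k] .
  have i: "integrable M (\<lambda>\<omega>. (Z \<omega>) ^ (2 * k))"
    using distributed_integrable[OF D, of "\<lambda>x. x ^ (2 * k)"] b m0 by (simp add: has_bochner_integral_iff)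
  have e: "expectation (\<lambda>\<omega>. (Z \<omega>) ^ (2 * k)) = fact (2 * k) / ((2 / v\<^sup>2) ^ k * fact k)"
    using distributed_integral[OF D, of "\<lambda>x. x ^ (2 * k)"] b m0 by (simp add: has_bochner_integral_iff)
  show ?thesis using nn_integral_eq_integral[OF i] e vV by (simp add: power_mult)
next
  fix m assume Zm: "Z \<in> borel_measurable M" and c: "AE \<omega> in M. Z \<omega> = m"
  have "expectation Z = expectation (\<lambda>_. m)" using Zm c by (intro integral_cong_AE) auto
  then have "m = 0" using E by (simp add: prob_space)
  then have "expectation (\<lambda>\<omega>. (Z \<omega>)\<^sup>2) = expectation (\<lambda>_. 0)"
    using Zm c by (intro integral_cong_AE) auto
  then show ?thesis using V by simp
qed

lemma (in prob_space) fbm_increment_moment: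
  assumes fbm: "fractional_brownian_motion M H B" and st: "0 \<le> s" "0 \<le> t" "s \<noteq> t" and H: "0 < H"
  shows "(\<lambda>\<omega>. B t \<omega> - B s \<omega>) \<in> borel_measurable M"
    and "(\<integral>\<^sup>+\<omega>. ennreal ((B t \<omega> - B s \<omega>) ^ (2 * k)) \<partial>M)
      = ennreal (fact (2 * k) / (2 ^ k * fact k) * (\<bar>t - s\<bar> powr (2 * H)) ^ k)"
proof -
  have gJ: "gaussian_rv M (\<lambda>\<omega>. \<Sum>t\<in>J. c t * B t \<omega>)" if "finite J" "J \<subseteq> {0..}" for J c
    using fbm that by (auto simp: fractional_brownian_motion_def)
  have g1: "gaussian_rv M (B u)" if "0 \<le> u" for u
    using gJ[of "{u}" "\<lambda>_. 1"] that by simp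
  have gZ: "gaussian_rv M (\<lambda>\<omega>. B t \<omega> - B s \<omega>)"
    using gJ[of "{s, t}" "\<lambda>u. if u = t then 1 else -1"] st by (simp add: algebra_simps)
  show "(\<lambda>\<omega>. B t \<omega> - B s \<omega>) \<in> borel_measurable M" by (rule gaussian_rv_square_integrable(2)[OF gZ])
  have m[measurable]: "B s \<in> borel_measurable M" "B t \<in> borel_measurable M"
    using gaussian_rv_square_integrable(2) g1 st by auto
  have sq: "integrable M (\<lambda>\<omega>. (B u \<omega>)\<^sup>2)" if "0 \<le> u" for u
    using gaussian_rv_square_integrable(1)[OF g1[OF that]] .
  have i1: "integrable M (B u)" if "0 \<le> u" for u
    using square_integrable_imp_integrable[OF gaussian_rv_square_integrable(2)[OF g1[OF that]] sq[OF that]] .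
  have ip: "integrable M (\<lambda>\<omega>. B s \<omega> * B t \<omega>)"
  proof (rule Bochner_Integration.integrable_bound)
    show "integrable M (\<lambda>\<omega>. (B s \<omega>)\<^sup>2 + (B t \<omega>)\<^sup>2)" using sq st by simp
    show "AE \<omega> in M. norm (B s \<omega> * B t \<omega>) \<le> norm ((B s \<omega>)\<^sup>2 + (B t \<omega>)\<^sup>2)"
    proof (rule AE_I2)
      fix \<omega>
      have "2 * (\<bar>B s \<omega>\<bar> * \<bar>B t \<omega>\<bar>) \<le> \<bar>B s \<omega>\<bar>^2 + \<bar>B t \<omega>\<bar>^2"
        using sum_squares_bound[of "\<bar>B s \<omega>\<bar>" "\<bar>B t \<omega>\<bar>"] by (simp add: mult.assoc)
      moreover have "0 \<le> \<bar>B s \<omega>\<bar> * \<bar>B t \<omega>\<bar>" by simp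
      ultimately have "\<bar>B s \<omega>\<bar> * \<bar>B t \<omega>\<bar> \<le> (B s \<omega>)\<^sup>2 + (B t \<omega>)\<^sup>2" unfolding power2_abs by linarith
      then show "norm (B s \<omega> * B t \<omega>) \<le> norm ((B s \<omega>)\<^sup>2 + (B t \<omega>)\<^sup>2)" by (simp add: abs_mult)
    qed
  qed simp
  have cov: "expectation (\<lambda>\<omega>. B s \<omega> * B t \<omega>) = (s powr (2 * H) + t powr (2 * H) - \<bar>t - s\<bar> powr (2 * H)) / 2"
    if "0 \<le> s" "0 \<le> t" for s t using fbm that by (auto simp: fractional_brownian_motion_def)
  have v: "expectation (\<lambda>\<omega>. (B u \<omega>)\<^sup>2) = u powr (2 * H)" if "0 \<le> u" for u
    using cov[OF that that] by (simp add: power2_eq_square)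
  have E: "expectation (\<lambda>\<omega>. B t \<omega> - B s \<omega>) = 0"
    using fbm st i1 by (simp add: fractional_brownian_motion_def)
  have "expectation (\<lambda>\<omega>. (B t \<omega> - B s \<omega>)\<^sup>2) = expectation (\<lambda>\<omega>. (B t \<omega>)\<^sup>2 - 2 * (B s \<omega> * B t \<omega>) + (B s \<omega>)\<^sup>2)"
    by (simp add: power2_eq_square algebra_simps)
  also have "\<dots> = expectation (\<lambda>\<omega>. (B t \<omega>)\<^sup>2) - 2 * expectation (\<lambda>\<omega>. B s \<omega> * B t \<omega>) + expectation (\<lambda>\<omega>. (B s \<omega>)\<^sup>2)"
    using sq st ip by simp
  also have "\<dots> = \<bar>t - s\<bar> powr (2 * H)"
    unfolding v[OF st(1)] v[OF st(2)] cov[OF st(1,2)] by (simp add: field_simps)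
  finally have V: "expectation (\<lambda>\<omega>. (B t \<omega> - B s \<omega>)\<^sup>2) = \<bar>t - s\<bar> powr (2 * H)" .
  have Vp: "0 < \<bar>t - s\<bar> powr (2 * H)" using st by simp
  have "fact (2 * k) / ((2 / (\<bar>t - s\<bar> powr (2 * H))) ^ k * fact k) = fact (2 * k) / (2 ^ k * fact k) * (\<bar>t - s\<bar> powr (2 * H)) ^ k"
    using Vp by (simp add: power_divide)
  then show "(\<integral>\<^sup>+\<omega>. ennreal ((B t \<omega> - B s \<omega>) ^ (2 * k)) \<partial>M)
      = ennreal (fact (2 * k) / (2 ^ k * fact k) * (\<bar>t - s\<bar> powr (2 * H)) ^ k)"
    using centered_gaussian_moment[OF gZ E V Vp, of k] by simp
qed

lemma hoelder_bound_scale: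
  assumes "hoelder_bound {0..1} C \<mu> (\<lambda>u. x (T * u))" "0 < T"
  shows "hoelder_bound {0..T} (C / T powr \<mu>) \<mu> x"
  unfolding hoelder_bound_def
proof (intro ballI)
  fix s t assume st: "s \<in> {0..T}" "t \<in> {0..T}"
  have "\<bar>x (T * (t / T)) - x (T * (s / T))\<bar> \<le> C * \<bar>t / T - s / T\<bar> powr \<mu>"
    using st assms(2) by (intro hoelder_boundD[OF assms(1)]) auto
  moreover have "\<bar>t / T - s / T\<bar> = \<bar>t - s\<bar> / T" using assms(2) by (simp flip: diff_divide_distrib)
  ultimately show "\<bar>x t - x s\<bar> \<le> C / T powr \<mu> * \<bar>t - s\<bar> powr \<mu>"
    using assms(2) by (simp add: powr_divide)
qed

text \<open>Choose \<open>k\<close> with \<open>2 * k * (H - \<mu>) > 1\<close>.  The increments of level \<open>n\<close> have moments of order \<open>2 * k\<close>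
  proportional to \<open>(1 / 2 ^ n) powr (2 * k * H)\<close> and there are \<open>2 ^ n\<close> of them, so the sum \<open>W\<close> of
  these powers, weighted by \<open>(2 ^ n) powr (2 * k * \<mu>)\<close>, has finite expectation.  Where \<open>W\<close> is
  finite, all dyadic increments satisfy the hypothesis of \<open>dyadic_chaining\<close>.\<close>

lemma (in prob_space) fbm_hoelder_order:
  assumes fbm: "fractional_brownian_motion M H B" and T: "0 < T" and \<mu>: "0 < \<mu>" "\<mu> < H"
  shows "AE \<omega> in M. \<exists>C\<ge>0. hoelder_bound {0..T} C \<mu> (\<lambda>t. B t \<omega>)"
proof -
  obtain k :: nat where k: "1 / (2 * (H - \<mu>)) < real k" using reals_Archimedean2 by blast
  have k0: "0 < k" using k \<mu> by (cases "k = 0") (auto simp: field_simps)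
  have k1: "1 + 2 * real k * \<mu> - 2 * real k * H < 0" using k \<mu> by (simp add: field_simps)
  define inc where "inc n j \<omega> = B (T * ((real j + 1) / 2^n)) \<omega> - B (T * (real j / 2^n)) \<omega>" for n j :: nat and \<omega>
  define c0 :: real where "c0 = fact (2 * k) / (2 ^ k * fact k)"
  have c0: "0 \<le> c0" by (simp add: c0_def)
  have T_diff: "T * ((real j + 1) / 2^n) - T * (real j / 2^n) = T / 2^n" for j n :: nat
    by (simp add: field_simps)
  have inc_m[measurable]: "inc n j \<in> borel_measurable M" for n j
    unfolding inc_def using T \<mu> T_diff[of j n]
    by (intro fbm_increment_moment(1)[OF fbm]) (auto simp: mult_nonneg_nonneg simp del: divide_const_simps)
  have mom: "(\<integral>\<^sup>+\<omega>. ennreal ((inc n j \<omega>) ^ (2 * k)) \<partial>M) = ennreal (c0 * ((T / 2^n) powr (2 * H)) ^ k)" for n j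
  proof -
    have "T * (real j / 2^n) \<noteq> T * ((real j + 1) / 2^n)" using T by (simp add: field_simps)
    then show ?thesis
      unfolding inc_def c0_def
      using fbm_increment_moment(2)[OF fbm, of "T * (real j / 2^n)" "T * ((real j + 1) / 2^n)" k] T \<mu>
      by (simp only: T_diff) simp
  qed
  define W where "W \<omega> = (\<Sum>n. \<Sum>j<2^n. ennreal ((2^n) powr (2 * real k * \<mu>) * (inc n j \<omega>) ^ (2 * k)))" for \<omega>
  define z :: real where "z = 2 powr (1 + 2 * real k * \<mu> - 2 * real k * H)"
  have z: "0 < z" "z < 1" using k1 powr_less_mono[of "1 + 2 * real k * \<mu> - 2 * real k * H" 0 2] by (auto simp: z_def)
  have "(\<integral>\<^sup>+\<omega>. W \<omega> \<partial>M) = (\<Sum>n. \<Sum>j<2^n. (\<integral>\<^sup>+\<omega>. ennreal ((2^n) powr (2 * real k * \<mu>) * (inc n j \<omega>) ^ (2 * k)) \<partial>M))"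
    unfolding W_def by (simp add: nn_integral_suminf nn_integral_sum del: sum_ennreal)
  also have "\<dots> = (\<Sum>n. ennreal (c0 * (T powr (2 * H)) ^ k * z ^ n))"
  proof (rule suminf_cong)
    fix n :: nat
    have "(\<integral>\<^sup>+\<omega>. ennreal ((2^n) powr (2 * real k * \<mu>) * (inc n j \<omega>) ^ (2 * k)) \<partial>M)
        = ennreal ((2^n) powr (2 * real k * \<mu>) * (c0 * ((T / 2^n) powr (2 * H)) ^ k))" for j
      using c0 by (simp add: ennreal_mult' nn_integral_cmult mom)
    then have "(\<Sum>j<2^n. (\<integral>\<^sup>+\<omega>. ennreal ((2^n) powr (2 * real k * \<mu>) * (inc n j \<omega>) ^ (2 * k)) \<partial>M))
       = of_nat (2^n) * ennreal ((2^n) powr (2 * real k * \<mu>) * (c0 * ((T / 2^n) powr (2 * H)) ^ k))"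
      by simp
    also have "\<dots> = ennreal (2^n * ((2^n) powr (2 * real k * \<mu>) * (c0 * ((T / 2^n) powr (2 * H)) ^ k)))"
      using c0 by (simp add: ennreal_mult' ennreal_of_nat_eq_real_of_nat)
    also have "2^n * ((2^n) powr (2 * real k * \<mu>) * (c0 * ((T / 2^n) powr (2 * H)) ^ k)) = c0 * (T powr (2 * H)) ^ k * z ^ n"
    proof -
      have e1: "((T / 2^n) powr (2 * H)) ^ k = (T powr (2 * H)) ^ k * 2 powr (- (real n * (2 * H) * real k))"
      proof -
        have "(T / 2^n) powr (2 * H) = T powr (2 * H) * 2 powr (- (real n * (2 * H)))"
        proof -
          have "(2^n) powr (2 * H) = (2::real) powr (real n * (2 * H))" by (simp add: powr_realpow[symmetric] powr_powr)
          moreover have "(T / 2^n) powr (2 * H) = T powr (2 * H) / (2^n) powr (2 * H)"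
            using T by (simp add: powr_divide)
          ultimately show ?thesis by (simp add: powr_minus divide_inverse)
        qed
        then show ?thesis by (simp add: power_mult_distrib powr_realpow[symmetric] powr_powr)
      qed
      have e2: "2^n * (2^n) powr (2 * real k * \<mu>) * 2 powr (- (real n * (2 * H) * real k)) = z ^ n"
        unfolding z_def by (simp add: powr_realpow[symmetric] powr_powr powr_add[symmetric] algebra_simps)
      show ?thesis unfolding e1 e2[symmetric] by (simp add: mult_ac)
    qed
    finally show "(\<Sum>j<2^n. (\<integral>\<^sup>+\<omega>. ennreal ((2^n) powr (2 * real k * \<mu>) * (inc n j \<omega>) ^ (2 * k)) \<partial>M)) = ennreal (c0 * (T powr (2 * H)) ^ k * z ^ n)" .
  qed
  also have "\<dots> = ennreal (\<Sum>n. c0 * (T powr (2 * H)) ^ k * z ^ n)"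
    using c0 z by (intro suminf_ennreal2 summable_mult summable_geometric) auto
  also have "\<dots> < \<infinity>" by simp
  finally have "(\<integral>\<^sup>+\<omega>. W \<omega> \<partial>M) \<noteq> \<infinity>" by simp
  moreover have "W \<in> borel_measurable M" unfolding W_def by measurable
  ultimately have "AE \<omega> in M. W \<omega> \<noteq> \<infinity>" by (intro nn_integral_PInf_AE)
  moreover have "AE \<omega> in M. continuous_on {0..} (\<lambda>t. B t \<omega>)" using fbm by (auto simp: fractional_brownian_motion_def)
  ultimately show ?thesis
  proof eventually_elim
    fix \<omega> assume W: "W \<omega> \<noteq> \<infinity>" and cont: "continuous_on {0..} (\<lambda>t. B t \<omega>)"
    then obtain w where w: "0 \<le> w" "W \<omega> = ennreal w" by (cases "W \<omega>") auto
    have le: "\<bar>inc n j \<omega>\<bar> \<le> w powr (1 / (2 * real k)) * (1 / 2^n) powr \<mu>" if "j < 2^n" for n j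
    proof -
      have "ennreal ((2^n) powr (2 * real k * \<mu>) * (inc n j \<omega>) ^ (2 * k)) \<le> (\<Sum>j<2^n. ennreal ((2^n) powr (2 * real k * \<mu>) * (inc n j \<omega>) ^ (2 * k)))"
        using that by (intro member_le_sum) auto
      also have "\<dots> \<le> W \<omega>"
        unfolding W_def using sum_le_suminf[of "\<lambda>n. \<Sum>j<2^n. ennreal ((2^n) powr (2 * real k * \<mu>) * (inc n j \<omega>) ^ (2 * k))" "{n}"] by simp
      finally have "(2^n) powr (2 * real k * \<mu>) * (inc n j \<omega>) ^ (2 * k) \<le> w" using w by (simp add: ennreal_le_iff)
      moreover have "(inc n j \<omega>) ^ (2 * k) = \<bar>inc n j \<omega>\<bar> ^ (2 * k)" by (simp add: power_even_abs)
      ultimately have "\<bar>inc n j \<omega>\<bar> ^ (2 * k) \<le> w * (1 / 2^n) powr (2 * real k * \<mu>)"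
        by (simp add: powr_divide field_simps)
      then have p: "(\<bar>inc n j \<omega>\<bar> ^ (2 * k)) powr (1 / (2 * real k)) \<le> (w * (1 / 2^n) powr (2 * real k * \<mu>)) powr (1 / (2 * real k))"
        by (intro powr_mono2) auto
      have "(\<bar>inc n j \<omega>\<bar> ^ (2 * k)) powr (1 / (2 * real k)) = \<bar>inc n j \<omega>\<bar>"
        using k0 by (cases "inc n j \<omega> = 0") (auto simp: powr_realpow[symmetric] powr_powr)
      moreover have "(w * (1 / 2^n) powr (2 * real k * \<mu>)) powr (1 / (2 * real k)) = w powr (1 / (2 * real k)) * (1 / 2^n) powr \<mu>"
        using k0 by (simp add: powr_mult powr_powr)
      ultimately show ?thesis using p by simp
    qed
    obtain C where C: "0 \<le> C" "hoelder_bound {0..1} C \<mu> (\<lambda>u. B (T * u) \<omega>)"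
    proof (rule dyadic_chaining[of "\<lambda>u. B (T * u) \<omega>" \<mu> "w powr (1 / (2 * real k))"])
      show "continuous_on {0..1} (\<lambda>u. B (T * u) \<omega>)"
        using T by (intro continuous_on_compose2[OF cont] continuous_intros) auto
    qed (use \<mu> le in \<open>auto simp: inc_def\<close>)
    show "\<exists>C\<ge>0. hoelder_bound {0..T} C \<mu> (\<lambda>t. B t \<omega>)"
      using hoelder_bound_scale[OF C(2) T] C(1) by (intro exI[of _ "C / T powr \<mu>"]) auto
  qed
qed

lemma hoelder_bound_mono:
  assumes f: "hoelder_bound S L \<nu> f" and "\<nu>' \<le> \<nu>" "0 \<le> L" and d: "\<And>s t. s \<in> S \<Longrightarrow> t \<in> S \<Longrightarrow> \<bar>t - s\<bar> \<le> d"
  shows "hoelder_bound S (L * d powr (\<nu> - \<nu>')) \<nu>' f"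
  unfolding hoelder_bound_def
proof (intro ballI)
  fix s t assume st: "s \<in> S" "t \<in> S"
  have "\<bar>f t - f s\<bar> \<le> L * \<bar>t - s\<bar> powr \<nu>" by (rule hoelder_boundD[OF f st])
  also have "\<bar>t - s\<bar> powr \<nu> = \<bar>t - s\<bar> powr (\<nu> - \<nu>') * \<bar>t - s\<bar> powr \<nu>'" by (simp flip: powr_add)
  also have "\<dots> \<le> d powr (\<nu> - \<nu>') * \<bar>t - s\<bar> powr \<nu>'"
    using d[OF st] assms(2) by (intro mult_right_mono powr_mono2) auto
  finally show "\<bar>f t - f s\<bar> \<le> L * d powr (\<nu> - \<nu>') * \<bar>t - s\<bar> powr \<nu>'"
    using \<open>0 \<le> L\<close> by (simp add: mult_left_mono mult.assoc)
qed

text \<open>Every order lies below a rational one, from which the regularity is inherited; countably many null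
  sets suffice.\<close>

theorem (in prob_space) fbm_hoelder:
  assumes fbm: "fractional_brownian_motion M H B" and T: "0 < T"
  shows "AE \<omega> in M. \<forall>\<mu>. 0 < \<mu> \<and> \<mu> < H \<longrightarrow> (\<exists>C\<ge>0. hoelder_bound {0..T} C \<mu> (\<lambda>t. B t \<omega>))"
proof -
  have "AE \<omega> in M. \<forall>q::rat. 0 < real_of_rat q \<and> real_of_rat q < H \<longrightarrow> (\<exists>C\<ge>0. hoelder_bound {0..T} C (real_of_rat q) (\<lambda>t. B t \<omega>))"
    unfolding AE_all_countable using fbm_hoelder_order[OF fbm T] by auto
  then show ?thesis
  proof eventually_elim
    fix \<omega> assume all: "\<forall>q::rat. 0 < real_of_rat q \<and> real_of_rat q < H \<longrightarrow> (\<exists>C\<ge>0. hoelder_bound {0..T} C (real_of_rat q) (\<lambda>t. B t \<omega>))"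
    show "\<forall>\<mu>. 0 < \<mu> \<and> \<mu> < H \<longrightarrow> (\<exists>C\<ge>0. hoelder_bound {0..T} C \<mu> (\<lambda>t. B t \<omega>))"
    proof (intro allI impI)
      fix \<mu> assume \<mu>: "0 < \<mu> \<and> \<mu> < H"
      obtain q where q: "\<mu> < real_of_rat q" "real_of_rat q < H" using of_rat_dense[of \<mu> H] \<mu> by auto
      then obtain C where C: "0 \<le> C" "hoelder_bound {0..T} C (real_of_rat q) (\<lambda>t. B t \<omega>)" using all \<mu> by (meson less_trans)
      have "hoelder_bound {0..T} (C * T powr (real_of_rat q - \<mu>)) \<mu> (\<lambda>t. B t \<omega>)"
        using C q by (intro hoelder_bound_mono[OF C(2)]) auto
      then show "\<exists>C\<ge>0. hoelder_bound {0..T} C \<mu> (\<lambda>t. B t \<omega>)"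
        using C by (intro exI[of _ "C * T powr (real_of_rat q - \<mu>)"]) auto
    qed
  qed
qed

section \<open>Discrete Young equations\<close>

text \<open>Sewing by halving: splitting the sum in the middle creates the single defect
  \<open>(G u - G n) * (w m - w u)\<close>, of order \<open>\<gamma> + \<mu>\<close>.  Both parts have at most two thirds of the length
  (exactly half is impossible for an odd number of steps, and the worst case is three), so with an
  exponent above \<open>1\<close> the defects form a geometric series.  The constant is independent of the mesh.\<close>

lemma discrete_young:
  fixes G w :: "int \<Rightarrow> real" and h \<gamma> \<mu> g c :: real
  assumes h: "0 \<le> h" and exps: "0 \<le> \<gamma>" "0 \<le> \<mu>" "1 < \<gamma> + \<mu>" and gc: "0 \<le> g" "0 \<le> c"
    and G: "\<And>j k. p \<le> j \<Longrightarrow> j \<le> k \<Longrightarrow> k < q \<Longrightarrow> \<bar>G k - G j\<bar> \<le> g * (h * of_int (k - j)) powr \<gamma>"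
    and w: "\<And>j k. p \<le> j \<Longrightarrow> j \<le> k \<Longrightarrow> k \<le> q \<Longrightarrow> \<bar>w k - w j\<bar> \<le> c * (h * of_int (k - j)) powr \<mu>"
    and "p \<le> n" "n \<le> m" "m \<le> q"
  shows "\<bar>(\<Sum>k\<in>{n..<m}. G k * (w (k + 1) - w k)) - G n * (w m - w n)\<bar>
    \<le> g * c / (1 - (2/3) powr (\<gamma> + \<mu> - 1)) * (h * of_int (m - n)) powr (\<gamma> + \<mu>)"
  using assms(8-)
proof (induction "nat (m - n)" arbitrary: n m rule: less_induct)
  case less
  define \<kappa> :: real where "\<kappa> = (2/3) powr (\<gamma> + \<mu> - 1)"
  have \<kappa>: "0 < \<kappa>" "\<kappa> < 1"
    unfolding \<kappa>_def using exps powr_less_mono2[of "\<gamma> + \<mu> - 1" "2/3" 1] by auto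
  let ?S = "\<lambda>n m. (\<Sum>k\<in>{n..<m}. G k * (w (k + 1) - w k)) - G n * (w m - w n)"
  show ?case
  proof (cases "m - n \<le> 1")
    case True
    then have "m = n \<or> m = n + 1" using less.prems by auto
    then have "?S n m = 0"
    proof
      assume "m = n + 1"
      moreover have "{n..<n + 1} = {n}" by auto
      ultimately show ?thesis by simp
    qed simp
    then have "\<bar>?S n m\<bar> = 0" by simp
    moreover have "0 \<le> g * c / (1 - \<kappa>) * (h * of_int (m - n)) powr (\<gamma> + \<mu>)"
      using gc \<kappa> by auto
    ultimately show ?thesis unfolding \<kappa>_def by linarith
  next
    case False
    define u where "u = n + (m - n) div 2"
    define e where "e = (m - n) div 2"
    have e: "2 * e \<le> m - n" "m - n \<le> 2 * e + 1" "1 \<le> e" using False unfolding e_def by linarith+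
    have u: "n < u" "u < m" "3 * (u - n) \<le> 2 * (m - n)" "3 * (m - u) \<le> 2 * (m - n)"
    proof -
      have ue: "u = n + e" by (simp add: u_def e_def)
      show "n < u" using ue e by simp
      show "u < m" using ue e by simp
      have "3 * e \<le> 2 * (m - n)" using e by simp
      then show "3 * (u - n) \<le> 2 * (m - n)" using ue by simp
      have "m - n \<le> 3 * e" using e by simp
      then show "3 * (m - u) \<le> 2 * (m - n)" using ue by simp
    qed
    define x y z where "x = h * of_int (u - n)" and "y = h * of_int (m - u)" and "z = h * of_int (m - n)"
    have xyz: "0 \<le> x" "0 \<le> y" unfolding x_def y_def using h u by (intro mult_nonneg_nonneg; simp)+
    have z: "z = x + y" by (simp add: x_def y_def z_def algebra_simps)
    have u1: "3 * (real_of_int u - real_of_int n) \<le> 2 * (real_of_int m - real_of_int n)"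
      using of_int_le_iff[where 'a=real, THEN iffD2, OF u(3)] by simp
    have u2: "3 * (real_of_int m - real_of_int u) \<le> 2 * (real_of_int m - real_of_int n)"
      using of_int_le_iff[where 'a=real, THEN iffD2, OF u(4)] by simp
    have x23: "x \<le> 2/3 * z" using mult_left_mono[OF u1 h] by (simp add: x_def z_def algebra_simps)
    have y23: "y \<le> 2/3 * z" using mult_left_mono[OF u2 h] by (simp add: y_def z_def algebra_simps)
    have split: "{n..<m} = {n..<u} \<union> {u..<m}" using u by auto
    have sum: "(\<Sum>k\<in>{n..<m}. G k * (w (k + 1) - w k)) = (\<Sum>k\<in>{n..<u}. G k * (w (k + 1) - w k)) + (\<Sum>k\<in>{u..<m}. G k * (w (k + 1) - w k))"
      unfolding split by (rule sum.union_disjoint) auto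
    have S: "?S n m = ?S n u + ?S u m + (G u - G n) * (w m - w u)"
      unfolding sum by (simp add: algebra_simps)
    have 1: "\<bar>?S n u\<bar> \<le> g * c / (1 - \<kappa>) * x powr (\<gamma> + \<mu>)"
      unfolding x_def \<kappa>_def using u less.prems by (intro less.hyps) auto
    have 2: "\<bar>?S u m\<bar> \<le> g * c / (1 - \<kappa>) * y powr (\<gamma> + \<mu>)"
      unfolding y_def \<kappa>_def using u less.prems by (intro less.hyps) auto
    have 3: "\<bar>(G u - G n) * (w m - w u)\<bar> \<le> g * c * z powr (\<gamma> + \<mu>)"
    proof -
      have "\<bar>(G u - G n) * (w m - w u)\<bar> \<le> (g * x powr \<gamma>) * (c * y powr \<mu>)"
        unfolding abs_mult x_def y_def using u less.prems gc by (intro mult_mono G w) auto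
      also have "\<dots> \<le> (g * z powr \<gamma>) * (c * z powr \<mu>)"
        using xyz z gc exps by (intro mult_mono mult_left_mono powr_mono2) auto
      finally show ?thesis by (simp add: powr_add mult_ac)
    qed
    have pw: "t powr (\<gamma> + \<mu>) \<le> t * (\<kappa> * z powr (\<gamma> + \<mu> - 1))" if "0 \<le> t" "t \<le> 2/3 * z" for t
    proof -
      have "t powr (\<gamma> + \<mu>) = t * t powr (\<gamma> + \<mu> - 1)"
        using that by (cases "t = 0") (auto simp: powr_diff)
      also have "t powr (\<gamma> + \<mu> - 1) \<le> (2/3 * z) powr (\<gamma> + \<mu> - 1)"
        using that exps by (intro powr_mono2) auto
      also have "(2/3 * z) powr (\<gamma> + \<mu> - 1) = \<kappa> * z powr (\<gamma> + \<mu> - 1)"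
        unfolding \<kappa>_def by (rule powr_mult)
      finally show ?thesis using that by (simp add: mult_left_mono)
    qed
    have "x powr (\<gamma> + \<mu>) + y powr (\<gamma> + \<mu>) \<le> (x + y) * (\<kappa> * z powr (\<gamma> + \<mu> - 1))"
      using pw[OF xyz(1) x23] pw[OF xyz(2) y23] by (simp only: distrib_right)
    also have "\<dots> = \<kappa> * z powr (\<gamma> + \<mu>)"
      using xyz z by (cases "z = 0") (auto simp: powr_diff)
    finally have 4: "x powr (\<gamma> + \<mu>) + y powr (\<gamma> + \<mu>) \<le> \<kappa> * z powr (\<gamma> + \<mu>)" .
    have "\<bar>?S n m\<bar> \<le> g * c / (1 - \<kappa>) * (x powr (\<gamma> + \<mu>) + y powr (\<gamma> + \<mu>)) + g * c * z powr (\<gamma> + \<mu>)"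
      unfolding S distrib_left using 1 2 3 by linarith
    also have "\<dots> \<le> g * c / (1 - \<kappa>) * (\<kappa> * z powr (\<gamma> + \<mu>)) + g * c * z powr (\<gamma> + \<mu>)"
      using 4 gc \<kappa> by (intro add_right_mono mult_left_mono) auto
    also have "\<dots> = g * c / (1 - \<kappa>) * z powr (\<gamma> + \<mu>)"
      using \<kappa> by (simp add: divide_simps algebra_simps)
    finally show ?thesis unfolding \<kappa>_def z_def .
  qed
qed

text \<open>A linear-growth discrete equation with memory.  Here \<open>a\<close> is the size of the inhomogeneity, \<open>S\<close> any
  bound for the past of \<open>x\<close>, and \<open>D\<close> any bound for the increments of the past over the lag
  \<open>m - n\<close>.  Stating the hypotheses for all such \<open>S\<close> and \<open>D\<close> allows coefficients that depend on
  the whole segment of length \<open>N\<close>; for the same reason indices start at \<open>-N\<close>.\<close>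

locale discrete_young_equation =
  fixes h T \<gamma> \<mu> A c a :: real and N :: int and x \<beta> G w R :: "int \<Rightarrow> real"
  assumes h: "0 < h" "h * of_int N = T" and N: "0 \<le> N"
    and exps: "0 < \<gamma>" "\<gamma> \<le> \<mu>" "\<mu> \<le> 1" "1 < \<gamma> + \<mu>"
    and nonneg: "0 \<le> A" "0 \<le> c" "0 \<le> a"
    and rec: "\<And>n. 0 \<le> n \<Longrightarrow> n < N \<Longrightarrow> x (n + 1) = x n + \<beta> n * h + G n * (w (n + 1) - w n) + R n"
    and R: "\<And>n. 0 \<le> n \<Longrightarrow> n < N \<Longrightarrow> \<bar>R n\<bar> \<le> a * h"
    and w: "\<And>j k. 0 \<le> j \<Longrightarrow> j \<le> k \<Longrightarrow> k \<le> N \<Longrightarrow> \<bar>w k - w j\<bar> \<le> c * (h * of_int (k - j)) powr \<mu>"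
    and size_\<beta>: "\<And>n S. 0 \<le> n \<Longrightarrow> n < N \<Longrightarrow> (\<And>k. -N \<le> k \<Longrightarrow> k \<le> n \<Longrightarrow> \<bar>x k\<bar> \<le> S) \<Longrightarrow> \<bar>\<beta> n\<bar> \<le> A * (a + S)"
    and size_G: "\<And>n S. 0 \<le> n \<Longrightarrow> n < N \<Longrightarrow> (\<And>k. -N \<le> k \<Longrightarrow> k \<le> n \<Longrightarrow> \<bar>x k\<bar> \<le> S) \<Longrightarrow> \<bar>G n\<bar> \<le> A * (a + S)"
    and incr_G: "\<And>n m S D. 0 \<le> n \<Longrightarrow> n \<le> m \<Longrightarrow> m < N \<Longrightarrow> (\<And>k. -N \<le> k \<Longrightarrow> k \<le> m \<Longrightarrow> \<bar>x k\<bar> \<le> S) \<Longrightarrow>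
        (\<And>k. -N \<le> k \<Longrightarrow> k \<le> n \<Longrightarrow> \<bar>x (k + (m - n)) - x k\<bar> \<le> D) \<Longrightarrow>
        \<bar>G m - G n\<bar> \<le> A * ((a + S) * (h * of_int (m - n)) powr \<gamma> + D)"
begin

text \<open>One number bounds the inhomogeneity, the values and the \<open>\<gamma>\<close>-Hoelder constant up to time \<open>p\<close>; it is
  the quantity that grows by a fixed factor from block to block.\<close>

definition controlled :: "real \<Rightarrow> int \<Rightarrow> bool" where
  "controlled V p \<longleftrightarrow> a \<le> V \<and> (\<forall>k. -N \<le> k \<and> k \<le> p \<longrightarrow> \<bar>x k\<bar> \<le> V) \<and>
     (\<forall>j k. -N \<le> j \<and> j \<le> k \<and> k \<le> p \<longrightarrow> \<bar>x k - x j\<bar> \<le> V * (h * of_int (k - j)) powr \<gamma>)"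

definition young_const :: real where
  "young_const = 1 / (1 - (2/3) powr (\<gamma> + \<mu> - 1))"

definition block_const :: real where
  "block_const = 2 * A * (1 + c) + 3 * young_const * A * c + 1"

definition growth :: real where
  "growth = 1 + 2 * block_const * (max 1 T)^2"

lemma young_const_pos: "0 < young_const"
  unfolding young_const_def using exps powr_less_mono2[of "\<gamma> + \<mu> - 1" "2/3" 1] by auto

lemma block_const_ge: "1 \<le> block_const"
  unfolding block_const_def using young_const_pos nonneg by auto

lemma growth_ge: "1 + 2 * block_const \<le> growth"
proof -
  have "1 \<le> (max 1 T)^2" by (intro one_le_power) auto
  then have "2 * block_const * 1 \<le> 2 * block_const * (max 1 T)^2"
    using block_const_ge by (intro mult_left_mono) auto
  then show ?thesis by (simp add: growth_def)
qed

lemma join_powr: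
  fixes V Q s t :: real
  assumes "0 \<le> s" "0 \<le> t" "0 \<le> V" "0 \<le> Q"
  shows "V * s powr \<gamma> + Q * t powr \<gamma> \<le> (V + Q) * (s + t) powr \<gamma>"
  unfolding distrib_right using assms exps by (intro add_mono mult_left_mono powr_mono2) auto

text \<open>Hoelder bounds on both sides of \<open>p\<close> combine to one across \<open>p\<close>.  The coefficients after \<open>p\<close> see the
  past before \<open>p\<close>, so both parts are needed at once.\<close>

lemma controlled_extend:
  assumes V: "controlled V p" and "0 \<le> p" "p \<le> q" "0 \<le> Q"
    and Q: "\<And>j k. p \<le> j \<Longrightarrow> j \<le> k \<Longrightarrow> k \<le> q \<Longrightarrow> \<bar>x k - x j\<bar> \<le> Q * (h * of_int (k - j)) powr \<gamma>"
  shows "\<And>j k. -N \<le> j \<Longrightarrow> j \<le> k \<Longrightarrow> k \<le> q \<Longrightarrow> \<bar>x k - x j\<bar> \<le> (V + Q) * (h * of_int (k - j)) powr \<gamma>"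
    and "\<And>k \<tau>. -N \<le> k \<Longrightarrow> k \<le> q \<Longrightarrow> h * of_int (k - p) \<le> \<tau> \<Longrightarrow> 0 \<le> \<tau> \<Longrightarrow> \<bar>x k\<bar> \<le> V + Q * \<tau> powr \<gamma>"
proof -
  have V0: "0 \<le> V" using V nonneg by (auto simp: controlled_def)
  show "\<bar>x k - x j\<bar> \<le> (V + Q) * (h * of_int (k - j)) powr \<gamma>" if jk: "-N \<le> j" "j \<le> k" "k \<le> q" for j k
  proof -
    consider "k \<le> p" | "p \<le> j" | "j \<le> p" "p \<le> k" by linarith
    then show ?thesis
    proof cases
      case 1
      then have "\<bar>x k - x j\<bar> \<le> V * (h * of_int (k - j)) powr \<gamma>" using V jk by (auto simp: controlled_def)
      also have "\<dots> \<le> (V + Q) * (h * of_int (k - j)) powr \<gamma>" using \<open>0 \<le> Q\<close> by (intro mult_right_mono) auto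
      finally show ?thesis .
    next
      case 2
      then have "\<bar>x k - x j\<bar> \<le> Q * (h * of_int (k - j)) powr \<gamma>" using Q jk by auto
      also have "\<dots> \<le> (V + Q) * (h * of_int (k - j)) powr \<gamma>" using V0 by (intro mult_right_mono) auto
      finally show ?thesis .
    next
      case 3
      have "\<bar>x k - x j\<bar> \<le> \<bar>x p - x j\<bar> + \<bar>x k - x p\<bar>" by linarith
      also have "\<dots> \<le> V * (h * of_int (p - j)) powr \<gamma> + Q * (h * of_int (k - p)) powr \<gamma>"
        using V Q 3 jk by (intro add_mono) (auto simp: controlled_def)
      also have "\<dots> \<le> (V + Q) * (h * of_int (p - j) + h * of_int (k - p)) powr \<gamma>"
        using V0 \<open>0 \<le> Q\<close> 3 h by (intro join_powr) auto
      also have "h * of_int (p - j) + h * of_int (k - p) = h * of_int (k - j)"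
        by (simp add: algebra_simps)
      finally show ?thesis .
    qed
  qed
  show "\<bar>x k\<bar> \<le> V + Q * \<tau> powr \<gamma>" if k: "-N \<le> k" "k \<le> q" "h * of_int (k - p) \<le> \<tau>" "0 \<le> \<tau>" for k \<tau>
  proof (cases "k \<le> p")
    case True
    then have "\<bar>x k\<bar> \<le> V" using V k by (auto simp: controlled_def)
    moreover have "0 \<le> Q * \<tau> powr \<gamma>" using \<open>0 \<le> Q\<close> by simp
    ultimately show ?thesis by linarith
  next
    case False
    have "-N \<le> p" using N \<open>0 \<le> p\<close> by linarith
    then have "\<bar>x p\<bar> \<le> V" using V by (auto simp: controlled_def)
    moreover have "\<bar>x k - x p\<bar> \<le> Q * (h * of_int (k - p)) powr \<gamma>" using Q False k by auto
    moreover have "Q * (h * of_int (k - p)) powr \<gamma> \<le> Q * \<tau> powr \<gamma>"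
      using \<open>0 \<le> Q\<close> k False h exps by (intro mult_left_mono powr_mono2) auto
    ultimately show ?thesis by linarith
  qed
qed

lemma increment_sum:
  assumes "0 \<le> n" "n \<le> m" "m \<le> N"
  shows "x m - x n = (\<Sum>k\<in>{n..<m}. \<beta> k * h + R k) + (\<Sum>k\<in>{n..<m}. G k * (w (k + 1) - w k))"
  using assms(2,3)
proof (induction m rule: int_ge_induct)
  case (step m)
  have "{n..<m + 1} = insert m {n..<m}" using step by auto
  then show ?case using step rec[of m] assms(1) by (simp add: algebra_simps)
qed simp

text \<open>On a time interval of length at most \<open>\<tau>\<close> the Hoelder constant \<open>Q = 2 * block_const * V\<close> reproduces
  itself: assuming it up to \<open>q\<close>, the increments ending at \<open>q + 1\<close> have a constant at most \<open>Q / 2\<close>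
  from the new part, by the smallness of \<open>\<tau>\<close>, plus \<open>block_const * V = Q / 2\<close> from the past and the
  inhomogeneity.  The sum up to \<open>q + 1\<close> involves \<open>x\<close> only up to \<open>q\<close>, hence the induction on \<open>q\<close>.\<close>

lemma block:
  assumes V: "controlled V p" and p: "0 \<le> p" and \<tau>: "0 < \<tau>" "\<tau> \<le> 1"
    and small: "A * (1 + c) * \<tau> powr \<gamma> + 2 * young_const * A * c * \<tau> powr \<mu> \<le> 1/2"
    and q: "p \<le> q" "q \<le> N" "h * of_int (q - p) \<le> \<tau>"
  shows "\<forall>j k. p \<le> j \<and> j \<le> k \<and> k \<le> q \<longrightarrow> \<bar>x k - x j\<bar> \<le> (2 * block_const * V) * (h * of_int (k - j)) powr \<gamma>"
  using q
proof (induction q rule: int_ge_induct)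
  case base
  show ?case
  proof (intro allI impI)
    fix j k assume "p \<le> j \<and> j \<le> k \<and> k \<le> p"
    then have "k = j" by auto
    then show "\<bar>x k - x j\<bar> \<le> (2 * block_const * V) * (h * of_int (k - j)) powr \<gamma>" by simp
  qed
next
  case (step q)
  define Q where "Q = 2 * block_const * V"
  have V0: "0 \<le> V" "a \<le> V" using V nonneg by (auto simp: controlled_def)
  have Q0: "0 \<le> Q" using V0 block_const_ge by (auto simp: Q_def)
  have hq: "h * of_int (q - p) \<le> h * of_int (q + 1 - p)" using h by (intro mult_left_mono) auto
  have IH: "\<bar>x k - x j\<bar> \<le> Q * (h * of_int (k - j)) powr \<gamma>" if "p \<le> j" "j \<le> k" "k \<le> q" for j k
    using step.IH step.prems hq that by (auto simp: Q_def)
  note ext = controlled_extend[OF V p \<open>p \<le> q\<close> Q0 IH, simplified]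
  define S where "S = V + Q * \<tau> powr \<gamma>"
  have sizex: "\<bar>x k\<bar> \<le> S" if "-N \<le> k" "k \<le> q" for k
  proof -
    have "h * of_int (k - p) \<le> h * of_int (q - p)" using that h by (intro mult_left_mono) auto
    then show ?thesis unfolding S_def using ext(2)[of k \<tau>] that \<tau> hq step.prems by auto
  qed
  have S0: "0 \<le> S" using V0 Q0 by (auto simp: S_def)
  define g where "g = A * ((a + S) + (V + Q))"
  have g0: "0 \<le> g" using nonneg S0 V0 Q0 by (auto simp: g_def)
  have GH: "\<bar>G k - G j\<bar> \<le> g * (h * of_int (k - j)) powr \<gamma>" if "p \<le> j" "j \<le> k" "k < q + 1" for j k
  proof -
    have "\<bar>G k - G j\<bar> \<le> A * ((a + S) * (h * of_int (k - j)) powr \<gamma> + (V + Q) * (h * of_int (k - j)) powr \<gamma>)"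
    proof (rule incr_G)
      fix i assume "-N \<le> i" "i \<le> j"
      then show "\<bar>x (i + (k - j)) - x i\<bar> \<le> (V + Q) * (h * of_int (k - j)) powr \<gamma>"
        using ext(1)[of i "i + (k - j)"] that by auto
    qed (use that p sizex step.prems in auto)
    then show ?thesis by (simp add: g_def algebra_simps)
  qed
  have new: "\<bar>x (q + 1) - x n\<bar> \<le> Q * (h * of_int (q + 1 - n)) powr \<gamma>" if n: "p \<le> n" "n \<le> q" for n
  proof -
    define d where "d = h * of_int (q + 1 - n)"
    have "h * of_int (q + 1 - n) \<le> h * of_int (q + 1 - p)" using n h by (intro mult_left_mono) auto
    from order_trans[OF this step.prems(2)] have d: "0 < d" "d \<le> \<tau>" using n h by (simp_all add: d_def)
    have sum1: "\<bar>\<Sum>k\<in>{n..<q+1}. \<beta> k * h + R k\<bar> \<le> (A * (a + S) + a) * d"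
    proof -
      have "\<bar>\<Sum>k\<in>{n..<q+1}. \<beta> k * h + R k\<bar> \<le> (\<Sum>k\<in>{n..<q+1}. A * (a + S) * h + a * h)"
      proof (rule order_trans[OF sum_abs sum_mono])
        fix k assume k: "k \<in> {n..<q+1}"
        have "\<bar>\<beta> k\<bar> \<le> A * (a + S)" using k n p step.prems sizex by (intro size_\<beta>) auto
        then have "\<bar>\<beta> k\<bar> * h \<le> A * (a + S) * h" using h by (intro mult_right_mono) auto
        moreover have "\<bar>R k\<bar> \<le> a * h" using k n p step.prems by (intro R) auto
        moreover have "\<bar>\<beta> k * h + R k\<bar> \<le> \<bar>\<beta> k\<bar> * h + \<bar>R k\<bar>"
          using h abs_triangle_ineq[of "\<beta> k * h" "R k"] by (simp add: abs_mult)
        ultimately show "\<bar>\<beta> k * h + R k\<bar> \<le> A * (a + S) * h + a * h" by linarith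
      qed
      also have "\<dots> = (A * (a + S) + a) * d" using n by (simp add: d_def algebra_simps)
      finally show ?thesis .
    qed
    have wd: "\<bar>w (q + 1) - w n\<bar> \<le> c * d powr \<mu>" unfolding d_def using n p step.prems by (intro w) auto
    have "\<bar>G n\<bar> \<le> A * (a + S)" using n p step.prems sizex by (intro size_G) auto
    then have "\<bar>G n * (w (q + 1) - w n)\<bar> \<le> A * (a + S) * (c * d powr \<mu>)"
      unfolding abs_mult using wd nonneg S0 by (intro mult_mono) auto
    moreover have "\<bar>(\<Sum>k\<in>{n..<q+1}. G k * (w (k + 1) - w k)) - G n * (w (q + 1) - w n)\<bar> \<le> young_const * g * c * d powr (\<gamma> + \<mu>)"
    proof -
      have "\<bar>(\<Sum>k\<in>{n..<q+1}. G k * (w (k + 1) - w k)) - G n * (w (q + 1) - w n)\<bar> \<le> g * c / (1 - (2/3) powr (\<gamma> + \<mu> - 1)) * d powr (\<gamma> + \<mu>)"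
        unfolding d_def using h exps nonneg g0 n p step.prems GH
        by (intro discrete_young[where p=p and q="q+1"] w) auto
      then show ?thesis by (simp add: young_const_def)
    qed
    ultimately have sum2: "\<bar>\<Sum>k\<in>{n..<q+1}. G k * (w (k + 1) - w k)\<bar> \<le> A * (a + S) * (c * d powr \<mu>) + young_const * g * c * d powr (\<gamma> + \<mu>)"
      by linarith
    have e1: "d \<le> d powr \<gamma>" using d \<tau> exps powr_mono'[of \<gamma> 1 d] by simp
    have e2: "d powr \<mu> \<le> d powr \<gamma>" using d \<tau> exps by (intro powr_mono') auto
    have e3: "d powr (\<gamma> + \<mu>) \<le> d powr \<gamma> * \<tau> powr \<mu>"
      unfolding powr_add using d exps by (intro mult_left_mono powr_mono2) auto
    have "\<bar>x (q + 1) - x n\<bar> \<le> \<bar>\<Sum>k\<in>{n..<q+1}. \<beta> k * h + R k\<bar> + \<bar>\<Sum>k\<in>{n..<q+1}. G k * (w (k + 1) - w k)\<bar>"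
      using increment_sum[of n "q + 1"] n p step.prems abs_triangle_ineq by auto
    also have "\<dots> \<le> (A * (a + S) + a) * d + (A * (a + S) * (c * d powr \<mu>) + young_const * g * c * d powr (\<gamma> + \<mu>))"
      using sum1 sum2 by linarith
    also have "\<dots> \<le> (A * (a + S) + a) * d powr \<gamma> + (A * (a + S) * (c * d powr \<gamma>) + young_const * g * c * (d powr \<gamma> * \<tau> powr \<mu>))"
    proof (intro add_mono)
      show "(A * (a + S) + a) * d \<le> (A * (a + S) + a) * d powr \<gamma>"
        using nonneg S0 by (intro mult_left_mono e1) simp
      show "A * (a + S) * (c * d powr \<mu>) \<le> A * (a + S) * (c * d powr \<gamma>)"
        using nonneg S0 by (intro mult_left_mono e2) simp_all
      show "young_const * g * c * d powr (\<gamma> + \<mu>) \<le> young_const * g * c * (d powr \<gamma> * \<tau> powr \<mu>)"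
        using nonneg g0 young_const_pos by (intro mult_left_mono e3) simp
    qed
    also have "\<dots> = (A * (1 + c) * (a + S) + a + young_const * c * \<tau> powr \<mu> * g) * d powr \<gamma>"
      by (simp add: algebra_simps)
    also have "\<dots> \<le> Q * d powr \<gamma>"
    proof (rule mult_right_mono)
      have t1: "\<tau> powr \<mu> \<le> 1" "\<tau> powr \<gamma> \<le> 1" using \<tau> exps by (auto intro!: powr_le1)
      have "A * (1 + c) * (a + S) \<le> A * (1 + c) * (2 * V + Q * \<tau> powr \<gamma>)"
        using nonneg V0 by (intro mult_left_mono) (auto simp: S_def)
      moreover have "young_const * c * \<tau> powr \<mu> * g \<le> young_const * c * \<tau> powr \<mu> * (A * (3 * V + 2 * Q))"
      proof (rule mult_left_mono)
        have "Q * \<tau> powr \<gamma> \<le> Q * 1" using t1 Q0 by (intro mult_left_mono) auto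
        then show "g \<le> A * (3 * V + 2 * Q)" unfolding g_def S_def using nonneg V0 by (intro mult_left_mono) auto
      qed (use young_const_pos nonneg in auto)
      moreover have "young_const * c * \<tau> powr \<mu> * (A * (3 * V + 2 * Q)) \<le> 3 * young_const * A * c * V + (2 * young_const * A * c * \<tau> powr \<mu>) * Q"
      proof -
        have "(3 * young_const * A * c * V) * \<tau> powr \<mu> \<le> (3 * young_const * A * c * V) * 1"
          using young_const_pos nonneg V0 t1 by (intro mult_left_mono) auto
        then show ?thesis by (simp add: algebra_simps)
      qed
      moreover have "(A * (1 + c) * \<tau> powr \<gamma> + 2 * young_const * A * c * \<tau> powr \<mu>) * Q \<le> 1/2 * Q"
        using small Q0 by (intro mult_right_mono) auto
      moreover have "Q = 2 * ((2 * A * (1 + c) + 3 * young_const * A * c + 1) * V)"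
        by (simp add: Q_def block_const_def)
      ultimately show "A * (1 + c) * (a + S) + a + young_const * c * \<tau> powr \<mu> * g \<le> Q"
        using V0 by (simp add: algebra_simps)
    qed simp
    finally show ?thesis by (simp add: d_def)
  qed
  show ?case
  proof (intro allI impI)
    fix j k assume jk: "p \<le> j \<and> j \<le> k \<and> k \<le> q + 1"
    show "\<bar>x k - x j\<bar> \<le> (2 * block_const * V) * (h * of_int (k - j)) powr \<gamma>"
    proof (cases "k = q + 1")
      case True
      then show ?thesis using new[of j] jk by (cases "j = q + 1") (auto simp: Q_def)
    next
      case False
      then show ?thesis using IH[of j k] jk by (auto simp: Q_def)
    qed
  qed
qed

text \<open>If the mesh exceeds \<open>\<tau>\<close>, a block consists of one step, over which no smallness is available.  None
  is needed, since the step only involves coefficients of the past; its length is at most \<open>T\<close>.\<close>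

lemma single_step:
  assumes V: "controlled V p" and p: "0 \<le> p" "p < N"
  shows "\<bar>x (p + 1) - x p\<bar> \<le> (2 * block_const * max 1 T * V) * h powr \<gamma>"
proof -
  have V0: "0 \<le> V" "a \<le> V" using V nonneg by (auto simp: controlled_def)
  have "h * 1 \<le> h * of_int N" using h p by (intro mult_left_mono) auto
  then have hT: "h \<le> T" using h by simp
  have sizex: "\<And>k. -N \<le> k \<Longrightarrow> k \<le> p \<Longrightarrow> \<bar>x k\<bar> \<le> V" using V by (auto simp: controlled_def)
  have b: "\<bar>\<beta> p\<bar> \<le> A * (2 * V)" using size_\<beta>[OF p sizex] V0 nonneg mult_left_mono[of "a + V" "2 * V" A] by linarith
  have g: "\<bar>G p\<bar> \<le> A * (2 * V)" using size_G[OF p sizex] V0 nonneg mult_left_mono[of "a + V" "2 * V" A] by linarith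
  have pw: "h powr e \<le> max 1 T * h powr \<gamma>" if "\<gamma> \<le> e" "e \<le> 1" for e
  proof -
    have "h powr e = h powr (e - \<gamma>) * h powr \<gamma>" by (simp flip: powr_add)
    also have "h powr (e - \<gamma>) \<le> max 1 T powr (e - \<gamma>)" using h hT that by (intro powr_mono2) auto
    also have "\<dots> \<le> max 1 T powr 1" using that exps by (intro powr_mono) auto
    finally show ?thesis by (simp add: mult_right_mono)
  qed
  have "\<bar>x (p + 1) - x p\<bar> \<le> \<bar>\<beta> p\<bar> * h + \<bar>G p\<bar> * \<bar>w (p + 1) - w p\<bar> + \<bar>R p\<bar>"
  proof -
    have "x (p + 1) - x p = \<beta> p * h + G p * (w (p + 1) - w p) + R p" using rec[OF p] by simp
    moreover have "\<bar>\<beta> p * h\<bar> = \<bar>\<beta> p\<bar> * h" using h by (simp add: abs_mult)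
    moreover have "\<bar>G p * (w (p + 1) - w p)\<bar> = \<bar>G p\<bar> * \<bar>w (p + 1) - w p\<bar>" by (rule abs_mult)
    ultimately show ?thesis by linarith
  qed
  also have "\<dots> \<le> A * (2 * V) * (max 1 T * h powr \<gamma>) + A * (2 * V) * (c * (max 1 T * h powr \<gamma>)) + V * (max 1 T * h powr \<gamma>)"
  proof (intro add_mono)
    have h1: "h \<le> max 1 T * h powr \<gamma>" using pw[of 1] exps h by simp
    show "\<bar>\<beta> p\<bar> * h \<le> A * (2 * V) * (max 1 T * h powr \<gamma>)"
      using b h1 h nonneg V0 by (intro mult_mono) simp_all
    have "\<bar>w (p + 1) - w p\<bar> \<le> c * h powr \<mu>" using w[of p "p + 1"] p by simp
    also have "\<dots> \<le> c * (max 1 T * h powr \<gamma>)" using pw[of \<mu>] exps nonneg by (intro mult_left_mono) simp_all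
    finally show "\<bar>G p\<bar> * \<bar>w (p + 1) - w p\<bar> \<le> A * (2 * V) * (c * (max 1 T * h powr \<gamma>))"
      using g nonneg V0 by (intro mult_mono) simp_all
    have "a * h \<le> V * (max 1 T * h powr \<gamma>)" using h1 h nonneg V0 by (intro mult_mono) simp_all
    then show "\<bar>R p\<bar> \<le> V * (max 1 T * h powr \<gamma>)" using R[OF p] by linarith
  qed
  also have "\<dots> = (2 * A * (1 + c) + 1) * (max 1 T * V * h powr \<gamma>)" by (simp add: algebra_simps)
  also have "\<dots> \<le> (2 * block_const) * (max 1 T * V * h powr \<gamma>)"
    using V0 young_const_pos nonneg by (intro mult_right_mono) (auto simp: block_const_def)
  finally show ?thesis by (simp add: mult_ac)
qed

lemma controlled_step:
  assumes V: "controlled V p" and p: "0 \<le> p" and \<tau>: "0 < \<tau>" "\<tau> \<le> 1"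
    and small: "A * (1 + c) * \<tau> powr \<gamma> + 2 * young_const * A * c * \<tau> powr \<mu> \<le> 1/2"
    and q: "p \<le> q" "q \<le> N" "q = p + 1 \<or> h * of_int (q - p) \<le> \<tau>"
  shows "controlled (growth * V) q"
proof -
  have V0: "0 \<le> V" "a \<le> V" using V nonneg by (auto simp: controlled_def)
  define T1 where "T1 = max 1 T"
  have T1: "1 \<le> T1" "T \<le> T1" by (auto simp: T1_def)
  define Q where "Q = 2 * block_const * T1 * V"
  have Q0: "0 \<le> Q" using V0 block_const_ge T1 by (auto simp: Q_def)
  have QH: "\<bar>x k - x j\<bar> \<le> Q * (h * of_int (k - j)) powr \<gamma>" if jk: "p \<le> j" "j \<le> k" "k \<le> q" for j k
    using q(3)
  proof
    assume "q = p + 1"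
    then have "j = k \<or> (j = p \<and> k = p + 1)" using jk by auto
    then show ?thesis
    proof
      assume "j = p \<and> k = p + 1"
      then show ?thesis using single_step[OF V p] q \<open>q = p + 1\<close> by (simp add: Q_def T1_def)
    qed (use Q0 in auto)
  next
    assume "h * of_int (q - p) \<le> \<tau>"
    from block[OF V p \<tau> small q(1,2) this] jk
    have "\<bar>x k - x j\<bar> \<le> (2 * block_const * V) * (h * of_int (k - j)) powr \<gamma>" by auto
    also have "\<dots> \<le> Q * (h * of_int (k - j)) powr \<gamma>"
      using T1 V0 block_const_ge mult_left_mono[of 1 T1 "2 * block_const * V"] unfolding Q_def by (intro mult_right_mono) (auto simp: mult_ac)
    finally show ?thesis .
  qed
  note ext = controlled_extend[OF V p q(1) Q0 QH, simplified]
  have VQ: "V + Q * T1 \<le> growth * V" "V + Q \<le> V + Q * T1"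
    using Q0 T1 mult_left_mono[of 1 T1 Q] by (auto simp: Q_def growth_def T1_def power2_eq_square algebra_simps)
  show ?thesis
    unfolding controlled_def
  proof (intro conjI allI impI)
    have "1 * V \<le> growth * V" using growth_ge block_const_ge V0 by (intro mult_right_mono) auto
    then show "a \<le> growth * V" using V0 by simp
    fix k assume k: "-N \<le> k \<and> k \<le> q"
    have "h * of_int (k - p) \<le> h * of_int N" using k p q h by (intro mult_left_mono) auto
    then have "\<bar>x k\<bar> \<le> V + Q * T1 powr \<gamma>" using ext(2)[of k T1] k T1 h by auto
    also have "\<dots> \<le> V + Q * T1"
      using Q0 T1 exps powr_mono[of \<gamma> 1 T1] by (intro add_left_mono mult_left_mono) auto
    finally show "\<bar>x k\<bar> \<le> growth * V" using VQ by simp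
  next
    fix j k assume "-N \<le> j \<and> j \<le> k \<and> k \<le> q"
    then have "\<bar>x k - x j\<bar> \<le> (V + Q) * (h * of_int (k - j)) powr \<gamma>" using ext(1) by auto
    also have "\<dots> \<le> growth * V * (h * of_int (k - j)) powr \<gamma>" using VQ by (intro mult_right_mono) auto
    finally show "\<bar>x k - x j\<bar> \<le> growth * V * (h * of_int (k - j)) powr \<gamma>" .
  qed
qed

text \<open>A block has \<open>l = max 1 \<lfloor>\<tau> / h\<rfloor>\<close> steps and hence covers a time of at least \<open>\<tau> / 2\<close>, whatever the
  mesh.  So \<open>2 * T / \<tau>\<close> blocks reach the end, and the growth is bounded independently of \<open>h\<close>.\<close>

lemma controlled_end:
  assumes V: "controlled a 0" and \<tau>: "0 < \<tau>" "\<tau> \<le> 1"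
    and small: "A * (1 + c) * \<tau> powr \<gamma> + 2 * young_const * A * c * \<tau> powr \<mu> \<le> 1/2"
    and J: "2 * T / \<tau> \<le> real J"
  shows "controlled (growth ^ J * a) N"
proof -
  define l where "l = max 1 \<lfloor>\<tau> / h\<rfloor>"
  have l: "1 \<le> l" by (simp add: l_def)
  have l2: "l = 1 \<or> h * of_int l \<le> \<tau>"
  proof (cases "l = 1")
    case False
    then have "real_of_int l \<le> \<tau> / h" by (auto simp: l_def max_def split: if_splits)
    then show ?thesis using h by (simp add: field_simps)
  qed simp
  have l3: "\<tau> \<le> 2 * (h * of_int l)"
  proof -
    have "\<tau> / h < real_of_int \<lfloor>\<tau> / h\<rfloor> + 1" by linarith
    also have "\<dots> \<le> 2 * real_of_int l" unfolding l_def by linarith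
    finally show ?thesis using h by (simp add: field_simps)
  qed
  have step: "controlled (growth ^ i * a) (min N (int i * l))" for i
  proof (induction i)
    case 0
    then show ?case using V N by simp
  next
    case (Suc i)
    let ?p = "min N (int i * l)" and ?q = "min N (int (Suc i) * l)"
    have sl: "int (Suc i) * l = int i * l + l" by (simp add: algebra_simps)
    have P0: "0 \<le> int i * l" using l by simp
    have pq: "?p \<le> ?q" "?q - ?p \<le> l" unfolding sl using l by linarith+
    have "?q = ?p + 1 \<or> h * of_int (?q - ?p) \<le> \<tau>"
    proof (cases "?q = ?p")
      case False
      show ?thesis using l2
      proof
        assume "h * of_int l \<le> \<tau>"
        moreover have "h * of_int (?q - ?p) \<le> h * of_int l"
          using of_int_le_iff[where 'a=real, THEN iffD2, OF pq(2)] h by (intro mult_left_mono) simp_all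
        ultimately show ?thesis by linarith
      next
        assume "l = 1"
        then show ?thesis using pq False by linarith
      qed
    qed (use \<tau> in simp)
    then have "controlled (growth * (growth ^ i * a)) ?q"
      using P0 N by (intro controlled_step[OF Suc _ \<tau> small pq(1)]) simp_all
    then show ?case by (simp only: power_Suc mult.assoc)
  qed
  have "h * of_int N \<le> h * (real J * real_of_int l)"
  proof -
    have "T \<le> real J * \<tau> / 2" using J \<tau> by (simp add: field_simps)
    also have "\<dots> \<le> real J * (h * of_int l)" using l3 mult_left_mono[OF l3, of "real J"] by simp
    finally show ?thesis using h by (simp add: mult_ac)
  qed
  then have "real_of_int N \<le> real_of_int (int J * l)" using h(1) by (simp only: mult_le_cancel_left_pos of_int_mult of_int_of_nat_eq)
  then have "N \<le> int J * l" by linarith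
  then show ?thesis using step[of J] by (simp add: min_def)
qed

end

text \<open>The constant is chosen before the mesh, the number of steps, the equation and the size \<open>a\<close>, and the
  solution is bounded linearly in \<open>a\<close>.\<close>

theorem discrete_young_gronwall:
  fixes T \<gamma> \<mu> A c :: real
  assumes "0 < T" "0 < \<gamma>" "\<gamma> \<le> \<mu>" "1 < \<gamma> + \<mu>" "0 \<le> A" "0 \<le> c"
  shows "\<exists>C\<ge>0. \<forall>h N x \<beta> G w R a. discrete_young_equation h T \<gamma> \<mu> A c a N x \<beta> G w R \<longrightarrow>
       discrete_young_equation.controlled h \<gamma> a N x a 0 \<longrightarrow>
       discrete_young_equation.controlled h \<gamma> a N x (C * a) N"
proof -
  define Y where "Y = 1 / (1 - (2/3) powr (\<gamma> + \<mu> - 1))"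
  define b where "b = A * (1 + c) + 2 * Y * A * c"
  have Y: "0 < Y" unfolding Y_def using assms powr_less_mono2[of "\<gamma> + \<mu> - 1" "2/3" 1] by auto
  have b: "0 \<le> b" using Y assms by (auto simp: b_def)
  \<comment> \<open>Chosen such that \<open>b * \<tau> powr \<gamma> \<le> 1/2\<close>.\<close>
  define \<tau> where "\<tau> = (1 / (2 * (b + 1))) powr (1 / \<gamma>)"
  have \<tau>: "0 < \<tau>" "\<tau> \<le> 1" using b assms unfolding \<tau>_def by (auto intro!: powr_le1)
  have \<tau>\<gamma>: "\<tau> powr \<gamma> = 1 / (2 * (b + 1))" using b assms by (simp add: \<tau>_def powr_powr)
  have small: "A * (1 + c) * \<tau> powr \<gamma> + 2 * Y * A * c * \<tau> powr \<mu> \<le> 1/2"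
  proof -
    have "2 * Y * A * c * \<tau> powr \<mu> \<le> 2 * Y * A * c * \<tau> powr \<gamma>"
      using Y assms \<tau> by (intro mult_left_mono powr_mono') auto
    then have "A * (1 + c) * \<tau> powr \<gamma> + 2 * Y * A * c * \<tau> powr \<mu> \<le> b * \<tau> powr \<gamma>"
      by (simp add: b_def algebra_simps)
    also have "\<dots> \<le> 1/2" unfolding \<tau>\<gamma> using b by (simp add: field_simps)
    finally show ?thesis .
  qed
  define J where "J = nat \<lceil>2 * T / \<tau>\<rceil>"
  have J: "2 * T / \<tau> \<le> real J" unfolding J_def by linarith
  define g where "g = 1 + 2 * (2 * A * (1 + c) + 3 * Y * A * c + 1) * (max 1 T)^2"
  show ?thesis
  proof (intro exI[of _ "g ^ J"] conjI allI impI)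
    show "0 \<le> g ^ J" using Y assms by (auto simp: g_def)
    fix h N x \<beta> G w R a
    assume eq: "discrete_young_equation h T \<gamma> \<mu> A c a N x \<beta> G w R"
      and ctl: "discrete_young_equation.controlled h \<gamma> a N x a 0"
    interpret discrete_young_equation h T \<gamma> \<mu> A c a N x \<beta> G w R by (rule eq)
    have "young_const = Y" "growth = g"
      by (simp_all add: young_const_def Y_def growth_def g_def block_const_def)
    then show "controlled (g ^ J * a) N"
      using controlled_end[OF ctl \<tau> _ J] small by simp
  qed
qed

section \<open>Frechet derivatives on the segment space\<close>

lemma seg_space_add: "\<xi> \<in> seg_space r \<Longrightarrow> \<eta> \<in> seg_space r \<Longrightarrow> (\<lambda>s. \<xi> s + \<eta> s) \<in> seg_space r"
  and seg_space_diff: "\<xi> \<in> seg_space r \<Longrightarrow> \<eta> \<in> seg_space r \<Longrightarrow> (\<lambda>s. \<xi> s - \<eta> s) \<in> seg_space r"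
  and seg_space_cmult: "\<xi> \<in> seg_space r \<Longrightarrow> (\<lambda>s. c * \<xi> s) \<in> seg_space r"
  unfolding seg_space_def mem_Collect_eq
  by (intro continuous_on_add continuous_on_diff continuous_on_mult continuous_on_const; assumption)+

lemma seg_bdd:
  assumes "\<xi> \<in> seg_space r"
  shows "bdd_above ((\<lambda>s. \<bar>\<xi> s\<bar>) ` {-r..0})"
proof -
  have "compact ((\<lambda>s. \<bar>\<xi> s\<bar>) ` {-r..0})"
    using assms by (intro compact_continuous_image continuous_intros) (auto simp: seg_space_def)
  then show ?thesis by (intro bounded_imp_bdd_above compact_imp_bounded)
qed

lemma le_seg_norm: "\<xi> \<in> seg_space r \<Longrightarrow> s \<in> {-r..0} \<Longrightarrow> \<bar>\<xi> s\<bar> \<le> seg_norm r \<xi>"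
  unfolding seg_norm_def by (intro cSUP_upper seg_bdd)

lemma seg_norm_le: "0 \<le> r \<Longrightarrow> (\<And>s. s \<in> {-r..0} \<Longrightarrow> \<bar>\<xi> s\<bar> \<le> c) \<Longrightarrow> seg_norm r \<xi> \<le> c"
  unfolding seg_norm_def by (intro cSUP_least) auto

lemma seg_norm_nonneg: "0 \<le> r \<Longrightarrow> \<xi> \<in> seg_space r \<Longrightarrow> 0 \<le> seg_norm r \<xi>"
  using le_seg_norm[of \<xi> r 0] by auto

lemma seg_dual_cmult: "\<Lambda> \<in> seg_dual r \<Longrightarrow> \<xi> \<in> seg_space r \<Longrightarrow> \<Lambda> (\<lambda>s. c * \<xi> s) = c * \<Lambda> \<xi>"
  and seg_dual_add: "\<Lambda> \<in> seg_dual r \<Longrightarrow> \<xi> \<in> seg_space r \<Longrightarrow> \<eta> \<in> seg_space r \<Longrightarrow> \<Lambda> (\<lambda>s. \<xi> s + \<eta> s) = \<Lambda> \<xi> + \<Lambda> \<eta>"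
  by (simp_all add: seg_dual_def)

lemma seg_dual_bound:
  assumes \<Lambda>: "\<Lambda> \<in> seg_dual r" and \<xi>: "\<xi> \<in> seg_space r" and r: "0 \<le> r"
  shows "\<bar>\<Lambda> \<xi>\<bar> \<le> seg_dual_norm r \<Lambda> * seg_norm r \<xi>"
proof -
  obtain C where C': "\<forall>\<xi>\<in>seg_space r. \<bar>\<Lambda> \<xi>\<bar> \<le> C * seg_norm r \<xi>"
    using \<Lambda> unfolding seg_dual_def by blast
  then have C: "\<bar>\<Lambda> \<xi>\<bar> \<le> C * seg_norm r \<xi>" if "\<xi> \<in> seg_space r" for \<xi> using that by blast
  have n0: "0 \<le> seg_norm r \<xi>" by (rule seg_norm_nonneg[OF r \<xi>])
  show ?thesis
  proof (cases "seg_norm r \<xi> = 0")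
    case True
    then show ?thesis using C[OF \<xi>] by simp
  next
    case False
    define n where "n = seg_norm r \<xi>"
    have n: "0 < n" using n0 False by (simp add: n_def)
    define \<eta> where "\<eta> = (\<lambda>s. (1 / n) * \<xi> s)"
    have \<eta>: "\<eta> \<in> seg_space r" unfolding \<eta>_def by (rule seg_space_cmult[OF \<xi>])
    have \<eta>1: "seg_norm r \<eta> \<le> 1"
    proof (intro seg_norm_le r)
      fix s assume "s \<in> {-r..0}"
      from le_seg_norm[OF \<xi> this] show "\<bar>\<eta> s\<bar> \<le> 1"
        unfolding \<eta>_def n_def[symmetric] using n by (simp add: abs_mult)
    qed
    have "bdd_above ((\<lambda>\<xi>. \<bar>\<Lambda> \<xi>\<bar>) ` {\<xi>\<in>seg_space r. seg_norm r \<xi> \<le> 1})"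
    proof (rule bdd_aboveI2)
      fix \<zeta> assume "\<zeta> \<in> {\<xi>\<in>seg_space r. seg_norm r \<xi> \<le> 1}"
      then have \<zeta>: "\<zeta> \<in> seg_space r" "seg_norm r \<zeta> \<le> 1" by auto
      have "\<bar>\<Lambda> \<zeta>\<bar> \<le> C * seg_norm r \<zeta>" by (rule C[OF \<zeta>(1)])
      also have "\<dots> \<le> \<bar>C\<bar> * 1"
        using seg_norm_nonneg[OF r \<zeta>(1)] \<zeta> by (intro mult_mono) simp_all
      finally show "\<bar>\<Lambda> \<zeta>\<bar> \<le> \<bar>C\<bar>" by simp
    qed
    then have "\<bar>\<Lambda> \<eta>\<bar> \<le> seg_dual_norm r \<Lambda>"
      unfolding seg_dual_norm_def using \<eta> \<eta>1 by (intro cSUP_upper) auto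
    moreover have "\<Lambda> \<eta> = (1 / n) * \<Lambda> \<xi>" unfolding \<eta>_def by (rule seg_dual_cmult[OF \<Lambda> \<xi>])
    ultimately show ?thesis using n by (simp add: n_def[symmetric] abs_mult divide_le_eq)
  qed
qed

lemma seg_dual_diff:
  assumes "\<Lambda> \<in> seg_dual r" "\<Lambda>' \<in> seg_dual r"
  shows "(\<lambda>\<zeta>. \<Lambda> \<zeta> - \<Lambda>' \<zeta>) \<in> seg_dual r"
proof -
  obtain C C' where C: "\<forall>\<xi>\<in>seg_space r. \<bar>\<Lambda> \<xi>\<bar> \<le> C * seg_norm r \<xi>"
    "\<forall>\<xi>\<in>seg_space r. \<bar>\<Lambda>' \<xi>\<bar> \<le> C' * seg_norm r \<xi>"
    using assms unfolding seg_dual_def by blast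
  have b: "\<forall>\<xi>\<in>seg_space r. \<bar>\<Lambda> \<xi> - \<Lambda>' \<xi>\<bar> \<le> (C + C') * seg_norm r \<xi>"
  proof
    fix \<xi> assume "\<xi> \<in> seg_space r"
    then have "\<bar>\<Lambda> \<xi>\<bar> \<le> C * seg_norm r \<xi>" "\<bar>\<Lambda>' \<xi>\<bar> \<le> C' * seg_norm r \<xi>" using C by auto
    then show "\<bar>\<Lambda> \<xi> - \<Lambda>' \<xi>\<bar> \<le> (C + C') * seg_norm r \<xi>" unfolding distrib_right by linarith
  qed
  have add: "\<Lambda> (\<lambda>s. \<xi> s + \<eta> s) - \<Lambda>' (\<lambda>s. \<xi> s + \<eta> s) = (\<Lambda> \<xi> - \<Lambda>' \<xi>) + (\<Lambda> \<eta> - \<Lambda>' \<eta>)"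
    if "\<xi> \<in> seg_space r" "\<eta> \<in> seg_space r" for \<xi> \<eta>
    using assms that unfolding seg_dual_def by simp
  have mult: "\<Lambda> (\<lambda>s. c * \<xi> s) - \<Lambda>' (\<lambda>s. c * \<xi> s) = c * (\<Lambda> \<xi> - \<Lambda>' \<xi>)" if "\<xi> \<in> seg_space r" for c \<xi>
    using assms that unfolding seg_dual_def by (simp add: right_diff_distrib)
  show ?thesis unfolding seg_dual_def using b add mult by blast
qed

lemma has_real_derivative_along_segment:
  assumes fre: "has_frechet_derivative_seg r G \<Lambda> (\<lambda>s. \<xi> s + \<theta> * \<eta> s)" and \<eta>: "\<eta> \<in> seg_space r" and r: "0 \<le> r"
  shows "((\<lambda>\<theta>. G (\<lambda>s. \<xi> s + \<theta> * \<eta> s)) has_real_derivative \<Lambda> \<eta>) (at \<theta>)"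
  unfolding has_field_derivative_def has_derivative_at_alt
proof (intro conjI allI impI)
  show "bounded_linear ((*) (\<Lambda> \<eta>))" by (rule bounded_linear_mult_right)
  have n0: "0 \<le> seg_norm r \<eta>" by (rule seg_norm_nonneg[OF r \<eta>])
  fix e :: real assume e: "0 < e"
  define e' where "e' = e / (seg_norm r \<eta> + 1)"
  have e': "0 < e'" "e' * seg_norm r \<eta> \<le> e" using e n0 by (auto simp: e'_def field_simps)
  obtain d where d: "0 < d" "\<And>\<zeta>. \<zeta> \<in> seg_space r \<Longrightarrow> seg_norm r \<zeta> < d \<Longrightarrow>
      \<bar>G (\<lambda>s. (\<xi> s + \<theta> * \<eta> s) + \<zeta> s) - G (\<lambda>s. \<xi> s + \<theta> * \<eta> s) - \<Lambda> \<zeta>\<bar> \<le> e' * seg_norm r \<zeta>"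
    using fre e'(1) unfolding has_frechet_derivative_seg_def by blast
  show "\<exists>d>0. \<forall>y. norm (y - \<theta>) < d \<longrightarrow>
      norm (G (\<lambda>s. \<xi> s + y * \<eta> s) - G (\<lambda>s. \<xi> s + \<theta> * \<eta> s) - \<Lambda> \<eta> * (y - \<theta>)) \<le> e * norm (y - \<theta>)"
  proof (intro exI[of _ "d / (seg_norm r \<eta> + 1)"] conjI allI impI)
    show "0 < d / (seg_norm r \<eta> + 1)" using d n0 by simp
    fix y assume y: "norm (y - \<theta>) < d / (seg_norm r \<eta> + 1)"
    define \<zeta> where "\<zeta> = (\<lambda>s. (y - \<theta>) * \<eta> s)"
    have \<zeta>: "\<zeta> \<in> seg_space r" unfolding \<zeta>_def by (rule seg_space_cmult[OF \<eta>])
    have n\<zeta>: "seg_norm r \<zeta> \<le> \<bar>y - \<theta>\<bar> * seg_norm r \<eta>"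
      unfolding \<zeta>_def using le_seg_norm[OF \<eta>] by (intro seg_norm_le r) (auto simp: abs_mult intro: mult_left_mono)
    have "\<bar>y - \<theta>\<bar> * seg_norm r \<eta> \<le> \<bar>y - \<theta>\<bar> * (seg_norm r \<eta> + 1)" by (intro mult_left_mono) auto
    also have "\<dots> < d" using y n0 by (simp add: field_simps)
    finally have "seg_norm r \<zeta> < d" using n\<zeta> by linarith
    from d(2)[OF \<zeta> this]
    have "\<bar>G (\<lambda>s. (\<xi> s + \<theta> * \<eta> s) + \<zeta> s) - G (\<lambda>s. \<xi> s + \<theta> * \<eta> s) - \<Lambda> \<zeta>\<bar> \<le> e' * seg_norm r \<zeta>" .
    moreover have "(\<lambda>s. (\<xi> s + \<theta> * \<eta> s) + \<zeta> s) = (\<lambda>s. \<xi> s + y * \<eta> s)" by (simp add: \<zeta>_def algebra_simps)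
    moreover have "\<Lambda> \<zeta> = (y - \<theta>) * \<Lambda> \<eta>"
      using fre \<eta> unfolding \<zeta>_def has_frechet_derivative_seg_def seg_dual_def by blast
    moreover have "e' * seg_norm r \<zeta> \<le> e * \<bar>y - \<theta>\<bar>"
    proof -
      have "e' * seg_norm r \<zeta> \<le> e' * (\<bar>y - \<theta>\<bar> * seg_norm r \<eta>)" using e' n\<zeta> by (intro mult_left_mono) auto
      also have "\<dots> = (e' * seg_norm r \<eta>) * \<bar>y - \<theta>\<bar>" by simp
      also have "\<dots> \<le> e * \<bar>y - \<theta>\<bar>" using e' by (intro mult_right_mono) auto
      finally show ?thesis .
    qed
    ultimately show "norm (G (\<lambda>s. \<xi> s + y * \<eta> s) - G (\<lambda>s. \<xi> s + \<theta> * \<eta> s) - \<Lambda> \<eta> * (y - \<theta>)) \<le> e * norm (y - \<theta>)"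
      by (simp add: mult.commute)
  qed
qed

text \<open>The mean value theorem along both segments simultaneously: the left-hand side is \<open>F 1 - F 0\<close> for
  \<open>F \<theta> = G t (\<xi>2 + \<theta> * (\<xi>1 - \<xi>2)) - G s (\<xi>4 + \<theta> * (\<xi>3 - \<xi>4))\<close>.  Its derivative compares two
  functionals applied to two directions.  The difference \<open>\<delta>\<close> of the directions meets the bound on
  the derivative, and the difference of the functionals, small by Lipschitz continuity, meets the
  direction \<open>\<xi>3 - \<xi>4\<close>.  Bounding \<open>G t \<xi>1 - G t \<xi>2\<close> and \<open>G s \<xi>3 - G s \<xi>4\<close> separately would
  lose the smallness in \<open>t - s\<close>.\<close>

lemma frechet_four_point:
  fixes G :: "real \<Rightarrow> (real \<Rightarrow> real) \<Rightarrow> real" and M1 M2 M3 :: real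
  assumes r: "0 \<le> r"
    and fre: "\<And>t \<xi>. t \<in> S \<Longrightarrow> \<xi> \<in> seg_space r \<Longrightarrow> has_frechet_derivative_seg r (G t) (D t \<xi>) \<xi>"
    and M1: "\<And>t \<xi>. t \<in> S \<Longrightarrow> \<xi> \<in> seg_space r \<Longrightarrow> seg_dual_norm r (D t \<xi>) \<le> M1"
    and M2: "\<And>t \<xi> \<eta>. t \<in> S \<Longrightarrow> \<xi> \<in> seg_space r \<Longrightarrow> \<eta> \<in> seg_space r \<Longrightarrow>
           seg_dual_norm r (\<lambda>\<zeta>. D t \<xi> \<zeta> - D t \<eta> \<zeta>) \<le> M2 * seg_norm r (\<lambda>u. \<xi> u - \<eta> u)"
    and M3: "\<And>s t \<xi>. s \<in> S \<Longrightarrow> t \<in> S \<Longrightarrow> \<xi> \<in> seg_space r \<Longrightarrow>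
           seg_dual_norm r (\<lambda>\<zeta>. D t \<xi> \<zeta> - D s \<xi> \<zeta>) \<le> M3 * \<bar>t - s\<bar>"
    and Mpos: "0 \<le> M1" "0 \<le> M2" "0 \<le> M3"
    and ts: "t \<in> S" "s \<in> S"
    and seg: "\<xi>1 \<in> seg_space r" "\<xi>2 \<in> seg_space r" "\<xi>3 \<in> seg_space r" "\<xi>4 \<in> seg_space r"
    and \<delta>: "\<And>u. u \<in> {-r..0} \<Longrightarrow> \<bar>(\<xi>1 u - \<xi>2 u) - (\<xi>3 u - \<xi>4 u)\<bar> \<le> \<delta>"
    and \<rho>1: "\<And>u. u \<in> {-r..0} \<Longrightarrow> \<bar>\<xi>1 u - \<xi>3 u\<bar> \<le> \<rho>1"
    and \<rho>2: "\<And>u. u \<in> {-r..0} \<Longrightarrow> \<bar>\<xi>2 u - \<xi>4 u\<bar> \<le> \<rho>2"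
    and \<epsilon>: "\<And>u. u \<in> {-r..0} \<Longrightarrow> \<bar>\<xi>3 u - \<xi>4 u\<bar> \<le> \<epsilon>"
  shows "\<bar>(G t \<xi>1 - G t \<xi>2) - (G s \<xi>3 - G s \<xi>4)\<bar> \<le> M1 * \<delta> + (M2 * (\<rho>1 + \<rho>2) + M3 * \<bar>t - s\<bar>) * \<epsilon>"
proof -
  define \<eta>1 where "\<eta>1 = (\<lambda>u. \<xi>1 u - \<xi>2 u)"
  define \<eta>2 where "\<eta>2 = (\<lambda>u. \<xi>3 u - \<xi>4 u)"
  have \<eta>: "\<eta>1 \<in> seg_space r" "\<eta>2 \<in> seg_space r" unfolding \<eta>1_def \<eta>2_def using seg by (auto intro: seg_space_diff)
  define p where "p \<theta> = (\<lambda>u. \<xi>2 u + \<theta> * \<eta>1 u)" for \<theta>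
  define q where "q \<theta> = (\<lambda>u. \<xi>4 u + \<theta> * \<eta>2 u)" for \<theta>
  have pq: "p \<theta> \<in> seg_space r" "q \<theta> \<in> seg_space r" for \<theta>
    unfolding p_def q_def using seg \<eta> by (auto intro!: seg_space_add seg_space_cmult)
  define F where "F \<theta> = G t (p \<theta>) - G s (q \<theta>)" for \<theta>
  have dF: "(F has_real_derivative D t (p \<theta>) \<eta>1 - D s (q \<theta>) \<eta>2) (at \<theta>)" for \<theta>
    unfolding F_def
  proof (rule DERIV_diff)
    show "((\<lambda>\<theta>. G t (p \<theta>)) has_real_derivative D t (p \<theta>) \<eta>1) (at \<theta>)"
      using has_real_derivative_along_segment[OF fre[OF ts(1) pq(1)[of \<theta>], unfolded p_def] \<eta>(1) r]
      by (simp only: p_def)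
    show "((\<lambda>\<theta>. G s (q \<theta>)) has_real_derivative D s (q \<theta>) \<eta>2) (at \<theta>)"
      using has_real_derivative_along_segment[OF fre[OF ts(2) pq(2)[of \<theta>], unfolded q_def] \<eta>(2) r]
      by (simp only: q_def)
  qed
  define F' where "F' \<theta> = D t (p \<theta>) \<eta>1 - D s (q \<theta>) \<eta>2" for \<theta>
  have "\<exists>z>0. z < 1 \<and> F 1 - F 0 = (1 - 0) * F' z"
  proof (rule MVT2)
    show "(F has_real_derivative F' \<theta>) (at \<theta>)" for \<theta> unfolding F'_def by (rule dF)
  qed simp
  then have "\<exists>z>0. z < 1 \<and> F 1 - F 0 = D t (p z) \<eta>1 - D s (q z) \<eta>2" unfolding F'_def by simp
  then obtain z where z: "0 < z" "z < 1" and Fz: "F 1 - F 0 = D t (p z) \<eta>1 - D s (q z) \<eta>2" by auto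
  have dual: "D t \<xi> \<in> seg_dual r" if "t \<in> S" "\<xi> \<in> seg_space r" for t \<xi>
    using fre[OF that] by (simp add: has_frechet_derivative_seg_def)
  define \<zeta> where "\<zeta> = (\<lambda>u. \<eta>1 u + (-1) * \<eta>2 u)"
  have \<zeta>: "\<zeta> \<in> seg_space r" unfolding \<zeta>_def using \<eta> by (intro seg_space_add seg_space_cmult)
  have "D t (p z) \<zeta> = D t (p z) \<eta>1 + D t (p z) (\<lambda>u. (-1) * \<eta>2 u)"
    unfolding \<zeta>_def by (rule seg_dual_add[OF dual[OF ts(1) pq(1)] \<eta>(1) seg_space_cmult[OF \<eta>(2)]])
  also have "D t (p z) (\<lambda>u. (-1) * \<eta>2 u) = (-1) * D t (p z) \<eta>2"
    by (rule seg_dual_cmult[OF dual[OF ts(1) pq(1)] \<eta>(2)])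
  finally have lin: "D t (p z) \<eta>1 = D t (p z) \<zeta> + D t (p z) \<eta>2" by simp
  have n\<eta>2: "seg_norm r \<eta>2 \<le> \<epsilon>" using \<epsilon> by (intro seg_norm_le r) (auto simp: \<eta>2_def)
  have 1: "\<bar>D t (p z) \<zeta>\<bar> \<le> M1 * \<delta>"
  proof -
    have "\<bar>D t (p z) \<zeta>\<bar> \<le> seg_dual_norm r (D t (p z)) * seg_norm r \<zeta>" by (rule seg_dual_bound[OF dual[OF ts(1) pq(1)] \<zeta> r])
    also have "\<dots> \<le> M1 * seg_norm r \<zeta>" using M1[OF ts(1) pq(1)] seg_norm_nonneg[OF r \<zeta>] by (rule mult_right_mono)
    also have "seg_norm r \<zeta> \<le> \<delta>"
    proof (intro seg_norm_le r)
      fix u assume "u \<in> {-r..0}"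
      moreover have "\<zeta> u = (\<xi>1 u - \<xi>2 u) - (\<xi>3 u - \<xi>4 u)" by (simp add: \<zeta>_def \<eta>1_def \<eta>2_def)
      ultimately show "\<bar>\<zeta> u\<bar> \<le> \<delta>" using \<delta> by (simp only:)
    qed
    finally show ?thesis using Mpos by (simp add: mult_left_mono)
  qed
  have 2: "\<bar>D t (p z) \<eta>2 - D t (q z) \<eta>2\<bar> \<le> M2 * (\<rho>1 + \<rho>2) * \<epsilon>"
  proof -
    have n: "seg_norm r (\<lambda>u. p z u - q z u) \<le> \<rho>1 + \<rho>2"
    proof (intro seg_norm_le r)
      fix u assume u: "u \<in> {-r..0}"
      have "p z u - q z u = z * (\<xi>1 u - \<xi>3 u) + (1 - z) * (\<xi>2 u - \<xi>4 u)"
        by (simp add: p_def q_def \<eta>1_def \<eta>2_def algebra_simps)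
      then have "\<bar>p z u - q z u\<bar> \<le> z * \<bar>\<xi>1 u - \<xi>3 u\<bar> + (1 - z) * \<bar>\<xi>2 u - \<xi>4 u\<bar>"
        using z abs_triangle_ineq[of "z * (\<xi>1 u - \<xi>3 u)" "(1 - z) * (\<xi>2 u - \<xi>4 u)"] by (simp add: abs_mult)
      also have "\<dots> \<le> 1 * \<rho>1 + 1 * \<rho>2" using \<rho>1[OF u] \<rho>2[OF u] z by (intro add_mono mult_mono) auto
      finally show "\<bar>p z u - q z u\<bar> \<le> \<rho>1 + \<rho>2" by simp
    qed
    have "\<bar>D t (p z) \<eta>2 - D t (q z) \<eta>2\<bar> \<le> seg_dual_norm r (\<lambda>\<zeta>. D t (p z) \<zeta> - D t (q z) \<zeta>) * seg_norm r \<eta>2"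
      using seg_dual_bound[OF seg_dual_diff[OF dual[OF ts(1) pq(1)] dual[OF ts(1) pq(2)]] \<eta>(2) r] .
    also have "\<dots> \<le> (M2 * (\<rho>1 + \<rho>2)) * \<epsilon>"
    proof (rule mult_mono[OF _ n\<eta>2 _ seg_norm_nonneg[OF r \<eta>(2)]])
      show "seg_dual_norm r (\<lambda>\<zeta>. D t (p z) \<zeta> - D t (q z) \<zeta>) \<le> M2 * (\<rho>1 + \<rho>2)"
        using M2[OF ts(1) pq] mult_left_mono[OF n Mpos(2)] by (rule order_trans)
      show "0 \<le> M2 * (\<rho>1 + \<rho>2)"
        using Mpos(2) order_trans[OF seg_norm_nonneg[OF r seg_space_diff[OF pq]] n] by (rule mult_nonneg_nonneg)
    qed
    finally show ?thesis .
  qed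
  have 3: "\<bar>D t (q z) \<eta>2 - D s (q z) \<eta>2\<bar> \<le> M3 * \<bar>t - s\<bar> * \<epsilon>"
  proof -
    have "\<bar>D t (q z) \<eta>2 - D s (q z) \<eta>2\<bar> \<le> seg_dual_norm r (\<lambda>\<zeta>. D t (q z) \<zeta> - D s (q z) \<zeta>) * seg_norm r \<eta>2"
      using seg_dual_bound[OF seg_dual_diff[OF dual[OF ts(1) pq(2)] dual[OF ts(2) pq(2)]] \<eta>(2) r] .
    also have "\<dots> \<le> (M3 * \<bar>t - s\<bar>) * \<epsilon>"
      using Mpos by (intro mult_mono[OF M3[OF ts(2,1) pq(2)] n\<eta>2 _ seg_norm_nonneg[OF r \<eta>(2)]]) simp
    finally show ?thesis .
  qed
  have "p 1 = \<xi>1" "p 0 = \<xi>2" "q 1 = \<xi>3" "q 0 = \<xi>4" by (simp_all add: p_def q_def \<eta>1_def \<eta>2_def)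
  then have "(G t \<xi>1 - G t \<xi>2) - (G s \<xi>3 - G s \<xi>4) = F 1 - F 0" by (simp add: F_def)
  also have "\<dots> = D t (p z) \<zeta> + (D t (p z) \<eta>2 - D t (q z) \<eta>2) + (D t (q z) \<eta>2 - D s (q z) \<eta>2)"
    unfolding Fz lin by simp
  finally show ?thesis using 1 2 3 by (simp add: distrib_right)
qed

section \<open>Quadrature and interpolation on the grid\<close>

lemma powr_le_scale:
  fixes d B p q :: real
  assumes "0 \<le> d" "d \<le> B" "q \<le> p"
  shows "d powr p \<le> B powr (p - q) * d powr q"
proof -
  have "d powr p = d powr (p - q) * d powr q" by (simp flip: powr_add)
  also have "\<dots> \<le> B powr (p - q) * d powr q" using assms by (intro mult_right_mono powr_mono2) auto
  finally show ?thesis .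
qed

lemma integral_minus_rect:
  fixes f :: "real \<Rightarrow> real"
  assumes "a \<le> b" "continuous_on {a..b} f" "\<And>s. s \<in> {a..b} \<Longrightarrow> \<bar>f s - c\<bar> \<le> d"
  shows "\<bar>integral {a..b} f - (b - a) * c\<bar> \<le> d * (b - a)"
proof -
  have i: "f integrable_on {a..b}" using assms by (intro integrable_continuous_interval)
  have "integral {a..b} (\<lambda>s. f s - c) = integral {a..b} f - (b - a) * c"
    using assms by (subst Henstock_Kurzweil_Integration.integral_diff[OF i]) auto
  moreover have "norm (integral {a..b} (\<lambda>s. f s - c)) \<le> d * (b - a)"
    using assms by (intro integral_bound continuous_intros) auto
  ultimately show ?thesis by simp
qed

lemma riemann_sum_error:
  fixes f :: "real \<Rightarrow> real"
  assumes "0 < h" and "continuous_on {- (real N * h)..0} f"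
    and "\<And>i s. i \<in> {- int N..-1} \<Longrightarrow> s \<in> {of_int i * h..of_int (i + 1) * h} \<Longrightarrow> \<bar>f s - f (of_int i * h)\<bar> \<le> d"
  shows "\<bar>integral {- (real N * h)..0} f - (\<Sum>i\<in>{- int N..-1}. h * f (of_int i * h))\<bar> \<le> d * (real N * h)"
  using assms(2,3)
proof (induction N)
  case (Suc N)
  let ?a = "- (real (Suc N) * h)" and ?b = "- (real N * h)"
  have ab: "?a \<le> ?b" "?b \<le> 0" "?b - ?a = h" using \<open>0 < h\<close> by (auto simp: algebra_simps)
  have cont: "continuous_on {?a..0} f" by (rule Suc.prems(1))
  have "integral {?a..0} f = integral {?a..?b} f + integral {?b..0} f"
    using ab cont by (intro Henstock_Kurzweil_Integration.integral_combine[symmetric] integrable_continuous_interval) auto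
  moreover have "{- int (Suc N)..-1} = insert (- int (Suc N)) {- int N..-1}" by auto
  then have "(\<Sum>i\<in>{- int (Suc N)..-1}. h * f (of_int i * h)) = h * f ?a + (\<Sum>i\<in>{- int N..-1}. h * f (of_int i * h))"
    by (simp add: algebra_simps)
  moreover have "\<bar>integral {?a..?b} f - (?b - ?a) * f ?a\<bar> \<le> d * (?b - ?a)"
  proof (rule integral_minus_rect)
    show "continuous_on {?a..?b} f" using cont by (rule continuous_on_subset) (use ab in auto)
    fix s assume "s \<in> {?a..?b}"
    then show "\<bar>f s - f ?a\<bar> \<le> d" using Suc.prems(2)[of "- int (Suc N)" s] by (simp add: algebra_simps)
  qed (use ab in simp)
  moreover have "\<bar>integral {?b..0} f - (\<Sum>i\<in>{- int N..-1}. h * f (of_int i * h))\<bar> \<le> d * (real N * h)"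
  proof (rule Suc.IH)
    show "continuous_on {?b..0} f" using cont by (rule continuous_on_subset) (use ab in auto)
  qed (use Suc.prems(2) in auto)
  ultimately have "\<bar>integral {?a..0} f - (\<Sum>i\<in>{- int (Suc N)..-1}. h * f (of_int i * h))\<bar> \<le> d * h + d * (real N * h)"
    unfolding ab(3) by linarith
  then show ?case by (simp add: algebra_simps)
qed simp

text \<open>The piecewise linear function with value \<open>v k\<close> at \<open>k * h\<close>, written as a sum of hat functions: in
  this form it is evidently continuous and linear in \<open>v\<close>.  Interpolating segments of a path at
  different nodes amounts to shifting the index of \<open>v\<close>, so that differences of such segments are
  bounded by differences of grid values.\<close>

definition hat_interpolation :: "nat \<Rightarrow> real \<Rightarrow> (int \<Rightarrow> real) \<Rightarrow> real \<Rightarrow> real" where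
  "hat_interpolation N h v s = (\<Sum>k\<in>{- int N..0}. v k * max 0 (1 - \<bar>s / h - of_int k\<bar>))"

lemma hat_interpolation_continuous: "hat_interpolation N h v \<in> seg_space r"
proof -
  have "continuous_on {-r..0} (\<lambda>s. s / h)" unfolding divide_inverse by (intro continuous_intros)
  then show ?thesis unfolding hat_interpolation_def seg_space_def mem_Collect_eq
    by (intro continuous_on_sum continuous_on_mult continuous_on_const continuous_on_max continuous_on_diff continuous_on_rabs)
qed

lemma hat_interpolation_between:
  assumes "0 < h" "j \<in> {- int N..-1}" "s \<in> {of_int j * h..of_int (j + 1) * h}"
  shows "\<exists>\<theta>. 0 \<le> \<theta> \<and> \<theta> \<le> 1 \<and> (\<forall>v. hat_interpolation N h v s = (1 - \<theta>) * v j + \<theta> * v (j + 1)) \<and>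
    (s = of_int j * h \<longrightarrow> \<theta> = 0) \<and> (s = of_int (j + 1) * h \<longrightarrow> \<theta> = 1)"
proof -
  define \<theta> where "\<theta> = s / h - of_int j"
  have th: "0 \<le> \<theta>" "\<theta> \<le> 1" using assms by (auto simp: \<theta>_def field_simps)
  have "hat_interpolation N h v s = (1 - \<theta>) * v j + \<theta> * v (j + 1)" for v
  proof -
    have sub: "{j, j + 1} \<subseteq> {- int N..0}" using assms by auto
    have zero: "max 0 (1 - \<bar>s / h - of_int k\<bar>) = 0" if "k \<notin> {j, j + 1}" for k
    proof -
      have "k \<le> j - 1 \<or> j + 2 \<le> k" using that by auto
      then have "real_of_int k \<le> of_int j - 1 \<or> of_int j + 2 \<le> real_of_int k" by linarith
      then have "1 - \<bar>s / h - of_int k\<bar> \<le> 0" using th unfolding \<theta>_def by linarith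
      then show ?thesis by simp
    qed
    have "hat_interpolation N h v s = (\<Sum>k\<in>{j, j + 1}. v k * max 0 (1 - \<bar>s / h - of_int k\<bar>))"
      unfolding hat_interpolation_def by (rule sum.mono_neutral_right) (use sub zero in auto)
    also have "\<dots> = v j * (1 - \<theta>) + v (j + 1) * \<theta>"
    proof -
      have m: "max 0 (1 - \<bar>s / h - of_int j\<bar>) = 1 - \<theta>" "max 0 (1 - \<bar>s / h - of_int (j + 1)\<bar>) = \<theta>"
        using th by (simp_all add: \<theta>_def abs_if max_def)
      have "(\<Sum>k\<in>{j, j + 1}. v k * max 0 (1 - \<bar>s / h - of_int k\<bar>))
          = v j * max 0 (1 - \<bar>s / h - of_int j\<bar>) + v (j + 1) * max 0 (1 - \<bar>s / h - of_int (j + 1)\<bar>)" by simp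
      then show ?thesis unfolding m .
    qed
    finally show ?thesis by (simp add: mult.commute)
  qed
  moreover have "s = of_int j * h \<longrightarrow> \<theta> = 0" "s = of_int (j + 1) * h \<longrightarrow> \<theta> = 1"
    using \<open>0 < h\<close> by (auto simp: \<theta>_def)
  ultimately show ?thesis using th by blast
qed

lemma grid_cover:
  assumes "0 < h" "0 < (N::nat)" "s \<in> {- (real N * h)..0}"
  obtains j where "j \<in> {- int N..-1}" "s \<in> {of_int j * h..of_int (j + 1) * h}"
proof (cases "s = 0")
  case True
  then show thesis using that[of "-1"] assms by auto
next
  case False
  define j where "j = \<lfloor>s / h\<rfloor>"
  have j: "of_int j \<le> s / h" "s / h < of_int j + 1" by (auto simp: j_def)
  have "- real N \<le> s / h" using assms by (simp add: field_simps)
  then have "real_of_int (- int N) < of_int (j + 1)" using j by simp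
  then have 1: "- int N \<le> j" by linarith
  have "s / h < 0" using assms False by (simp add: divide_neg_pos)
  then have "real_of_int j < 0" using j by linarith
  then have 2: "j \<le> -1" by linarith
  show thesis using that[of j] 1 2 j assms by (auto simp: field_simps)
qed

lemma hat_interpolation_grid:
  assumes "0 < h" "0 < N" "k \<in> {- int N..0}"
  shows "hat_interpolation N h v (of_int k * h) = v k"
proof (cases "k = 0")
  case True
  obtain \<theta> where "\<forall>v. hat_interpolation N h v (of_int k * h) = (1 - \<theta>) * v (-1) + \<theta> * v (-1 + 1)"
     "of_int k * h = of_int (-1 + 1) * h \<longrightarrow> \<theta> = 1"
    using hat_interpolation_between[of h "-1" N "of_int k * h"] assms True by auto
  then show ?thesis using True by simp
next
  case False
  obtain \<theta> where "\<forall>v. hat_interpolation N h v (of_int k * h) = (1 - \<theta>) * v k + \<theta> * v (k + 1)"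
     "of_int k * h = of_int k * h \<longrightarrow> \<theta> = 0"
    using hat_interpolation_between[of h k N "of_int k * h"] assms False by auto
  then show ?thesis by simp
qed

lemma hat_interpolation_bound:
  assumes "0 < h" "0 < N" "s \<in> {- (real N * h)..0}" and v: "\<And>k. k \<in> {- int N..0} \<Longrightarrow> \<bar>v k\<bar> \<le> S"
  shows "\<bar>hat_interpolation N h v s\<bar> \<le> S"
proof -
  obtain j where j: "j \<in> {- int N..-1}" "s \<in> {of_int j * h..of_int (j + 1) * h}"
    using grid_cover[OF assms(1-3)] .
  obtain \<theta> where \<theta>: "0 \<le> \<theta>" "\<theta> \<le> 1" "\<forall>v. hat_interpolation N h v s = (1 - \<theta>) * v j + \<theta> * v (j + 1)"
    using hat_interpolation_between[OF assms(1) j] by blast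
  have "\<bar>hat_interpolation N h v s\<bar> \<le> (1 - \<theta>) * \<bar>v j\<bar> + \<theta> * \<bar>v (j + 1)\<bar>"
    unfolding \<theta>(3)[rule_format] using \<theta> abs_triangle_ineq[of "(1 - \<theta>) * v j" "\<theta> * v (j + 1)"] by (simp add: abs_mult)
  also have "\<dots> \<le> (1 - \<theta>) * S + \<theta> * S" using \<theta> v[of j] v[of "j + 1"] j by (intro add_mono mult_left_mono) auto
  finally show ?thesis by (simp add: algebra_simps)
qed

lemma hat_interpolation_diff:
  "hat_interpolation N h (\<lambda>k. v k - v' k) s = hat_interpolation N h v s - hat_interpolation N h v' s"
  unfolding hat_interpolation_def by (simp add: left_diff_distrib sum_subtractf)

lemma hat_interpolation_step:
  assumes "0 < h" "0 < N" "j \<in> {- int N..-1}" "s \<in> {of_int j * h..of_int (j + 1) * h}" and "\<bar>v (j + 1) - v j\<bar> \<le> \<delta>"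
  shows "\<bar>hat_interpolation N h v s - hat_interpolation N h v (of_int j * h)\<bar> \<le> \<delta>"
proof -
  obtain \<theta> where \<theta>: "0 \<le> \<theta>" "\<theta> \<le> 1" "\<forall>v. hat_interpolation N h v s = (1 - \<theta>) * v j + \<theta> * v (j + 1)"
    using hat_interpolation_between[OF assms(1,3,4)] by blast
  have "hat_interpolation N h v s - hat_interpolation N h v (of_int j * h) = \<theta> * (v (j + 1) - v j)"
    using hat_interpolation_grid[OF assms(1,2), of j v] assms(3) unfolding \<theta>(3)[rule_format] by (simp add: algebra_simps)
  also have "\<bar>\<dots>\<bar> \<le> 1 * \<delta>" unfolding abs_mult using \<theta> assms(5) by (intro mult_mono) auto
  finally show ?thesis by simp
qed

section \<open>The coefficients and the delay integral\<close>

locale delay_coefficients =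
  fixes T :: real and b \<sigma> K :: "real \<Rightarrow> real \<Rightarrow> real \<Rightarrow> real" and L1 L2 L3 K1 K2 K3 :: real
  assumes T: "0 < T"
    and L_pos: "0 < L1" "0 < L2" "0 < L3" and K_pos: "0 < K1" "0 < K2" "0 < K3"
    and K_cont: "continuous_on ({0..T} \<times> {-T..0} \<times> UNIV) (\<lambda>(t, s, x). K t s x)"
    and coeff_time: "\<And>s t x y. s \<in> {0..T} \<Longrightarrow> t \<in> {0..T} \<Longrightarrow>
           \<bar>b t x y - b s x y\<bar> + \<bar>\<sigma> t x y - \<sigma> s x y\<bar> \<le> L1 * \<bar>t - s\<bar>"
    and coeff_space: "\<And>t x1 y1 x2 y2. t \<in> {0..T} \<Longrightarrow>
           \<bar>b t x1 y1 - b t x2 y2\<bar> + \<bar>\<sigma> t x1 y1 - \<sigma> t x2 y2\<bar> \<le> L2 * (\<bar>x1 - x2\<bar> + \<bar>y1 - y2\<bar>)"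
    and coeff_growth: "\<And>t x y. t \<in> {0..T} \<Longrightarrow> \<bar>b t x y\<bar> + \<bar>\<sigma> t x y\<bar> \<le> L3 * (1 + \<bar>x\<bar> + \<bar>y\<bar>)"
    and K_time: "\<And>t u s v x. t \<in> {0..T} \<Longrightarrow> u \<in> {0..T} \<Longrightarrow> s \<in> {-T..0} \<Longrightarrow> v \<in> {-T..0} \<Longrightarrow>
           \<bar>K t s x - K u v x\<bar> \<le> K1 * (\<bar>t - u\<bar> + \<bar>s - v\<bar>)"
    and K_space: "\<And>t s x y. t \<in> {0..T} \<Longrightarrow> s \<in> {-T..0} \<Longrightarrow> \<bar>K t s x - K t s y\<bar> \<le> K2 * \<bar>x - y\<bar>"
    and K_growth: "\<And>t s x. t \<in> {0..T} \<Longrightarrow> s \<in> {-T..0} \<Longrightarrow> \<bar>K t s x\<bar> \<le> K3 * (1 + \<bar>x\<bar>)"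
begin

lemma \<sigma>_lipschitz:
  assumes "t \<in> {0..T}" "u \<in> {0..T}"
  shows "\<bar>\<sigma> t x y - \<sigma> u x' y'\<bar> \<le> L1 * \<bar>t - u\<bar> + L2 * (\<bar>x - x'\<bar> + \<bar>y - y'\<bar>)"
  using coeff_time[OF assms(2,1), of x y] coeff_space[OF assms(2), of x y x' y'] by linarith

lemma b_lipschitz:
  assumes "t \<in> {0..T}" "u \<in> {0..T}"
  shows "\<bar>b t x y - b u x' y'\<bar> \<le> L1 * \<bar>t - u\<bar> + L2 * (\<bar>x - x'\<bar> + \<bar>y - y'\<bar>)"
  using coeff_time[OF assms(2,1), of x y] coeff_space[OF assms(2), of x y x' y'] by linarith

lemma K_lipschitz:
  assumes "t \<in> {0..T}" "u \<in> {0..T}" "s \<in> {-T..0}" "v \<in> {-T..0}"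
  shows "\<bar>K t s x - K u v y\<bar> \<le> K1 * (\<bar>t - u\<bar> + \<bar>s - v\<bar>) + K2 * \<bar>x - y\<bar>"
  using K_time[OF assms, of x] K_space[OF assms(2,4), of x y] by linarith

definition seg_delay :: "real \<Rightarrow> (real \<Rightarrow> real) \<Rightarrow> real" where
  "seg_delay t \<xi> = (LBINT s:{-T..0}. K t s (\<xi> s))"

lemma K_seg_continuous:
  assumes "t \<in> {0..T}" "\<xi> \<in> seg_space T"
  shows "continuous_on {-T..0} (\<lambda>s. K t s (\<xi> s))"
proof -
  have 1: "continuous_on {-T..0} (\<lambda>s. (t, s, \<xi> s))"
    using assms by (intro continuous_on_Pair continuous_on_const continuous_on_id) (simp add: seg_space_def)
  have 2: "(\<lambda>s. (t, s, \<xi> s)) ` {-T..0} \<subseteq> {0..T} \<times> {-T..0} \<times> UNIV" using assms by auto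
  from continuous_on_compose2[OF K_cont 1 2] show ?thesis by simp
qed

lemma seg_delay_integral:
  assumes "t \<in> {0..T}" "\<xi> \<in> seg_space T"
  shows "seg_delay t \<xi> = integral {-T..0} (\<lambda>s. K t s (\<xi> s))"
    and "set_integrable lborel {-T..0} (\<lambda>s. K t s (\<xi> s))"
proof -
  show i: "set_integrable lborel {-T..0} (\<lambda>s. K t s (\<xi> s))"
    by (rule borel_integrable_atLeastAtMost'[OF K_seg_continuous[OF assms]])
  show "seg_delay t \<xi> = integral {-T..0} (\<lambda>s. K t s (\<xi> s))"
    unfolding seg_delay_def by (rule set_borel_integral_eq_integral(2)[OF i])
qed

lemma seg_delay_lipschitz:
  assumes tu: "t \<in> {0..T}" "u \<in> {0..T}" and seg: "\<xi> \<in> seg_space T" "\<eta> \<in> seg_space T"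
    and d: "\<And>s. s \<in> {-T..0} \<Longrightarrow> \<bar>\<xi> s - \<eta> s\<bar> \<le> \<delta>"
  shows "\<bar>seg_delay t \<xi> - seg_delay u \<eta>\<bar> \<le> T * (K1 * \<bar>t - u\<bar> + K2 * \<delta>)"
proof -
  note c = K_seg_continuous[OF tu(1) seg(1)] K_seg_continuous[OF tu(2) seg(2)]
  have "seg_delay t \<xi> - seg_delay u \<eta> = integral {-T..0} (\<lambda>s. K t s (\<xi> s) - K u s (\<eta> s))"
    unfolding seg_delay_integral(1)[OF tu(1) seg(1)] seg_delay_integral(1)[OF tu(2) seg(2)]
    using c by (intro Henstock_Kurzweil_Integration.integral_diff[symmetric] integrable_continuous_interval)
  moreover have "norm (integral {-T..0} (\<lambda>s. K t s (\<xi> s) - K u s (\<eta> s))) \<le> (K1 * \<bar>t - u\<bar> + K2 * \<delta>) * (0 - - T)"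
  proof (rule integral_bound)
    fix s assume s: "s \<in> {-T..0}"
    have "K2 * \<bar>\<xi> s - \<eta> s\<bar> \<le> K2 * \<delta>" using d[OF s] K_pos by (intro mult_left_mono) auto
    then show "norm (K t s (\<xi> s) - K u s (\<eta> s)) \<le> K1 * \<bar>t - u\<bar> + K2 * \<delta>"
      using K_lipschitz[OF tu s s, of "\<xi> s" "\<eta> s"] by simp
  qed (use T c in \<open>auto intro: continuous_on_diff\<close>)
  ultimately show ?thesis by (simp add: mult.commute)
qed

text \<open>Left-endpoint rule, with \<open>\<delta>\<close> the oscillation of the segment on a cell.\<close>

lemma seg_delay_quadrature:
  assumes N: "0 < N" and h: "h = T / real N" and t: "t \<in> {0..T}" and \<xi>: "\<xi> \<in> seg_space T"
    and d: "\<And>i s. i \<in> {- int N..-1} \<Longrightarrow> s \<in> {of_int i * h..of_int (i + 1) * h} \<Longrightarrow> \<bar>\<xi> s - \<xi> (of_int i * h)\<bar> \<le> \<delta>"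
  shows "\<bar>seg_delay t \<xi> - (\<Sum>i\<in>{- int N..-1}. h * K t (of_int i * h) (\<xi> (of_int i * h)))\<bar> \<le> T * (K1 * h + K2 * \<delta>)"
proof -
  have h0: "0 < h" and Nh: "real N * h = T" using N T by (auto simp: h)
  have "\<bar>integral {- (real N * h)..0} (\<lambda>s. K t s (\<xi> s)) - (\<Sum>i\<in>{- int N..-1}. h * K t (of_int i * h) (\<xi> (of_int i * h)))\<bar> \<le> (K1 * h + K2 * \<delta>) * (real N * h)"
  proof (rule riemann_sum_error[OF h0])
    show "continuous_on {- (real N * h)..0} (\<lambda>s. K t s (\<xi> s))" unfolding Nh by (rule K_seg_continuous[OF t \<xi>])
    fix i s assume i: "i \<in> {- int N..-1}" and s: "s \<in> {of_int i * h..of_int (i + 1) * h}"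
    have "real_of_int (- int N) \<le> of_int i" "real_of_int (i + 1) \<le> 0" using i by (simp_all only: atLeastAtMost_iff of_int_le_iff of_int_le_0_iff) simp_all
    then have "real_of_int (- int N) * h \<le> of_int i * h" "of_int (i + 1) * h \<le> 0"
      using h0 by (intro mult_right_mono mult_nonpos_nonneg; simp)+
    moreover have "real_of_int (- int N) * h = - T" using Nh by simp
    ultimately have mem: "s \<in> {-T..0}" "of_int i * h \<in> {-T..0}" using s h0 by (auto simp: algebra_simps)
    have "\<bar>s - of_int i * h\<bar> \<le> h" using s by (auto simp: algebra_simps)
    then have "K1 * \<bar>s - of_int i * h\<bar> \<le> K1 * h" using K_pos by (intro mult_left_mono) auto
    moreover have "K2 * \<bar>\<xi> s - \<xi> (of_int i * h)\<bar> \<le> K2 * \<delta>" using d[OF i s] K_pos by (intro mult_left_mono) auto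
    ultimately show "\<bar>K t s (\<xi> s) - K t (of_int i * h) (\<xi> (of_int i * h))\<bar> \<le> K1 * h + K2 * \<delta>"
      using K_lipschitz[OF t t mem, of "\<xi> s" "\<xi> (of_int i * h)"] by simp
  qed
  then show ?thesis unfolding Nh seg_delay_integral(1)[OF t \<xi>] by (simp add: mult.commute)
qed

end

section \<open>Regularity of the solution\<close>

lemma hoelder_boundI:
  assumes "\<And>s t. s \<in> S \<Longrightarrow> t \<in> S \<Longrightarrow> s < t \<Longrightarrow> \<bar>f t - f s\<bar> \<le> L * (t - s) powr \<nu>"
  shows "hoelder_bound S L \<nu> f"
  unfolding hoelder_bound_def
proof (intro ballI)
  fix s t assume st: "s \<in> S" "t \<in> S"
  consider "s < t" | "t < s" | "s = t" by linarith
  then show "\<bar>f t - f s\<bar> \<le> L * \<bar>t - s\<bar> powr \<nu>"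
  proof cases
    case 1 then show ?thesis using assms[OF st] by simp
  next
    case 2 then show ?thesis using assms[OF st(2,1)] by (simp add: abs_minus_commute)
  qed simp
qed

lemma hoelder_bound_continuous_on:
  assumes "hoelder_bound {a..b} L \<nu> f" "0 < \<nu>" "0 \<le> L" "a \<le> b"
  shows "continuous_on {a..b} f"
proof -
  have "continuous_on {a..b} (\<lambda>x. f (max a (min b x)))"
    using hoelder_const_continuous[OF hoelder_const_clamp[OF assms(1,4,3)]] assms(2)
    by (auto intro: continuous_on_subset)
  then show ?thesis by (rule continuous_on_eq) auto
qed

lemma hoelder_bound_join:
  assumes f: "hoelder_bound {a..b} L \<nu> f" and g: "hoelder_bound {b..c} L' \<nu> f" and "0 \<le> L" "0 \<le> L'" "0 \<le> \<nu>"
  shows "hoelder_bound {a..c} (L + L') \<nu> f"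
proof (rule hoelder_boundI)
  fix s t assume st: "s \<in> {a..c}" "t \<in> {a..c}" "s < t"
  have up: "L * u powr \<nu> \<le> (L + L') * u powr \<nu>" "L' * u powr \<nu> \<le> (L + L') * u powr \<nu>" for u
    using assms by (auto intro: mult_right_mono)
  consider "t \<le> b" | "b \<le> s" | "s \<le> b" "b \<le> t" by linarith
  then show "\<bar>f t - f s\<bar> \<le> (L + L') * (t - s) powr \<nu>"
  proof cases
    case 1
    then have "\<bar>f t - f s\<bar> \<le> L * (t - s) powr \<nu>" using hoelder_boundD[OF f, of s t] st by simp
    then show ?thesis using up(1) by (rule order_trans)
  next
    case 2
    then have "\<bar>f t - f s\<bar> \<le> L' * (t - s) powr \<nu>" using hoelder_boundD[OF g, of s t] st by simp
    then show ?thesis using up(2) by (rule order_trans)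
  next
    case 3
    have "\<bar>f t - f s\<bar> \<le> \<bar>f t - f b\<bar> + \<bar>f b - f s\<bar>" by linarith
    also have "\<dots> \<le> L' * (t - b) powr \<nu> + L * (b - s) powr \<nu>"
      using hoelder_boundD[OF g, of b t] hoelder_boundD[OF f, of s b] 3 st by simp
    also have "\<dots> \<le> L' * (t - s) powr \<nu> + L * (t - s) powr \<nu>"
      using 3 assms by (intro add_mono mult_left_mono powr_mono2) auto
    finally show ?thesis by (simp add: algebra_simps)
  qed
qed

text \<open>One path \<open>x\<close> of the solution, driven by one path \<open>w\<close> of the noise; everything below is deterministic.\<close>

locale delay_path = delay_coefficients +
  fixes H :: real and \<phi> x w :: "real \<Rightarrow> real"
  assumes H: "1/2 < H" "H < 1"
    and x_initial: "\<And>t. t \<in> {-T..0} \<Longrightarrow> x t = \<phi> t"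
    and \<phi>_hoelder: "\<And>\<mu>. 0 < \<mu> \<Longrightarrow> \<mu> < H \<Longrightarrow> \<exists>L\<ge>0. hoelder_bound {-T..0} L \<mu> \<phi>"
    and x_hoelder_some: "\<exists>\<nu>>1 - H. \<exists>L\<ge>0. hoelder_bound {-T..T} L \<nu> x"
    and w_hoelder: "\<And>\<mu>. 0 < \<mu> \<Longrightarrow> \<mu> < H \<Longrightarrow> \<exists>L\<ge>0. hoelder_bound {0..T} L \<mu> w"
    and equation: "\<And>t. t \<in> {0..T} \<Longrightarrow> \<exists>I.
           has_gls_integral (\<lambda>s. \<sigma> s (x s) (delay_term T K x s)) w 0 t I \<and>
           x t = x 0 + (LBINT s:{0..t}. b s (x s) (delay_term T K x s)) + I"
begin

definition drift :: "real \<Rightarrow> real" where "drift s = b s (x s) (delay_term T K x s)"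
definition diffusion :: "real \<Rightarrow> real" where "diffusion s = \<sigma> s (x s) (delay_term T K x s)"

lemma delay_term_eq: "delay_term T K x t = seg_delay t (\<lambda>s. x (t + s))"
  by (simp add: delay_term_def seg_delay_def)

lemma x_segment:
  assumes x: "hoelder_bound {-T..T} L \<nu> x" "0 < \<nu>" "0 \<le> L" and t: "t \<in> {0..T}"
  shows "(\<lambda>s. x (t + s)) \<in> seg_space T"
proof -
  have "continuous_on {-T..T} x" using hoelder_bound_continuous_on[OF x] T by auto
  then show ?thesis unfolding seg_space_def mem_Collect_eq
    by (rule continuous_on_compose2) (use t in \<open>auto intro: continuous_intros\<close>)
qed

lemma delay_term_hoelder:
  assumes x: "hoelder_bound {-T..T} L \<nu> x" "0 < \<nu>" "0 \<le> L" "\<nu> \<le> 1" and tu: "t \<in> {0..T}" "u \<in> {0..T}"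
  shows "\<bar>delay_term T K x t - delay_term T K x u\<bar> \<le> (T * (K1 * T powr (1 - \<nu>) + K2 * L)) * \<bar>t - u\<bar> powr \<nu>"
proof -
  have "\<bar>delay_term T K x t - delay_term T K x u\<bar> \<le> T * (K1 * \<bar>t - u\<bar> + K2 * (L * \<bar>t - u\<bar> powr \<nu>))"
    unfolding delay_term_eq
  proof (rule seg_delay_lipschitz[OF tu x_segment[OF x(1-3) tu(1)] x_segment[OF x(1-3) tu(2)]])
    fix s assume "s \<in> {-T..0}"
    then show "\<bar>x (t + s) - x (u + s)\<bar> \<le> L * \<bar>t - u\<bar> powr \<nu>"
      using hoelder_boundD[OF x(1), of "u + s" "t + s"] tu by auto
  qed
  also have "\<dots> \<le> T * (K1 * (T powr (1 - \<nu>) * \<bar>t - u\<bar> powr \<nu>) + K2 * (L * \<bar>t - u\<bar> powr \<nu>))"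
  proof -
    have "\<bar>t - u\<bar> \<le> T powr (1 - \<nu>) * \<bar>t - u\<bar> powr \<nu>"
      using powr_le_scale[of "\<bar>t - u\<bar>" T \<nu> 1] tu x by auto
    then have "K1 * \<bar>t - u\<bar> \<le> K1 * (T powr (1 - \<nu>) * \<bar>t - u\<bar> powr \<nu>)" using K_pos by (intro mult_left_mono) auto
    from mult_left_mono[OF add_right_mono[OF this], of T "K2 * (L * \<bar>t - u\<bar> powr \<nu>)"]
    show ?thesis using T by simp
  qed
  finally show ?thesis by (simp add: algebra_simps)
qed

lemma coefficients_hoelder:
  assumes x: "hoelder_bound {-T..T} L \<nu> x" "0 < \<nu>" "0 \<le> L" "\<nu> \<le> 1"
  obtains L' where "0 \<le> L'" "hoelder_bound {0..T} L' \<nu> drift" "hoelder_bound {0..T} L' \<nu> diffusion"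
proof -
  define Y where "Y = T * (K1 * T powr (1 - \<nu>) + K2 * L)"
  define L' where "L' = L1 * T powr (1 - \<nu>) + L2 * (L + Y)"
  have "L1 * \<bar>t - u\<bar> + L2 * (\<bar>x t - x u\<bar> + \<bar>delay_term T K x t - delay_term T K x u\<bar>) \<le> L' * \<bar>t - u\<bar> powr \<nu>"
    if tu: "t \<in> {0..T}" "u \<in> {0..T}" for t u
  proof -
    have "\<bar>t - u\<bar> \<le> T powr (1 - \<nu>) * \<bar>t - u\<bar> powr \<nu>"
      using powr_le_scale[of "\<bar>t - u\<bar>" T \<nu> 1] tu x by auto
    moreover have "\<bar>x t - x u\<bar> \<le> L * \<bar>t - u\<bar> powr \<nu>" using hoelder_boundD[OF x(1), of u t] tu T by auto
    moreover have "\<bar>delay_term T K x t - delay_term T K x u\<bar> \<le> Y * \<bar>t - u\<bar> powr \<nu>"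
      unfolding Y_def by (rule delay_term_hoelder[OF x tu])
    ultimately have "L1 * \<bar>t - u\<bar> + L2 * (\<bar>x t - x u\<bar> + \<bar>delay_term T K x t - delay_term T K x u\<bar>)
       \<le> L1 * (T powr (1 - \<nu>) * \<bar>t - u\<bar> powr \<nu>) + L2 * (L * \<bar>t - u\<bar> powr \<nu> + Y * \<bar>t - u\<bar> powr \<nu>)"
      using L_pos by (intro add_mono mult_left_mono) auto
    then show ?thesis by (simp add: L'_def algebra_simps)
  qed
  note le = this
  show thesis
  proof
    show "0 \<le> L'" using L_pos K_pos T x by (simp add: L'_def Y_def)
    show "hoelder_bound {0..T} L' \<nu> drift"
      unfolding hoelder_bound_def drift_def using le b_lipschitz by (meson order_trans)
    show "hoelder_bound {0..T} L' \<nu> diffusion"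
      unfolding hoelder_bound_def diffusion_def using le \<sigma>_lipschitz by (meson order_trans)
  qed
qed

text \<open>Local expansion of the solution, with a remainder of order above \<open>1\<close>: the drift integral contributes
  \<open>\<nu> + 1\<close>, the stochastic integral \<open>\<nu> + \<mu>\<close> by the Young estimate.\<close>

lemma expansion:
  assumes x: "hoelder_bound {-T..T} L \<nu> x" "0 < \<nu>" "0 \<le> L" "\<nu> \<le> 1"
    and \<mu>: "0 < \<mu>" "\<mu> < H" "1 < \<nu> + \<mu>"
  obtains C where "0 \<le> C" "\<And>s t. 0 \<le> s \<Longrightarrow> s \<le> t \<Longrightarrow> t \<le> T \<Longrightarrow>
    \<bar>x t - x s - (drift s * (t - s) + diffusion s * (w t - w s))\<bar> \<le> C * (t - s) powr (\<nu> + \<mu>)"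
proof -
  obtain L' where L': "0 \<le> L'" "hoelder_bound {0..T} L' \<nu> drift" "hoelder_bound {0..T} L' \<nu> diffusion"
    using coefficients_hoelder[OF x] .
  obtain W where W: "0 \<le> W" "hoelder_bound {0..T} W \<mu> w" using w_hoelder[OF \<mu>(1,2)] by auto
  obtain I where I: "\<And>t. t \<in> {0..T} \<Longrightarrow> has_gls_integral diffusion w 0 t (I t)"
    "\<And>t. t \<in> {0..T} \<Longrightarrow> x t = x 0 + (LBINT s:{0..t}. drift s) + I t"
    using equation unfolding diffusion_def[abs_def, symmetric] drift_def[abs_def, symmetric] by metis
  obtain C where C: "0 \<le> C" "\<And>s t. 0 \<le> s \<Longrightarrow> s \<le> t \<Longrightarrow> t \<le> T \<Longrightarrow>
     \<bar>I t - I s - diffusion s * (w t - w s)\<bar> \<le> C * (t - s) powr (\<nu> + \<mu>)"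
    using gls_integral_young_estimate[OF L'(3) W(2) x(2) \<mu>(1,3) L'(1) W(1) I(1)] by blast
  have cont: "continuous_on {0..T} drift" using hoelder_bound_continuous_on[OF L'(2) x(2) L'(1)] T by auto
  have cont': "continuous_on {s..t} drift" if "0 \<le> s" "t \<le> T" for s t
    using cont by (rule continuous_on_subset) (use that in auto)
  have D: "\<bar>(LBINT u:{0..t}. drift u) - (LBINT u:{0..s}. drift u) - drift s * (t - s)\<bar> \<le> L' * T powr (1 - \<mu>) * (t - s) powr (\<nu> + \<mu>)"
    if st: "0 \<le> s" "s \<le> t" "t \<le> T" for s t
  proof -
    have e: "(LBINT u:{0..v}. drift u) = integral {0..v} drift" if "0 \<le> v" "v \<le> T" for v
      by (rule set_borel_integral_eq_integral(2)[OF borel_integrable_atLeastAtMost'[OF cont']]) (use that in auto)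
    have "integral {0..t} drift = integral {0..s} drift + integral {s..t} drift"
      using st by (intro Henstock_Kurzweil_Integration.integral_combine[symmetric] integrable_continuous_interval cont') auto
    moreover have "\<bar>integral {s..t} drift - (t - s) * drift s\<bar> \<le> (L' * (t - s) powr \<nu>) * (t - s)"
    proof (rule integral_minus_rect[OF st(2) cont'[OF st(1,3)]])
      fix u assume u: "u \<in> {s..t}"
      have "\<bar>drift u - drift s\<bar> \<le> L' * \<bar>u - s\<bar> powr \<nu>" using hoelder_boundD[OF L'(2), of s u] u st by auto
      also have "\<dots> \<le> L' * (t - s) powr \<nu>" using u L' x by (intro mult_left_mono powr_mono2) auto
      finally show "\<bar>drift u - drift s\<bar> \<le> L' * (t - s) powr \<nu>" .
    qed
    moreover have "(L' * (t - s) powr \<nu>) * (t - s) \<le> L' * T powr (1 - \<mu>) * (t - s) powr (\<nu> + \<mu>)"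
    proof -
      have "(t - s) powr 1 \<le> T powr (1 - \<mu>) * (t - s) powr \<mu>" using st \<mu> H by (intro powr_le_scale) auto
      then have "(L' * (t - s) powr \<nu>) * (t - s) \<le> (L' * (t - s) powr \<nu>) * (T powr (1 - \<mu>) * (t - s) powr \<mu>)"
        using st L' by (intro mult_left_mono) auto
      then show ?thesis by (simp add: powr_add mult_ac)
    qed
    ultimately show ?thesis using e st by (simp add: mult.commute)
  qed
  show thesis
  proof
    show "0 \<le> C + L' * T powr (1 - \<mu>)" using C L' by simp
    fix s t assume st: "0 \<le> s" "s \<le> t" "t \<le> T"
    have "x t - x s - (drift s * (t - s) + diffusion s * (w t - w s)) = ((LBINT u:{0..t}. drift u) - (LBINT u:{0..s}. drift u) - drift s * (t - s)) + (I t - I s - diffusion s * (w t - w s))"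
      using I(2)[of t] I(2)[of s] st by simp
    then show "\<bar>x t - x s - (drift s * (t - s) + diffusion s * (w t - w s))\<bar> \<le> (C + L' * T powr (1 - \<mu>)) * (t - s) powr (\<nu> + \<mu>)"
      using D[OF st] C(2)[OF st] by (simp add: distrib_right)
  qed
qed

lemma hoelder_bound_bounded:
  assumes "hoelder_bound {0..T} L \<nu> f" "0 \<le> L" "0 \<le> \<nu>" "s \<in> {0..T}"
  shows "\<bar>f s\<bar> \<le> \<bar>f 0\<bar> + L * T powr \<nu>"
proof -
  have "\<bar>f s - f 0\<bar> \<le> L * \<bar>s - 0\<bar> powr \<nu>" using assms T by (intro hoelder_boundD[OF assms(1)]) auto
  also have "\<dots> \<le> L * T powr \<nu>" using assms by (intro mult_left_mono powr_mono2) auto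
  finally show ?thesis by linarith
qed

text \<open>Bootstrap: the equation comes with some order \<open>\<nu> > 1 - H\<close> only.  Together with an order \<open>\<mu>1\<close> of the
  driver close to \<open>H\<close> this suffices for the expansion, whose leading term has the order of the driver.\<close>

lemma x_hoelder:
  assumes \<mu>: "0 < \<mu>" "\<mu> < H"
  shows "\<exists>L\<ge>0. hoelder_bound {-T..T} L \<mu> x"
proof -
  obtain \<nu>0 L0 where \<nu>0: "1 - H < \<nu>0" "0 \<le> L0" "hoelder_bound {-T..T} L0 \<nu>0 x"
    using x_hoelder_some by auto
  define \<nu> where "\<nu> = min \<nu>0 1"
  have \<nu>: "1 - H < \<nu>" "\<nu> \<le> 1" "0 < \<nu>" using \<nu>0 H by (auto simp: \<nu>_def)
  define L where "L = L0 * (2 * T) powr (\<nu>0 - \<nu>)"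
  have L: "0 \<le> L" "hoelder_bound {-T..T} L \<nu> x"
    unfolding L_def using \<nu>0 by (auto intro!: hoelder_bound_mono[OF \<nu>0(3)] simp: \<nu>_def)
  obtain \<mu>1 where \<mu>1: "max \<mu> (1 - \<nu>) < \<mu>1" "\<mu>1 < H" using dense[of "max \<mu> (1 - \<nu>)" H] \<mu> \<nu> by auto
  have \<mu>1': "0 < \<mu>1" "1 < \<nu> + \<mu>1" "\<mu> \<le> \<mu>1" using \<mu>1 \<mu> by auto
  obtain L' where L': "0 \<le> L'" "hoelder_bound {0..T} L' \<nu> drift" "hoelder_bound {0..T} L' \<nu> diffusion"
    using coefficients_hoelder[OF L(2) \<nu>(3) L(1) \<nu>(2)] .
  obtain W where W: "0 \<le> W" "hoelder_bound {0..T} W \<mu>1 w" using w_hoelder[OF \<mu>1'(1) \<mu>1(2)] by auto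
  obtain C where C: "0 \<le> C" "\<And>s t. 0 \<le> s \<Longrightarrow> s \<le> t \<Longrightarrow> t \<le> T \<Longrightarrow>
    \<bar>x t - x s - (drift s * (t - s) + diffusion s * (w t - w s))\<bar> \<le> C * (t - s) powr (\<nu> + \<mu>1)"
    using expansion[OF L(2) \<nu>(3) L(1) \<nu>(2) \<mu>1'(1) \<mu>1(2) \<mu>1'(2)] by blast
  define Bd where "Bd = \<bar>drift 0\<bar> + L' * T powr \<nu>"
  define Bf where "Bf = \<bar>diffusion 0\<bar> + L' * T powr \<nu>"
  have B0: "0 \<le> Bd" "0 \<le> Bf" using L' by (auto simp: Bd_def Bf_def)
  define La where "La = Bd * T powr (1 - \<mu>) + Bf * (W * T powr (\<mu>1 - \<mu>)) + C * T powr (\<nu> + \<mu>1 - \<mu>)"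
  have La0: "0 \<le> La" using B0 W C by (simp add: La_def)
  have "hoelder_bound {0..T} La \<mu> x"
  proof (rule hoelder_boundI)
    fix s t assume st: "s \<in> {0..T}" "t \<in> {0..T}" "s < t"
    have d: "0 \<le> t - s" "t - s \<le> T" using st by auto
    have s1: "t - s \<le> T powr (1 - \<mu>) * (t - s) powr \<mu>" using powr_le_scale[OF d, of \<mu> 1] \<mu> H d by simp
    have s2: "(t - s) powr \<mu>1 \<le> T powr (\<mu>1 - \<mu>) * (t - s) powr \<mu>" using d \<mu>1' by (intro powr_le_scale) auto
    have s3: "(t - s) powr (\<nu> + \<mu>1) \<le> T powr (\<nu> + \<mu>1 - \<mu>) * (t - s) powr \<mu>" using d \<mu>1' \<nu> by (intro powr_le_scale) auto
    have "\<bar>drift s * (t - s)\<bar> \<le> Bd * (T powr (1 - \<mu>) * (t - s) powr \<mu>)"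
      unfolding abs_mult using hoelder_bound_bounded[OF L'(2,1) _ st(1)] \<nu> s1 d B0 by (intro mult_mono) (auto simp: Bd_def)
    moreover have "\<bar>diffusion s * (w t - w s)\<bar> \<le> Bf * (W * (T powr (\<mu>1 - \<mu>) * (t - s) powr \<mu>))"
      unfolding abs_mult
    proof (rule mult_mono)
      have "\<bar>w t - w s\<bar> \<le> W * (t - s) powr \<mu>1" using hoelder_boundD[OF W(2) st(1,2)] st by simp
      also have "\<dots> \<le> W * (T powr (\<mu>1 - \<mu>) * (t - s) powr \<mu>)" using s2 W by (intro mult_left_mono) auto
      finally show "\<bar>w t - w s\<bar> \<le> W * (T powr (\<mu>1 - \<mu>) * (t - s) powr \<mu>)" .
    qed (use hoelder_bound_bounded[OF L'(3,1) _ st(1)] \<nu> B0 in \<open>auto simp: Bf_def\<close>)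
    moreover have "C * (t - s) powr (\<nu> + \<mu>1) \<le> C * (T powr (\<nu> + \<mu>1 - \<mu>) * (t - s) powr \<mu>)"
      using s3 C by (intro mult_left_mono) auto
    moreover have "\<bar>x t - x s - (drift s * (t - s) + diffusion s * (w t - w s))\<bar> \<le> C * (t - s) powr (\<nu> + \<mu>1)"
      using C(2)[of s t] st by auto
    ultimately have "\<bar>x t - x s\<bar> \<le> Bd * (T powr (1 - \<mu>) * (t - s) powr \<mu>) + Bf * (W * (T powr (\<mu>1 - \<mu>) * (t - s) powr \<mu>)) + C * (T powr (\<nu> + \<mu>1 - \<mu>) * (t - s) powr \<mu>)"
      by linarith
    then show "\<bar>x t - x s\<bar> \<le> La * (t - s) powr \<mu>" by (simp add: La_def algebra_simps)
  qed
  moreover obtain Lb where Lb: "0 \<le> Lb" "hoelder_bound {-T..0} Lb \<mu> \<phi>" using \<phi>_hoelder[OF \<mu>] by auto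
  then have "hoelder_bound {-T..0} Lb \<mu> x" using x_initial by (auto simp: hoelder_bound_def)
  ultimately have "hoelder_bound {-T..T} (Lb + La) \<mu> x"
    using Lb La0 \<mu> by (intro hoelder_bound_join) auto
  then show ?thesis using Lb La0 by (intro exI[of _ "Lb + La"]) auto
qed

end

section \<open>Uniform bounds for the Euler scheme\<close>

context delay_coefficients
begin

abbreviation mesh :: "nat \<Rightarrow> real" where "mesh N \<equiv> T / real N"
abbreviation node :: "nat \<Rightarrow> int \<Rightarrow> real" where "node N n \<equiv> of_int n * (T / real N)"

lemma grid_mem:
  assumes "0 < N" "0 \<le> n" "n \<le> int N"
  shows "node N n \<in> {0..T}"
proof -
  have "node N n \<le> node N (int N)"
    using assms T by (intro mult_right_mono) auto
  moreover have "0 \<le> node N n" using assms T by (intro mult_nonneg_nonneg) auto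
  ultimately show ?thesis using assms(1) by auto
qed

lemma lag_mem:
  assumes "0 < N" "i \<in> {- int N..0}"
  shows "node N i \<in> {-T..0}"
  using grid_mem[OF assms(1), of "- i"] assms(2) by auto

lemma euler_delay_lipschitz:
  assumes N: "0 < N" and tu: "t \<in> {0..T}" "u \<in> {0..T}"
    and d: "\<And>i. i \<in> {- int N..-1} \<Longrightarrow> \<bar>x (t + node N i) - y (u + node N i)\<bar> \<le> D"
  shows "\<bar>euler_delay (mesh N) N K x t - euler_delay (mesh N) N K y u\<bar> \<le> T * (K1 * \<bar>t - u\<bar> + K2 * D)"
proof -
  let ?h = "mesh N"
  have h: "0 < ?h" using T N by simp
  have "\<bar>euler_delay ?h N K x t - euler_delay ?h N K y u\<bar>
    \<le> (\<Sum>i\<in>{- int N..-1}. \<bar>?h * K t (of_int i * ?h) (x (t + of_int i * ?h)) - ?h * K u (of_int i * ?h) (y (u + of_int i * ?h))\<bar>)"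
    unfolding euler_delay_def sum_subtractf[symmetric] by (rule sum_abs)
  also have "\<dots> \<le> (\<Sum>i\<in>{- int N..-1}. ?h * (K1 * \<bar>t - u\<bar> + K2 * D))"
  proof (rule sum_mono)
    fix i assume i: "i \<in> {- int N..-1}"
    have mem: "of_int i * ?h \<in> {-T..0}" using i N by (intro lag_mem) auto
    have "K2 * \<bar>x (t + of_int i * ?h) - y (u + of_int i * ?h)\<bar> \<le> K2 * D" using d[OF i] K_pos by (intro mult_left_mono) auto
    then have "\<bar>K t (of_int i * ?h) (x (t + of_int i * ?h)) - K u (of_int i * ?h) (y (u + of_int i * ?h))\<bar> \<le> K1 * \<bar>t - u\<bar> + K2 * D"
      using K_lipschitz[OF tu mem mem, of "x (t + of_int i * ?h)" "y (u + of_int i * ?h)"] by simp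
    from mult_left_mono[OF this less_imp_le[OF h]]
    show "\<bar>?h * K t (of_int i * ?h) (x (t + of_int i * ?h)) - ?h * K u (of_int i * ?h) (y (u + of_int i * ?h))\<bar> \<le> ?h * (K1 * \<bar>t - u\<bar> + K2 * D)"
      unfolding right_diff_distrib[symmetric] abs_mult abs_of_pos[OF h] .
  qed
  also have "\<dots> = T * (K1 * \<bar>t - u\<bar> + K2 * D)" using N by simp
  finally show ?thesis .
qed

lemma euler_delay_growth:
  assumes N: "0 < N" and t: "t \<in> {0..T}"
    and S: "\<And>i. i \<in> {- int N..-1} \<Longrightarrow> \<bar>x (t + node N i)\<bar> \<le> S"
  shows "\<bar>euler_delay (mesh N) N K x t\<bar> \<le> T * (K3 * (1 + S))"
proof -
  let ?h = "mesh N"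
  have h: "0 < ?h" using T N by simp
  have "\<bar>euler_delay ?h N K x t\<bar> \<le> (\<Sum>i\<in>{- int N..-1}. \<bar>?h * K t (of_int i * ?h) (x (t + of_int i * ?h))\<bar>)"
    unfolding euler_delay_def by (rule sum_abs)
  also have "\<dots> \<le> (\<Sum>i\<in>{- int N..-1}. ?h * (K3 * (1 + S)))"
  proof (rule sum_mono)
    fix i assume i: "i \<in> {- int N..-1}"
    have mem: "of_int i * ?h \<in> {-T..0}" using i N by (intro lag_mem) auto
    have "\<bar>K t (of_int i * ?h) (x (t + of_int i * ?h))\<bar> \<le> K3 * (1 + \<bar>x (t + of_int i * ?h)\<bar>)" by (rule K_growth[OF t mem])
    also have "\<dots> \<le> K3 * (1 + S)" using S[OF i] K_pos by (intro mult_left_mono) auto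
    finally have "\<bar>K t (of_int i * ?h) (x (t + of_int i * ?h))\<bar> \<le> K3 * (1 + S)" .
    from mult_left_mono[OF this less_imp_le[OF h]]
    show "\<bar>?h * K t (of_int i * ?h) (x (t + of_int i * ?h))\<bar> \<le> ?h * (K3 * (1 + S))"
      unfolding abs_mult abs_of_pos[OF h] .
  qed
  also have "\<dots> = T * (K3 * (1 + S))" using N by simp
  finally show ?thesis .
qed

text \<open>The Riemann sum of the scheme, read as the delay integral of an interpolated segment.  In this way
  hypotheses on functionals of continuous segments apply to grid values.\<close>

lemma interpolated_delay:
  assumes N: "0 < N" and t: "t \<in> {0..T}" and v: "\<And>k. k \<in> {- int N..-1} \<Longrightarrow> \<bar>v (k + 1) - v k\<bar> \<le> \<delta>"
  shows "\<bar>seg_delay t (hat_interpolation N (mesh N) v) - (\<Sum>i\<in>{- int N..-1}. mesh N * K t (node N i) (v i))\<bar>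
    \<le> T * (K1 * mesh N + K2 * \<delta>)"
proof -
  let ?h = "mesh N" and ?P = "hat_interpolation N (mesh N) v"
  have h: "0 < ?h" using T N by simp
  have "\<bar>seg_delay t ?P - (\<Sum>i\<in>{- int N..-1}. ?h * K t (of_int i * ?h) (?P (of_int i * ?h)))\<bar> \<le> T * (K1 * ?h + K2 * \<delta>)"
    using hat_interpolation_step[OF h N] v
    by (intro seg_delay_quadrature N refl t hat_interpolation_continuous) blast
  moreover have "(\<Sum>i\<in>{- int N..-1}. ?h * K t (of_int i * ?h) (?P (of_int i * ?h))) = (\<Sum>i\<in>{- int N..-1}. ?h * K t (of_int i * ?h) (v i))"
  proof (rule sum.cong[OF refl])
    fix i assume "i \<in> {- int N..-1}"
    then have "?P (of_int i * ?h) = v i" by (intro hat_interpolation_grid[OF h N]) auto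
    then show "?h * K t (of_int i * ?h) (?P (of_int i * ?h)) = ?h * K t (of_int i * ?h) (v i)" by (simp only:)
  qed
  ultimately show ?thesis by (simp only:)
qed

end

context delay_path
begin

definition euler :: "nat \<Rightarrow> real \<Rightarrow> real" where
  "euler N = euler_scheme b \<sigma> K \<phi> T N w"

definition euler_drift :: "nat \<Rightarrow> int \<Rightarrow> real" where
  "euler_drift N n = (let t = node N n in b t (euler N t) (euler_delay (mesh N) N K (euler N) t))"

definition euler_diffusion :: "nat \<Rightarrow> int \<Rightarrow> real" where
  "euler_diffusion N n = (let t = node N n in \<sigma> t (euler N t) (euler_delay (mesh N) N K (euler N) t))"

lemma euler_initial: "t \<le> 0 \<Longrightarrow> euler N t = \<phi> t"
  unfolding euler_def using T by (rule euler_scheme_initial)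

lemma euler_step:
  assumes "0 \<le> n" "n < int N" "t \<in> {node N n..node N (n + 1)}"
  shows "euler N t = euler N (node N n) + euler_drift N n * (t - node N n)
    + euler_diffusion N n * (w t - w (node N n))"
proof -
  have n: "of_int n = real (nat n)" "of_int (n + 1) = real (Suc (nat n))" using assms(1) by auto
  show ?thesis
    unfolding euler_drift_def euler_diffusion_def Let_def euler_def n
  proof (rule euler_scheme_recursion[OF T])
    show "nat n < N" using assms by linarith
    show "t \<in> {real (nat n) * mesh N..real (Suc (nat n)) * mesh N}" using assms(3) unfolding n .
  qed
qed

text \<open>The scheme solves a discrete Young equation without defect; \<open>a\<close> collects the initial
  segment and, being at least \<open>1\<close>, the constant in the linear growth condition.\<close>

lemma euler_uniform_hoelder:
  assumes \<mu>: "1/2 < \<mu>" "\<mu> < H"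
  obtains C where "0 \<le> C"
    "\<And>N k. 0 < N \<Longrightarrow> - int N \<le> k \<Longrightarrow> k \<le> int N \<Longrightarrow> \<bar>euler N (node N k)\<bar> \<le> C"
    "\<And>N j k. 0 < N \<Longrightarrow> - int N \<le> j \<Longrightarrow> j \<le> k \<Longrightarrow> k \<le> int N \<Longrightarrow>
       \<bar>euler N (node N k) - euler N (node N j)\<bar> \<le> C * (mesh N * of_int (k - j)) powr \<mu>"
proof -
  have \<mu>0: "0 < \<mu>" "\<mu> \<le> 1" using \<mu> H by auto
  obtain Lp where Lp: "0 \<le> Lp" "hoelder_bound {-T..0} Lp \<mu> \<phi>" using \<phi>_hoelder[OF \<mu>0(1) \<mu>(2)] by auto
  obtain W where W: "0 \<le> W" "hoelder_bound {0..T} W \<mu> w" using w_hoelder[OF \<mu>0(1) \<mu>(2)] by auto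
  define a where "a = 1 + \<bar>\<phi> 0\<bar> + Lp * T powr \<mu> + Lp"
  have a: "1 \<le> a" "Lp \<le> a" "\<bar>\<phi> 0\<bar> + Lp * T powr \<mu> \<le> a" using Lp by (auto simp: a_def)
  define A1 where "A1 = L3 * (1 + T * K3)"
  define A2 where "A2 = (L1 + L2 * T * K1) * T powr (1 - \<mu>)"
  define A3 where "A3 = L2 * (1 + T * K2)"
  define A where "A = A1 + A2 + A3"
  have A: "0 \<le> A1" "0 \<le> A2" "0 \<le> A3" using L_pos K_pos T by (auto simp: A1_def A2_def A3_def)
  have A0: "0 \<le> A" using A by (simp add: A_def)
  have \<mu>2: "1 < \<mu> + \<mu>" using \<mu> by simp
  obtain C where C: "0 \<le> C"
    "\<forall>h N x \<beta> G w R a. discrete_young_equation h T \<mu> \<mu> A W a N x \<beta> G w R \<longrightarrow>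
       discrete_young_equation.controlled h \<mu> a N x a 0 \<longrightarrow>
       discrete_young_equation.controlled h \<mu> a N x (C * a) N"
    using discrete_young_gronwall[OF T \<mu>0(1) order_refl \<mu>2 A0 W(1)] by (elim exE conjE)
  have main: "discrete_young_equation.controlled (mesh N) \<mu> a (int N) (\<lambda>k. euler N (node N k)) (C * a) (int N)
      \<and> discrete_young_equation (mesh N) T \<mu> \<mu> A W a (int N) (\<lambda>k. euler N (node N k)) (euler_drift N) (euler_diffusion N) (\<lambda>k. w (node N k)) (\<lambda>_. 0)"
    if N: "0 < N" for N
  proof -
    define h where "h = mesh N"
    have h: "0 < h" "h * of_int (int N) = T" using N T by (auto simp: h_def)
    define z where "z k = euler N (of_int k * h)" for k :: int
    have shift: "of_int n * h + of_int i * h = of_int (n + i) * h" for n i :: int by (simp add: algebra_simps)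
    have dist: "\<bar>of_int m * h - of_int n * h\<bar> = h * of_int (m - n)" if "n \<le> m" for n m :: int
    proof -
      have "of_int m * h - of_int n * h = h * of_int (m - n)" by (simp add: algebra_simps)
      moreover have "0 \<le> h * of_int (m - n)" using that h by (intro mult_nonneg_nonneg) auto
      ultimately show ?thesis by simp
    qed
    have dT: "h * of_int (m - n) \<le> T" if "0 \<le> n" "m \<le> int N" for n m :: int
    proof -
      have "h * of_int (m - n) \<le> h * of_int (int N)" using that h by (intro mult_left_mono) auto
      also have "h * of_int (int N) = T" by (rule h(2))
      finally show ?thesis .
    qed
    have size: "\<bar>euler_drift N n\<bar> + \<bar>euler_diffusion N n\<bar> \<le> A * (a + S)"
      if n: "0 \<le> n" "n < int N" and S: "\<And>k. - int N \<le> k \<Longrightarrow> k \<le> n \<Longrightarrow> \<bar>z k\<bar> \<le> S" for n S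
    proof -
      have t: "of_int n * h \<in> {0..T}" unfolding h_def by (rule grid_mem[OF N n(1) less_imp_le[OF n(2)]])
      have Sn: "\<bar>z n\<bar> \<le> S" using n by (intro S) simp_all
      have S0: "0 \<le> S" using Sn by linarith
      have Y: "\<bar>euler_delay h N K (euler N) (of_int n * h)\<bar> \<le> T * (K3 * (1 + S))"
        unfolding h_def
      proof (rule euler_delay_growth[OF N t[unfolded h_def]])
        fix i assume "i \<in> {- int N..-1}"
        then show "\<bar>euler N (node N n + node N i)\<bar> \<le> S"
          using S[of "n + i"] n unfolding z_def shift[unfolded h_def] h_def by auto
      qed
      have "\<bar>euler_drift N n\<bar> + \<bar>euler_diffusion N n\<bar> \<le> L3 * (1 + \<bar>z n\<bar> + \<bar>euler_delay h N K (euler N) (of_int n * h)\<bar>)"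
        unfolding euler_drift_def euler_diffusion_def Let_def z_def h_def[symmetric] by (rule coeff_growth[OF t])
      also have "\<dots> \<le> L3 * (1 + S + T * (K3 * (1 + S)))" using Sn Y L_pos by (intro mult_left_mono) auto
      also have "\<dots> = A1 * (1 + S)" by (simp add: A1_def algebra_simps)
      also have "\<dots> \<le> A * (a + S)" using A a S0 by (intro mult_mono) (auto simp: A_def)
      finally show ?thesis .
    qed
    have eq: "discrete_young_equation h T \<mu> \<mu> A W a (int N) z (euler_drift N) (euler_diffusion N) (\<lambda>k. w (of_int k * h)) (\<lambda>_. 0)"
    proof
      fix n :: int assume n: "0 \<le> n" "n < int N"
      have "of_int n * h \<le> of_int (n + 1) * h" using h by (intro mult_right_mono) auto
      then have "of_int (n + 1) * h \<in> {of_int n * h..of_int (n + 1) * h}" by simp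
      from euler_step[OF n, folded h_def, OF this]
      have "z (n + 1) = z n + euler_drift N n * (of_int (n + 1) * h - of_int n * h) + euler_diffusion N n * (w (of_int (n + 1) * h) - w (of_int n * h))"
        unfolding z_def .
      moreover have "of_int (n + 1) * h - of_int n * h = h" by (simp add: algebra_simps)
      ultimately show "z (n + 1) = z n + euler_drift N n * h + euler_diffusion N n * (w (of_int (n + 1) * h) - w (of_int n * h)) + 0"
        by simp
    next
      fix j k :: int assume jk: "0 \<le> j" "j \<le> k" "k \<le> int N"
      have "\<bar>w (of_int k * h) - w (of_int j * h)\<bar> \<le> W * \<bar>of_int k * h - of_int j * h\<bar> powr \<mu>"
        unfolding h_def
        by (rule hoelder_boundD[OF W(2) grid_mem[OF N jk(1) order_trans[OF jk(2,3)]] grid_mem[OF N order_trans[OF jk(1,2)] jk(3)]])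
      then show "\<bar>w (of_int k * h) - w (of_int j * h)\<bar> \<le> W * (h * of_int (k - j)) powr \<mu>"
        unfolding dist[OF jk(2)] .
    next
      fix n S assume n: "0 \<le> n" "n < int N" and S: "\<And>k. - int N \<le> k \<Longrightarrow> k \<le> n \<Longrightarrow> \<bar>z k\<bar> \<le> S"
      show "\<bar>euler_drift N n\<bar> \<le> A * (a + S)" "\<bar>euler_diffusion N n\<bar> \<le> A * (a + S)"
        using size[OF n S] by linarith+
    next
      fix n m S D assume nm: "0 \<le> n" "n \<le> m" "m < int N" and S: "\<And>k. - int N \<le> k \<Longrightarrow> k \<le> m \<Longrightarrow> \<bar>z k\<bar> \<le> S"
        and D: "\<And>k. - int N \<le> k \<Longrightarrow> k \<le> n \<Longrightarrow> \<bar>z (k + (m - n)) - z k\<bar> \<le> D"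
      define d where "d = h * of_int (m - n)"
      have d: "0 \<le> d" "d \<le> T" unfolding d_def using dT[of n m] nm h by (auto intro!: mult_nonneg_nonneg)
      have nm': "0 \<le> m" "m \<le> int N" "n \<le> int N" using nm by simp_all
      have t: "of_int m * h \<in> {0..T}" "of_int n * h \<in> {0..T}"
        unfolding h_def by (rule grid_mem[OF N nm'(1,2)], rule grid_mem[OF N nm(1) nm'(3)])
      have Dn: "\<bar>z m - z n\<bar> \<le> D" using D[of n] nm by auto
      have D0: "0 \<le> D" using Dn by linarith
      have "\<bar>z n\<bar> \<le> S" using S[of n] nm by auto
      then have S0: "0 \<le> S" by linarith
      have Y: "\<bar>euler_delay h N K (euler N) (of_int m * h) - euler_delay h N K (euler N) (of_int n * h)\<bar> \<le> T * (K1 * d + K2 * D)"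
        unfolding d_def dist[OF nm(2), symmetric] unfolding h_def
      proof (rule euler_delay_lipschitz[OF N t[unfolded h_def]])
        fix i assume i: "i \<in> {- int N..-1}"
        show "\<bar>euler N (node N m + node N i) - euler N (node N n + node N i)\<bar> \<le> D"
          unfolding shift[unfolded h_def] using D[of "n + i"] nm i unfolding z_def h_def by (simp add: algebra_simps)
      qed
      have "\<bar>euler_diffusion N m - euler_diffusion N n\<bar> \<le> L1 * d + L2 * (\<bar>z m - z n\<bar> + \<bar>euler_delay h N K (euler N) (of_int m * h) - euler_delay h N K (euler N) (of_int n * h)\<bar>)"
        using \<sigma>_lipschitz[OF t] unfolding euler_diffusion_def Let_def z_def h_def[symmetric] d_def dist[OF nm(2), symmetric] .
      also have "\<dots> \<le> L1 * d + L2 * (D + T * (K1 * d + K2 * D))"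
        using Dn Y L_pos by (intro add_left_mono mult_left_mono add_mono) auto
      also have "\<dots> = (L1 + L2 * T * K1) * d + A3 * D" by (simp add: A3_def algebra_simps)
      also have "\<dots> \<le> (L1 + L2 * T * K1) * (T powr (1 - \<mu>) * d powr \<mu>) + A3 * D"
        using powr_le_scale[OF d, of \<mu> 1] \<mu>0 d L_pos K_pos T by (intro add_right_mono mult_left_mono) auto
      also have "\<dots> = A2 * (1 * d powr \<mu>) + A3 * D" by (simp add: A2_def)
      also have "\<dots> \<le> A * ((a + S) * d powr \<mu>) + A * D"
        using A a S0 D0 by (intro add_mono mult_mono mult_right_mono) (auto simp: A_def)
      finally show "\<bar>euler_diffusion N m - euler_diffusion N n\<bar> \<le> A * ((a + S) * (h * of_int (m - n)) powr \<mu> + D)"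
        by (simp add: d_def algebra_simps)
    qed (use h \<mu> \<mu>0 A W a in \<open>auto simp: A_def\<close>)
    have "discrete_young_equation.controlled h \<mu> a (int N) z a 0"
      unfolding discrete_young_equation.controlled_def[OF eq]
    proof (intro conjI allI impI)
      have zphi: "z k = \<phi> (of_int k * h)" if "k \<le> 0" for k
        unfolding z_def using that h by (intro euler_initial mult_nonpos_nonneg) auto
      have mem: "of_int k * h \<in> {-T..0}" if "- int N \<le> k" "k \<le> 0" for k
        unfolding h_def using that by (intro lag_mem[OF N]) simp
      fix k assume k: "- int N \<le> k \<and> k \<le> 0"
      have "\<bar>\<phi> (of_int k * h) - \<phi> 0\<bar> \<le> Lp * \<bar>of_int k * h - 0\<bar> powr \<mu>"
        using k T by (intro hoelder_boundD[OF Lp(2)] mem) auto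
      also have "\<dots> \<le> Lp * T powr \<mu>" using mem[of k] k \<mu>0 Lp by (intro mult_left_mono powr_mono2) auto
      finally show "\<bar>z k\<bar> \<le> a" using zphi[of k] k a by linarith
    next
      fix j k assume jk: "- int N \<le> j \<and> j \<le> k \<and> k \<le> 0"
      have zphi: "z k = \<phi> (of_int k * h)" if "k \<le> 0" for k
        unfolding z_def using that h by (intro euler_initial mult_nonpos_nonneg) auto
      have "\<bar>\<phi> (of_int k * h) - \<phi> (of_int j * h)\<bar> \<le> Lp * \<bar>of_int k * h - of_int j * h\<bar> powr \<mu>"
        unfolding h_def using jk by (intro hoelder_boundD[OF Lp(2)] lag_mem[OF N]) simp_all
      also have "\<dots> \<le> a * \<bar>of_int k * h - of_int j * h\<bar> powr \<mu>" using a by (intro mult_right_mono) auto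
      finally show "\<bar>z k - z j\<bar> \<le> a * (h * of_int (k - j)) powr \<mu>"
        using zphi[of k] zphi[of j] jk dist[of j k] by simp
    qed simp
    from C(2)[rule_format, OF eq this] eq show ?thesis unfolding z_def h_def by blast
  qed
  show thesis
  proof
    show "0 \<le> C * a" using C a by simp
    fix N :: nat and k :: int assume N: "0 < N" and k: "- int N \<le> k" "k \<le> int N"
    show "\<bar>euler N (node N k)\<bar> \<le> C * a"
      using main[OF N] k discrete_young_equation.controlled_def by blast
  next
    fix N :: nat and j k :: int assume N: "0 < N" and jk: "- int N \<le> j" "j \<le> k" "k \<le> int N"
    show "\<bar>euler N (node N k) - euler N (node N j)\<bar> \<le> C * a * (mesh N * of_int (k - j)) powr \<mu>"
      using main[OF N] jk discrete_young_equation.controlled_def by blast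
  qed
qed

end

section \<open>The error on the grid\<close>

lemma abs_diff_replace:
  fixes a1 a2 b1 b2 c1 c2 d1 d2 p p' q s :: real
  assumes "\<bar>a1 - b1\<bar> \<le> p" "\<bar>a2 - b2\<bar> \<le> p" "\<bar>c1 - d1\<bar> \<le> p'" "\<bar>c2 - d2\<bar> \<le> p'"
    and "\<bar>(b1 - d1) - (b2 - d2)\<bar> \<le> q" "p + p' \<le> s"
  shows "\<bar>(a1 - c1) - (a2 - c2)\<bar> \<le> q + 2 * s"
  using assms by linarith

context delay_coefficients
begin

lemma grid_shift: "of_int n * h + of_int i * h = of_int (n + i) * (h::real)"
  by (simp add: algebra_simps)

lemma grid_dist:
  assumes "n \<le> m" "0 < (h::real)"
  shows "\<bar>of_int m * h - of_int n * h\<bar> = h * of_int (m - n)"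
proof -
  have "of_int m * h - of_int n * h = h * of_int (m - n)" by (simp add: algebra_simps)
  moreover have "0 \<le> h * of_int (m - n)" using assms by (intro mult_nonneg_nonneg) auto
  ultimately show ?thesis by simp
qed

lemma grid_dist_le:
  assumes "0 < N" "0 \<le> n" "m \<le> int N"
  shows "mesh N * of_int (m - n) \<le> T"
proof -
  have "mesh N * of_int (m - n) \<le> mesh N * of_int (int N)"
    using assms T by (intro mult_left_mono) auto
  also have "\<dots> = T" using assms by simp
  finally show ?thesis .
qed

text \<open>A diffusion coefficient evaluated at an approximate delay value \<open>y\<close> differs from the functional
  \<open>sigma_hat\<close> at the interpolated segment only by quadrature errors; it applies to the exact delay
  term of the solution as well as to the Riemann sum of the scheme.\<close>

lemma sigma_hat_interpolation:
  fixes n :: int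
  assumes N: "0 < N" and n: "0 \<le> n" "n \<le> int N"
    and step: "\<And>k. k \<in> {- int N..-1} \<Longrightarrow> \<bar>f (node N (n + k + 1)) - f (node N (n + k))\<bar> \<le> \<delta>"
    and y: "\<bar>y - euler_delay (mesh N) N K f (node N n)\<bar> \<le> \<eta>"
  shows "\<bar>\<sigma> (node N n) (f (node N n)) y
     - sigma_hat T \<sigma> K (node N n) (hat_interpolation N (mesh N) (\<lambda>k. f (node N (n + k))))\<bar>
     \<le> L2 * (\<eta> + T * (K1 * mesh N + K2 * \<delta>))"
proof -
  define h where "h = mesh N"
  have h: "0 < h" using N T by (simp add: h_def)
  define t where "t = of_int n * h"
  have t: "t \<in> {0..T}" unfolding t_def h_def by (rule grid_mem[OF N n])
  define P where "P = hat_interpolation N h (\<lambda>k. f (of_int (n + k) * h))"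
  have "\<bar>seg_delay t P - (\<Sum>i\<in>{- int N..-1}. h * K t (of_int i * h) (f (of_int (n + i) * h)))\<bar> \<le> T * (K1 * h + K2 * \<delta>)"
    unfolding P_def h_def
    by (rule interpolated_delay[OF N t]) (use step in \<open>simp add: add.assoc\<close>)
  moreover have "(\<Sum>i\<in>{- int N..-1}. h * K t (of_int i * h) (f (of_int (n + i) * h))) = euler_delay h N K f t"
    unfolding euler_delay_def t_def grid_shift ..
  ultimately have "\<bar>y - seg_delay t P\<bar> \<le> \<eta> + T * (K1 * h + K2 * \<delta>)"
    using y unfolding h_def[symmetric] t_def[symmetric] by linarith
  moreover have "P 0 = f t"
  proof -
    have "P (of_int 0 * h) = f (of_int (n + 0) * h)" unfolding P_def using N by (intro hat_interpolation_grid[OF h]) auto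
    then show ?thesis by (simp add: t_def)
  qed
  moreover have "sigma_hat T \<sigma> K t P = \<sigma> t (P 0) (seg_delay t P)" by (simp add: sigma_hat_def seg_delay_def)
  moreover have "\<bar>\<sigma> t (f t) y - \<sigma> t (f t) (seg_delay t P)\<bar> \<le> L1 * \<bar>t - t\<bar> + L2 * (\<bar>f t - f t\<bar> + \<bar>y - seg_delay t P\<bar>)"
    by (rule \<sigma>_lipschitz[OF t t])
  moreover have "L2 * \<bar>y - seg_delay t P\<bar> \<le> L2 * (\<eta> + T * (K1 * h + K2 * \<delta>))"
    using calculation(1) L_pos by (intro mult_left_mono) auto
  ultimately have "\<bar>\<sigma> t (f t) y - sigma_hat T \<sigma> K t P\<bar> \<le> L2 * (\<eta> + T * (K1 * h + K2 * \<delta>))" by simp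
  then show ?thesis unfolding t_def P_def h_def .
qed

end

locale delay_frechet = delay_path +
  fixes D :: "real \<Rightarrow> (real \<Rightarrow> real) \<Rightarrow> (real \<Rightarrow> real) \<Rightarrow> real" and M1 M2 M3 :: real
  assumes M_pos: "0 < M1" "0 < M2" "0 < M3"
    and frechet: "\<And>t \<xi>. t \<in> {0..T} \<Longrightarrow> \<xi> \<in> seg_space T \<Longrightarrow> has_frechet_derivative_seg T (sigma_hat T \<sigma> K t) (D t \<xi>) \<xi>"
    and D_bound: "\<And>t \<xi>. t \<in> {0..T} \<Longrightarrow> \<xi> \<in> seg_space T \<Longrightarrow> seg_dual_norm T (D t \<xi>) \<le> M1"
    and D_lipschitz: "\<And>t \<xi> \<eta>. t \<in> {0..T} \<Longrightarrow> \<xi> \<in> seg_space T \<Longrightarrow> \<eta> \<in> seg_space T \<Longrightarrow>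
           seg_dual_norm T (\<lambda>\<zeta>. D t \<xi> \<zeta> - D t \<eta> \<zeta>) \<le> M2 * seg_norm T (\<lambda>u. \<xi> u - \<eta> u)"
    and D_time: "\<And>s t \<xi>. s \<in> {0..T} \<Longrightarrow> t \<in> {0..T} \<Longrightarrow> \<xi> \<in> seg_space T \<Longrightarrow>
           seg_dual_norm T (\<lambda>\<zeta>. D t \<xi> \<zeta> - D s \<xi> \<zeta>) \<le> M3 * \<bar>t - s\<bar>"
begin

lemma sigma_hat_four_point:
  assumes "t \<in> {0..T}" "s \<in> {0..T}" "\<xi>1 \<in> seg_space T" "\<xi>2 \<in> seg_space T" "\<xi>3 \<in> seg_space T" "\<xi>4 \<in> seg_space T"
    and "\<And>u. u \<in> {-T..0} \<Longrightarrow> \<bar>(\<xi>1 u - \<xi>2 u) - (\<xi>3 u - \<xi>4 u)\<bar> \<le> \<delta>"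
    and "\<And>u. u \<in> {-T..0} \<Longrightarrow> \<bar>\<xi>1 u - \<xi>3 u\<bar> \<le> \<rho>1"
    and "\<And>u. u \<in> {-T..0} \<Longrightarrow> \<bar>\<xi>2 u - \<xi>4 u\<bar> \<le> \<rho>2"
    and "\<And>u. u \<in> {-T..0} \<Longrightarrow> \<bar>\<xi>3 u - \<xi>4 u\<bar> \<le> \<epsilon>"
  shows "\<bar>(sigma_hat T \<sigma> K t \<xi>1 - sigma_hat T \<sigma> K t \<xi>2) - (sigma_hat T \<sigma> K s \<xi>3 - sigma_hat T \<sigma> K s \<xi>4)\<bar>
    \<le> M1 * \<delta> + (M2 * (\<rho>1 + \<rho>2) + M3 * \<bar>t - s\<bar>) * \<epsilon>"
  using frechet_four_point[where S="{0..T}" and G="sigma_hat T \<sigma> K" and D=D and r=T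
      and t=t and s=s,
      OF less_imp_le[OF T] frechet D_bound D_lipschitz D_time less_imp_le[OF M_pos(1)] less_imp_le[OF M_pos(2)] less_imp_le[OF M_pos(3)] assms]
  by blast

definition grid_error :: "nat \<Rightarrow> int \<Rightarrow> real" where
  "grid_error N k = x (node N k) - euler N (node N k)"

definition drift_error :: "nat \<Rightarrow> int \<Rightarrow> real" where
  "drift_error N n = drift (node N n) - euler_drift N n"

definition diffusion_error :: "nat \<Rightarrow> int \<Rightarrow> real" where
  "diffusion_error N n = diffusion (node N n) - euler_diffusion N n"

text \<open>The error starts from \<open>0\<close> and solves a discrete Young equation with inhomogeneity
  \<open>a = a1 * h powr (\<mu> - \<gamma>)\<close>.  Its defect \<open>R\<close>, from the expansion of the solution, is of order
  \<open>h powr (2 * \<mu>)\<close>, which is at most \<open>a * h\<close> as \<open>\<gamma> + \<mu> > 1\<close>.  The increments of \<open>diffusion_error\<close>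
  are those of the functional \<open>sigma_hat\<close> at interpolated segments, bounded by the four-point
  inequality, and quadrature errors.  The latter are of order \<open>h powr \<mu>\<close> with no decay in the
  distance \<open>d\<close> of the nodes, but \<open>h \<le> d\<close> for distinct nodes, so that
  \<open>h powr \<mu> \<le> h powr (\<mu> - \<gamma>) * d powr \<gamma>\<close>.\<close>

lemma grid_error_estimate:
  assumes \<gamma>: "0 < \<gamma>" "\<gamma> \<le> \<mu>" and \<mu>: "1/2 < \<mu>" "\<mu> < H" and \<gamma>\<mu>: "1 < \<gamma> + \<mu>"
  obtains C where "0 \<le> C"
    "\<And>N j k. 0 < N \<Longrightarrow> - int N \<le> j \<Longrightarrow> j \<le> k \<Longrightarrow> k \<le> int N \<Longrightarrow>
       \<bar>grid_error N k - grid_error N j\<bar> \<le> C * mesh N powr (\<mu> - \<gamma>) * (mesh N * of_int (k - j)) powr \<gamma>"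
    "\<And>N n. 0 < N \<Longrightarrow> 0 \<le> n \<Longrightarrow> n < int N \<Longrightarrow>
       \<bar>drift_error N n\<bar> \<le> C * mesh N powr (\<mu> - \<gamma>) \<and> \<bar>diffusion_error N n\<bar> \<le> C * mesh N powr (\<mu> - \<gamma>)"
proof -
  have \<mu>0: "0 < \<mu>" "\<mu> \<le> 1" "\<gamma> \<le> 1" "1 < \<mu> + \<mu>" using \<gamma> \<mu> H by auto
  obtain Lx where Lx: "0 \<le> Lx" "hoelder_bound {-T..T} Lx \<mu> x" using x_hoelder[OF \<mu>0(1) \<mu>(2)] by auto
  obtain W where W: "0 \<le> W" "hoelder_bound {0..T} W \<mu> w" using w_hoelder[OF \<mu>0(1) \<mu>(2)] by auto
  obtain Cz where Cz: "0 \<le> Cz"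
    "\<And>N k. 0 < N \<Longrightarrow> - int N \<le> k \<Longrightarrow> k \<le> int N \<Longrightarrow> \<bar>euler N (node N k)\<bar> \<le> Cz"
    "\<And>N j k. 0 < N \<Longrightarrow> - int N \<le> j \<Longrightarrow> j \<le> k \<Longrightarrow> k \<le> int N \<Longrightarrow>
       \<bar>euler N (node N k) - euler N (node N j)\<bar> \<le> Cz * (mesh N * of_int (k - j)) powr \<mu>"
    using euler_uniform_hoelder[OF \<mu>] by blast
  obtain CR where CR: "0 \<le> CR" "\<And>s t. 0 \<le> s \<Longrightarrow> s \<le> t \<Longrightarrow> t \<le> T \<Longrightarrow>
    \<bar>x t - x s - (drift s * (t - s) + diffusion s * (w t - w s))\<bar> \<le> CR * (t - s) powr (\<mu> + \<mu>)"
    using expansion[OF Lx(2) \<mu>0(1) Lx(1) \<mu>0(2) \<mu>0(1) \<mu>(2) \<mu>0(4)] by blast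
  \<comment> \<open>\<open>V\<close> is a common Hoelder constant of the solution and all schemes, \<open>Q * h powr \<mu>\<close> a common quadrature error.\<close>
  define V where "V = Lx + Cz"
  have V: "0 \<le> V" "Lx \<le> V" "Cz \<le> V" using Lx Cz by (auto simp: V_def)
  define Q where "Q = T * (K1 * T powr (1 - \<mu>) + K2 * V)"
  have Q: "0 \<le> Q" using T K_pos V by (simp add: Q_def)
  \<comment> \<open>The summands serve, in this order, the size of the quadrature error, the defect, and the increments of the quadrature error.\<close>
  define a1 where "a1 = Q * T powr \<gamma> + CR * T powr (\<mu> + \<gamma> - 1) + Q"
  have a1: "Q * T powr \<gamma> \<le> a1" "CR * T powr (\<mu> + \<gamma> - 1) \<le> a1" "Q \<le> a1" "0 \<le> a1"
    using Q CR by (auto simp: a1_def)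
  define A1 where "A1 = L2 * (1 + T * K2)"
  define A2 where "A2 = M2 * (2 * (V * T powr (\<mu> - \<gamma>))) + M3 * T powr (1 - \<gamma>)"
  define A where "A = A1 + A2 + M1 + 6 * L2"
  have A: "0 \<le> A1" "0 \<le> A2" "0 \<le> A" using L_pos K_pos T M_pos V by (auto simp: A1_def A2_def A_def)
  obtain C where C: "0 \<le> C"
    "\<forall>h N x \<beta> G w R a. discrete_young_equation h T \<gamma> \<mu> A W a N x \<beta> G w R \<longrightarrow>
       discrete_young_equation.controlled h \<gamma> a N x a 0 \<longrightarrow>
       discrete_young_equation.controlled h \<gamma> a N x (C * a) N"
    using discrete_young_gronwall[OF T \<gamma>(1,2) \<gamma>\<mu> A(3) W(1)] by (elim exE conjE)
  have main: "discrete_young_equation.controlled (mesh N) \<gamma> (a1 * mesh N powr (\<mu> - \<gamma>)) (int N) (grid_error N) (C * (a1 * mesh N powr (\<mu> - \<gamma>))) (int N)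
     \<and> discrete_young_equation (mesh N) T \<gamma> \<mu> A W (a1 * mesh N powr (\<mu> - \<gamma>)) (int N) (grid_error N) (drift_error N) (diffusion_error N) (\<lambda>k. w (node N k))
        (\<lambda>n. x (node N (n + 1)) - x (node N n) - (drift (node N n) * mesh N + diffusion (node N n) * (w (node N (n + 1)) - w (node N n))))"
    if N: "0 < N" for N
  proof -
    define h where "h = mesh N"
    have h: "0 < h" "h * of_int (int N) = T" using N T by (auto simp: h_def)
    have "h * 1 \<le> h * of_int (int N)" using h N by (intro mult_left_mono) auto
    also have "h * of_int (int N) = T" by (rule h(2))
    finally have hT: "h \<le> T" by simp
    define \<kappa> where "\<kappa> = h powr (\<mu> - \<gamma>)"
    have \<kappa>: "0 \<le> \<kappa>" by (simp add: \<kappa>_def)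
    define a where "a = a1 * \<kappa>"
    have a0: "0 \<le> a" using a1 \<kappa> by (simp add: a_def)
    have h\<mu>: "h powr \<mu> = \<kappa> * h powr \<gamma>" by (simp add: \<kappa>_def flip: powr_add)
    have h_le: "h \<le> T powr (1 - \<mu>) * h powr \<mu>" using powr_le_scale[of h T \<mu> 1] h hT \<mu>0 by simp
    \<comment> \<open>The shape in which quadrature errors arise, with \<open>v\<close> a Hoelder constant.\<close>
    have Qh: "T * (K1 * h + K2 * (v * h powr \<mu>)) \<le> Q * h powr \<mu>" if "0 \<le> v" "v \<le> V" for v
    proof -
      have "K1 * h + K2 * (v * h powr \<mu>) \<le> K1 * (T powr (1 - \<mu>) * h powr \<mu>) + K2 * (V * h powr \<mu>)"
        using h_le K_pos that by (intro add_mono mult_left_mono mult_right_mono) auto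
      from mult_left_mono[OF this, of T] T show ?thesis by (simp add: Q_def algebra_simps)
    qed
    have Qa: "Q * h powr \<mu> \<le> a"
    proof -
      have "h powr \<gamma> \<le> T powr \<gamma>" using h hT \<gamma> by (intro powr_mono2) auto
      then have "Q * (\<kappa> * h powr \<gamma>) \<le> Q * (\<kappa> * T powr \<gamma>)" using Q \<kappa> by (intro mult_left_mono) auto
      also have "\<dots> = (Q * T powr \<gamma>) * \<kappa>" by simp
      also have "\<dots> \<le> a1 * \<kappa>" using a1 \<kappa> by (intro mult_right_mono) auto
      finally show ?thesis by (simp add: h\<mu> a_def)
    qed
    define tm where "tm n = of_int n * h" for n :: int
    have tm: "tm n \<in> {0..T}" if "0 \<le> n" "n \<le> int N" for n unfolding tm_def h_def by (rule grid_mem[OF N that])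
    have tm': "tm n \<in> {-T..T}" if "- int N \<le> n" "n \<le> int N" for n
    proof (cases "0 \<le> n")
      case True
      then show ?thesis using tm[OF True that(2)] T by simp
    next
      case False
      then have "tm n \<in> {-T..0}" unfolding tm_def h_def using that by (intro lag_mem[OF N]) simp
      then show ?thesis using T by simp
    qed
    have tm_dist: "\<bar>tm m - tm n\<bar> = h * of_int (m - n)" if "n \<le> m" for m n
      unfolding tm_def by (rule grid_dist[OF that h(1)])
    have xH: "\<bar>x (tm m) - x (tm n)\<bar> \<le> V * (h * of_int (m - n)) powr \<mu>" if "- int N \<le> n" "n \<le> m" "m \<le> int N" for m n
    proof -
      have "\<bar>x (tm m) - x (tm n)\<bar> \<le> Lx * \<bar>tm m - tm n\<bar> powr \<mu>"
        using that by (intro hoelder_boundD[OF Lx(2)] tm') simp_all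
      also have "\<dots> \<le> V * \<bar>tm m - tm n\<bar> powr \<mu>" using V by (intro mult_right_mono) simp_all
      finally show ?thesis unfolding tm_dist[OF that(2)] .
    qed
    have zH: "\<bar>euler N (tm m) - euler N (tm n)\<bar> \<le> V * (h * of_int (m - n)) powr \<mu>" if "- int N \<le> n" "n \<le> m" "m \<le> int N" for m n
    proof -
      have "\<bar>euler N (tm m) - euler N (tm n)\<bar> \<le> Cz * (h * of_int (m - n)) powr \<mu>"
        unfolding tm_def h_def by (rule Cz(3)[OF N that])
      also have "\<dots> \<le> V * (h * of_int (m - n)) powr \<mu>" using V by (intro mult_right_mono) simp_all
      finally show ?thesis .
    qed
    define P where "P f n = hat_interpolation N h (\<lambda>k. f (tm (n + k)))" for f :: "real \<Rightarrow> real" and n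
    have P_seg: "P f n \<in> seg_space T" for f n unfolding P_def by (rule hat_interpolation_continuous)
    \<comment> \<open>\<open>sh f n\<close> is the diffusion functional at the interpolated segment of \<open>f\<close> ending at the \<open>n\<close>-th node.\<close>
    define sh where "sh f n = sigma_hat T \<sigma> K (tm n) (P f n)" for f n
    have x_delay: "\<bar>delay_term T K x (tm n) - euler_delay h N K x (tm n)\<bar> \<le> Q * h powr \<mu>" if n: "0 \<le> n" "n \<le> int N" for n
    proof -
      have "\<bar>seg_delay (tm n) (\<lambda>s. x (tm n + s)) - (\<Sum>i\<in>{- int N..-1}. h * K (tm n) (of_int i * h) (x (tm n + of_int i * h)))\<bar> \<le> T * (K1 * h + K2 * (Lx * h powr \<mu>))"
      proof (rule seg_delay_quadrature[OF N h_def tm[OF n] x_segment[OF Lx(2) \<mu>0(1) Lx(1) tm[OF n]]])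
        fix i s assume i: "i \<in> {- int N..-1}" and s: "s \<in> {of_int i * h..of_int (i + 1) * h}"
        have "of_int i * h \<in> {-T..0}" "of_int (i + 1) * h \<in> {-T..0}"
          unfolding h_def using i by (intro lag_mem[OF N]; simp)+
        then have mem: "tm n + s \<in> {-T..T}" "tm n + of_int i * h \<in> {-T..T}" using s tm[OF n] by auto
        have "\<bar>s - of_int i * h\<bar> \<le> h" using s by (auto simp: algebra_simps)
        then have "\<bar>s - of_int i * h\<bar> powr \<mu> \<le> h powr \<mu>" using \<mu>0 by (intro powr_mono2) auto
        then have "Lx * \<bar>s - of_int i * h\<bar> powr \<mu> \<le> Lx * h powr \<mu>" using Lx by (intro mult_left_mono) auto
        then show "\<bar>x (tm n + s) - x (tm n + of_int i * h)\<bar> \<le> Lx * h powr \<mu>"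
          using hoelder_boundD[OF Lx(2) mem(2,1)] by simp
      qed
      also have "\<dots> \<le> Q * h powr \<mu>" using Lx V by (intro Qh) auto
      finally show ?thesis unfolding delay_term_eq euler_delay_def .
    qed
    have interp: "\<bar>\<sigma> (tm n) (f (tm n)) y - sh f n\<bar> \<le> L2 * (\<eta> + Q * h powr \<mu>)"
      if n: "0 \<le> n" "n \<le> int N" and y: "\<bar>y - euler_delay h N K f (tm n)\<bar> \<le> \<eta>"
        and f: "\<And>m n. - int N \<le> n \<Longrightarrow> n \<le> m \<Longrightarrow> m \<le> int N \<Longrightarrow> \<bar>f (tm m) - f (tm n)\<bar> \<le> V * (h * of_int (m - n)) powr \<mu>" for f y \<eta> n
    proof -
      have "\<bar>\<sigma> (tm n) (f (tm n)) y - sh f n\<bar> \<le> L2 * (\<eta> + T * (K1 * h + K2 * (V * h powr \<mu>)))"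
        unfolding sh_def P_def tm_def h_def
      proof (rule sigma_hat_interpolation[OF N n _ y[unfolded tm_def h_def]])
        fix k assume "k \<in> {- int N..-1}"
        then show "\<bar>f (node N (n + k + 1)) - f (node N (n + k))\<bar> \<le> V * mesh N powr \<mu>"
          using f[of "n + k" "n + k + 1", unfolded tm_def h_def] n by simp
      qed
      also have "\<dots> \<le> L2 * (\<eta> + Q * h powr \<mu>)" using L_pos V by (intro mult_left_mono add_left_mono Qh) auto
      finally show ?thesis .
    qed
    have dx: "\<bar>diffusion (tm n) - sh x n\<bar> \<le> L2 * (Q * h powr \<mu> + Q * h powr \<mu>)" if n: "0 \<le> n" "n \<le> int N" for n
      unfolding diffusion_def by (rule interp[OF n x_delay[OF n] xH])
    have dz: "\<bar>euler_diffusion N n - sh (euler N) n\<bar> \<le> L2 * (0 + Q * h powr \<mu>)" if n: "0 \<le> n" "n \<le> int N" for n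
      unfolding euler_diffusion_def Let_def h_def[symmetric] tm_def[symmetric] by (rule interp[OF n _ zH]) simp
    define e where "e = grid_error N"
    have e: "e k = x (tm k) - euler N (tm k)" for k by (simp add: e_def grid_error_def tm_def h_def)
    have e0: "e k = 0" if "- int N \<le> k" "k \<le> 0" for k
    proof -
      have "tm k \<in> {-T..0}" unfolding tm_def h_def using that by (intro lag_mem[OF N]) simp
      then show ?thesis unfolding e using x_initial euler_initial by simp
    qed
    have size: "\<bar>drift_error N n\<bar> + \<bar>diffusion_error N n\<bar> \<le> A * (a + S)"
      if n: "0 \<le> n" "n < int N" and S: "\<And>k. - int N \<le> k \<Longrightarrow> k \<le> n \<Longrightarrow> \<bar>e k\<bar> \<le> S" for n S
    proof -
      have n': "0 \<le> n" "n \<le> int N" using n by simp_all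
      have Sn: "\<bar>e n\<bar> \<le> S" using n by (intro S) simp_all
      have S0: "0 \<le> S" using Sn by linarith
      have "\<bar>euler_delay h N K x (tm n) - euler_delay h N K (euler N) (tm n)\<bar> \<le> T * (K1 * \<bar>tm n - tm n\<bar> + K2 * S)"
        unfolding h_def
      proof (rule euler_delay_lipschitz[OF N tm[OF n'] tm[OF n']])
        fix i assume "i \<in> {- int N..-1}"
        then show "\<bar>x (tm n + node N i) - euler N (tm n + node N i)\<bar> \<le> S"
          using S[of "n + i"] n unfolding e tm_def grid_shift h_def[symmetric] by simp
      qed
      then have Y: "\<bar>delay_term T K x (tm n) - euler_delay h N K (euler N) (tm n)\<bar> \<le> a + T * K2 * S"
        using x_delay[OF n'] Qa by simp
      have "\<bar>drift_error N n\<bar> + \<bar>diffusion_error N n\<bar> \<le> L2 * (\<bar>x (tm n) - euler N (tm n)\<bar> + \<bar>delay_term T K x (tm n) - euler_delay h N K (euler N) (tm n)\<bar>)"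
        unfolding drift_error_def diffusion_error_def drift_def diffusion_def euler_drift_def euler_diffusion_def Let_def
          h_def[symmetric] tm_def[symmetric] by (rule coeff_space[OF tm[OF n']])
      also have "\<dots> \<le> L2 * (S + (a + T * K2 * S))" using Sn[unfolded e] Y L_pos by (intro mult_left_mono) simp_all
      also have "\<dots> = L2 * a + A1 * S" by (simp add: A1_def algebra_simps)
      also have "\<dots> \<le> A * a + A * S"
        using a0 S0 A M_pos L_pos by (intro add_mono mult_right_mono) (simp_all add: A_def)
      finally show ?thesis by (simp add: algebra_simps)
    qed
    define R where "R n = x (tm (n + 1)) - x (tm n) - (drift (tm n) * h + diffusion (tm n) * (w (tm (n + 1)) - w (tm n)))" for n
    have tm_step: "tm (n + 1) - tm n = h" for n by (simp add: tm_def algebra_simps)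
    have eq: "discrete_young_equation h T \<gamma> \<mu> A W a (int N) e (drift_error N) (diffusion_error N) (\<lambda>k. w (tm k)) R"
    proof
      fix n :: int assume n: "0 \<le> n" "n < int N"
      have "of_int (n + 1) * h \<in> {of_int n * h..of_int (n + 1) * h}" using tm_step[of n] h by (simp add: tm_def)
      from euler_step[OF n, folded h_def, OF this]
      have "euler N (tm (n + 1)) = euler N (tm n) + euler_drift N n * h + euler_diffusion N n * (w (tm (n + 1)) - w (tm n))"
        unfolding tm_def[symmetric] tm_step .
      then show "e (n + 1) = e n + drift_error N n * h + diffusion_error N n * (w (tm (n + 1)) - w (tm n)) + R n"
        unfolding e R_def drift_error_def diffusion_error_def h_def[symmetric] tm_def[symmetric] by (simp add: algebra_simps)
    next
      fix n :: int assume n: "0 \<le> n" "n < int N"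
      have "\<bar>x (tm (n + 1)) - x (tm n) - (drift (tm n) * (tm (n + 1) - tm n) + diffusion (tm n) * (w (tm (n + 1)) - w (tm n)))\<bar> \<le> CR * (tm (n + 1) - tm n) powr (\<mu> + \<mu>)"
        using tm[of n] tm[of "n + 1"] tm_step[of n] h n by (intro CR(2)) simp_all
      then have "\<bar>R n\<bar> \<le> CR * h powr (\<mu> + \<mu>)" unfolding tm_step R_def .
      also have "h powr (\<mu> + \<mu>) = \<kappa> * (h powr (\<mu> + \<gamma> - 1) * h powr 1)" unfolding \<kappa>_def powr_add[symmetric] by simp
      also have "h powr (\<mu> + \<gamma> - 1) \<le> T powr (\<mu> + \<gamma> - 1)" using h hT \<gamma>\<mu> by (intro powr_mono2) simp_all
      then have "CR * (\<kappa> * (h powr (\<mu> + \<gamma> - 1) * h powr 1)) \<le> CR * (\<kappa> * (T powr (\<mu> + \<gamma> - 1) * h powr 1))"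
        using CR \<kappa> by (intro mult_left_mono mult_right_mono) simp_all
      also have "\<dots> = (CR * T powr (\<mu> + \<gamma> - 1)) * (\<kappa> * h)" using h by simp
      also have "\<dots> \<le> a1 * (\<kappa> * h)" using a1 \<kappa> h by (intro mult_right_mono) simp_all
      finally show "\<bar>R n\<bar> \<le> a * h" by (simp add: a_def)
    next
      fix j k :: int assume jk: "0 \<le> j" "j \<le> k" "k \<le> int N"
      have "\<bar>w (tm k) - w (tm j)\<bar> \<le> W * \<bar>tm k - tm j\<bar> powr \<mu>"
        using jk by (intro hoelder_boundD[OF W(2)] tm) simp_all
      then show "\<bar>w (tm k) - w (tm j)\<bar> \<le> W * (h * of_int (k - j)) powr \<mu>" unfolding tm_dist[OF jk(2)] .
    next
      fix n S assume n: "0 \<le> n" "n < int N" and S: "\<And>k. - int N \<le> k \<Longrightarrow> k \<le> n \<Longrightarrow> \<bar>e k\<bar> \<le> S"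
      show "\<bar>drift_error N n\<bar> \<le> A * (a + S)" "\<bar>diffusion_error N n\<bar> \<le> A * (a + S)"
        using size[OF n S] by linarith+
    next
      fix n m S Dl assume nm: "0 \<le> n" "n \<le> m" "m < int N" and S: "\<And>k. - int N \<le> k \<Longrightarrow> k \<le> m \<Longrightarrow> \<bar>e k\<bar> \<le> S"
        and Dl: "\<And>k. - int N \<le> k \<Longrightarrow> k \<le> n \<Longrightarrow> \<bar>e (k + (m - n)) - e k\<bar> \<le> Dl"
      define d where "d = h * of_int (m - n)"
      have nm': "n \<le> int N" "m \<le> int N" "0 \<le> m" using nm by simp_all
      have d: "0 \<le> d" "d \<le> T"
        using nm h grid_dist_le[OF N nm(1) nm'(2)] by (simp_all add: d_def h_def[symmetric])
      have "\<bar>e n\<bar> \<le> S" using S[of n] nm by simp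
      then have S0: "0 \<le> S" by linarith
      have "\<bar>e m - e n\<bar> \<le> Dl" using Dl[of n] nm by simp
      then have D0: "0 \<le> Dl" by linarith
      have Ph: "\<bar>hat_interpolation N h v u\<bar> \<le> B" if "u \<in> {-T..0}" "\<And>k. k \<in> {- int N..0} \<Longrightarrow> \<bar>v k\<bar> \<le> B" for v u B
        using that h(2) by (intro hat_interpolation_bound[OF h(1) N]) (simp_all add: mult.commute)
      have four: "\<bar>(sh x m - sh (euler N) m) - (sh x n - sh (euler N) n)\<bar>
          \<le> M1 * Dl + (M2 * (V * d powr \<mu> + V * d powr \<mu>) + M3 * \<bar>tm m - tm n\<bar>) * S"
        unfolding sh_def
      proof (rule sigma_hat_four_point[OF tm[OF nm'(3,2)] tm[OF nm(1) nm'(1)] P_seg P_seg P_seg P_seg])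
        fix u assume u: "u \<in> {-T..0}"
        show "\<bar>(P x m u - P (euler N) m u) - (P x n u - P (euler N) n u)\<bar> \<le> Dl"
          unfolding P_def hat_interpolation_diff[symmetric]
        proof (rule Ph[OF u])
          fix k assume "k \<in> {- int N..0}"
          then show "\<bar>(x (tm (m + k)) - euler N (tm (m + k))) - (x (tm (n + k)) - euler N (tm (n + k)))\<bar> \<le> Dl"
            using Dl[of "n + k"] nm unfolding e by (simp add: algebra_simps)
        qed
        show "\<bar>P x m u - P x n u\<bar> \<le> V * d powr \<mu>"
          unfolding P_def hat_interpolation_diff[symmetric]
        proof (rule Ph[OF u])
          fix k assume "k \<in> {- int N..0}"
          then show "\<bar>x (tm (m + k)) - x (tm (n + k))\<bar> \<le> V * d powr \<mu>"
            using xH[of "n + k" "m + k"] nm by (simp add: d_def)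
        qed
        show "\<bar>P (euler N) m u - P (euler N) n u\<bar> \<le> V * d powr \<mu>"
          unfolding P_def hat_interpolation_diff[symmetric]
        proof (rule Ph[OF u])
          fix k assume "k \<in> {- int N..0}"
          then show "\<bar>euler N (tm (m + k)) - euler N (tm (n + k))\<bar> \<le> V * d powr \<mu>"
            using zH[of "n + k" "m + k"] nm by (simp add: d_def)
        qed
        show "\<bar>P x n u - P (euler N) n u\<bar> \<le> S"
          unfolding P_def hat_interpolation_diff[symmetric]
        proof (rule Ph[OF u])
          fix k assume "k \<in> {- int N..0}"
          then show "\<bar>x (tm (n + k)) - euler N (tm (n + k))\<bar> \<le> S"
            using S[of "n + k"] nm unfolding e by simp
        qed
      qed
      have "\<bar>diffusion_error N m - diffusion_error N n\<bar> \<le> A * ((a + S) * d powr \<gamma> + Dl)"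
      proof (cases "m = n")
        case True
        then show ?thesis using A a0 S0 D0 by simp
      next
        case False
        have "h * 1 \<le> h * of_int (m - n)" using False nm h by (intro mult_left_mono) simp_all
        \<comment> \<open>Distinct nodes are at least \<open>h\<close> apart: the quadrature error turns into a Hoelder increment.\<close>
        then have hd: "h \<le> d" by (simp add: d_def)
        have "\<kappa> * h powr \<gamma> \<le> \<kappa> * d powr \<gamma>" using hd h \<gamma> \<kappa> by (intro mult_left_mono powr_mono2) simp_all
        from mult_left_mono[OF this Q] have "Q * h powr \<mu> \<le> Q * (\<kappa> * d powr \<gamma>)" unfolding h\<mu> .
        also have "\<dots> \<le> a1 * (\<kappa> * d powr \<gamma>)" using a1 \<kappa> by (intro mult_right_mono) simp_all
        finally have q: "Q * h powr \<mu> \<le> a * d powr \<gamma>" by (simp add: a_def)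
        have t: "\<bar>tm m - tm n\<bar> \<le> T powr (1 - \<gamma>) * d powr \<gamma>"
          unfolding tm_dist[OF nm(2)] d_def[symmetric] using powr_le_scale[OF d, of \<gamma> 1] \<mu>0 d by simp
        have v: "V * d powr \<mu> \<le> V * (T powr (\<mu> - \<gamma>) * d powr \<gamma>)"
          by (rule mult_left_mono[OF powr_le_scale[OF d \<gamma>(2)] V(1)])
        have "M2 * (V * d powr \<mu> + V * d powr \<mu>) + M3 * \<bar>tm m - tm n\<bar>
            \<le> M2 * (2 * (V * (T powr (\<mu> - \<gamma>) * d powr \<gamma>))) + M3 * (T powr (1 - \<gamma>) * d powr \<gamma>)"
        proof (rule add_mono)
          show "M2 * (V * d powr \<mu> + V * d powr \<mu>) \<le> M2 * (2 * (V * (T powr (\<mu> - \<gamma>) * d powr \<gamma>)))"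
            using v M_pos(2) by (intro mult_left_mono[OF _ less_imp_le]) linarith+
          show "M3 * \<bar>tm m - tm n\<bar> \<le> M3 * (T powr (1 - \<gamma>) * d powr \<gamma>)"
            by (rule mult_left_mono[OF t less_imp_le[OF M_pos(3)]])
        qed
        also have "\<dots> = A2 * d powr \<gamma>" by (simp add: A2_def algebra_simps)
        finally have "(M2 * (V * d powr \<mu> + V * d powr \<mu>) + M3 * \<bar>tm m - tm n\<bar>) * S \<le> A2 * d powr \<gamma> * S"
          using S0 by (rule mult_right_mono)
        with four have f4: "\<bar>(sh x m - sh (euler N) m) - (sh x n - sh (euler N) n)\<bar> \<le> M1 * Dl + A2 * d powr \<gamma> * S" by linarith
        have "L2 * ((Q * h powr \<mu> + Q * h powr \<mu>) + (0 + Q * h powr \<mu>)) \<le> L2 * (3 * (a * d powr \<gamma>))"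
          using q by (intro mult_left_mono[OF _ less_imp_le[OF L_pos(2)]]) linarith
        then have q3: "L2 * (Q * h powr \<mu> + Q * h powr \<mu>) + L2 * (0 + Q * h powr \<mu>) \<le> L2 * (3 * (a * d powr \<gamma>))"
          by (simp only: distrib_left[of L2 "Q * h powr \<mu> + Q * h powr \<mu>" "0 + Q * h powr \<mu>"])
        have "\<bar>diffusion_error N m - diffusion_error N n\<bar> \<le> (M1 * Dl + A2 * d powr \<gamma> * S) + 2 * (L2 * (3 * (a * d powr \<gamma>)))"
          unfolding diffusion_error_def h_def[symmetric] tm_def[symmetric]
          by (rule abs_diff_replace[OF dx[OF nm'(3,2)] dx[OF nm(1) nm'(1)] dz[OF nm'(3,2)] dz[OF nm(1) nm'(1)] f4 q3])
        also have "\<dots> = (6 * L2) * (a * d powr \<gamma>) + A2 * (S * d powr \<gamma>) + M1 * Dl" by (simp add: algebra_simps)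
        also have "\<dots> \<le> A * (a * d powr \<gamma>) + A * (S * d powr \<gamma>) + A * Dl"
          using A M_pos L_pos a0 S0 D0 by (intro add_mono mult_right_mono) (simp_all add: A_def)
        finally show ?thesis by (simp add: algebra_simps)
      qed
      then show "\<bar>diffusion_error N m - diffusion_error N n\<bar> \<le> A * ((a + S) * (h * of_int (m - n)) powr \<gamma> + Dl)"
        by (simp add: d_def)
    qed (use h \<gamma> \<mu>0 \<gamma>\<mu> A W a0 in simp_all)
    have "discrete_young_equation.controlled h \<gamma> a (int N) e a 0"
      unfolding discrete_young_equation.controlled_def[OF eq] using e0 a0 by simp
    from C(2)[rule_format, OF eq this] eq show ?thesis
      unfolding e_def a_def \<kappa>_def R_def[abs_def] tm_def h_def by blast
  qed
  define C' where "C' = C * a1 + A * (a1 + C * a1)"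
  have C': "0 \<le> C'" "C * a1 \<le> C'" "A * (a1 + C * a1) \<le> C'" using C a1 A by (auto simp: C'_def)
  show thesis
  proof
    show "0 \<le> C'" by (rule C'(1))
    fix N :: nat and j k :: int assume N: "0 < N" and jk: "- int N \<le> j" "j \<le> k" "k \<le> int N"
    have "\<bar>grid_error N k - grid_error N j\<bar> \<le> (C * (a1 * mesh N powr (\<mu> - \<gamma>))) * (mesh N * of_int (k - j)) powr \<gamma>"
      using main[OF N] jk discrete_young_equation.controlled_def by blast
    also have "\<dots> = (C * a1) * (mesh N powr (\<mu> - \<gamma>) * (mesh N * of_int (k - j)) powr \<gamma>)" by simp
    also have "\<dots> \<le> C' * (mesh N powr (\<mu> - \<gamma>) * (mesh N * of_int (k - j)) powr \<gamma>)"
      using C' by (intro mult_right_mono) simp_all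
    finally show "\<bar>grid_error N k - grid_error N j\<bar> \<le> C' * mesh N powr (\<mu> - \<gamma>) * (mesh N * of_int (k - j)) powr \<gamma>" by simp
  next
    fix N :: nat and n :: int assume N: "0 < N" and n: "0 \<le> n" "n < int N"
    define a where "a = a1 * mesh N powr (\<mu> - \<gamma>)"
    have ctl: "\<forall>k. - int N \<le> k \<and> k \<le> int N \<longrightarrow> \<bar>grid_error N k\<bar> \<le> C * a"
      using main[OF N] discrete_young_equation.controlled_def unfolding a_def by blast
    have S: "\<bar>grid_error N k\<bar> \<le> C * a" if "- int N \<le> k" "k \<le> n" for k using ctl that n by simp
    note dye = main[OF N, THEN conjunct2, folded a_def]
    have le: "A * (a + C * a) \<le> C' * mesh N powr (\<mu> - \<gamma>)"
    proof -
      have "A * (a + C * a) = (A * (a1 + C * a1)) * mesh N powr (\<mu> - \<gamma>)" by (simp add: a_def algebra_simps)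
      also have "\<dots> \<le> C' * mesh N powr (\<mu> - \<gamma>)" using C' by (intro mult_right_mono) simp_all
      finally show ?thesis .
    qed
    show "\<bar>drift_error N n\<bar> \<le> C' * mesh N powr (\<mu> - \<gamma>) \<and> \<bar>diffusion_error N n\<bar> \<le> C' * mesh N powr (\<mu> - \<gamma>)"
      using discrete_young_equation.size_\<beta>[OF dye n S] discrete_young_equation.size_G[OF dye n S] le by linarith
  qed
qed

end

section \<open>The error functional\<close>

lemma grid_floor_le: "0 < h \<Longrightarrow> grid_floor h y \<le> y"
  unfolding grid_floor_def using mult_right_mono[OF of_int_floor_le[of "y / h"], of h] by simp

lemma grid_floor_nonneg: "0 < h \<Longrightarrow> 0 \<le> y \<Longrightarrow> 0 \<le> grid_floor h y"
  unfolding grid_floor_def by simp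

text \<open>With \<open>\<gamma> > \<beta>\<close> the singular kernels are reduced to \<open>(y - v) powr (\<gamma> - \<beta> - 1)\<close>, which is integrable.  In
  the double integral the shift by \<open>s\<close> does not change the length of the increment, so the inner
  integration only contributes a factor at most \<open>T\<close>.\<close>

lemma euler_error_le:
  assumes T: "0 < T" and \<beta>: "0 < \<beta>" "\<beta> < \<gamma>" and "0 \<le> c" and h: "0 < h"
    and e: "\<And>s t. s \<in> {0..T} \<Longrightarrow> t \<in> {0..T} \<Longrightarrow> \<bar>(x t - z t) - (x s - z s)\<bar> \<le> c * \<bar>t - s\<bar> powr \<gamma>"
    and e0: "x 0 = z 0"
  shows "euler_error T \<beta> h x z \<le> ennreal (c * (T powr \<gamma> + T powr (\<gamma> - \<beta>) / (\<gamma> - \<beta>) + T * (T powr (\<gamma> - \<beta>) / (\<gamma> - \<beta>))))"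
  unfolding euler_error_def
proof (rule SUP_least)
  fix y assume y: "y \<in> {0..T}"
  define B where "B = c * (T powr (\<gamma> - \<beta>) / (\<gamma> - \<beta>))"
  have B0: "0 \<le> B" using \<open>0 \<le> c\<close> \<beta> by (simp add: B_def)
  have quot: "err_incr x z u s / (s - u) powr (\<beta> + 1) \<le> c * (s - u) powr (\<gamma> - \<beta> - 1)"
    if "0 \<le> u" "u \<le> s" "s \<le> T" for u s
  proof -
    have "err_incr x z u s \<le> c * (s - u) powr \<gamma>" using e[of u s] that by (simp add: err_incr_def)
    then have "err_incr x z u s / (s - u) powr (\<beta> + 1) \<le> c * (s - u) powr \<gamma> / (s - u) powr (\<beta> + 1)"
      by (intro divide_right_mono) simp_all
    also have "\<dots> = c * (s - u) powr (\<gamma> - (\<beta> + 1))" by (simp add: powr_diff)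
    finally show ?thesis by (simp add: algebra_simps)
  qed
  have ker: "(\<integral>\<^sup>+v\<in>{0..y}. ennreal (c * (y - v) powr (\<gamma> - \<beta> - 1)) \<partial>lborel) \<le> ennreal B"
  proof -
    have "(\<integral>\<^sup>+v\<in>{0..y}. ennreal (c * (y - v) powr (\<gamma> - \<beta> - 1)) \<partial>lborel) = ennreal (LBINT v:{0..y}. c * (y - v) powr (\<gamma> - \<beta> - 1))"
      using set_integrable_powr_kernel(1)[of 0 y "\<gamma> - \<beta> - 1"] y \<beta> \<open>0 \<le> c\<close> by (intro nn_set_integral_eq) simp_all
    also have "(LBINT v:{0..y}. c * (y - v) powr (\<gamma> - \<beta> - 1)) = c * (y powr (\<gamma> - \<beta>) / (\<gamma> - \<beta>))"
      using set_integrable_powr_kernel(2)[of 0 y "\<gamma> - \<beta> - 1"] y \<beta> by simp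
    also have "\<dots> \<le> B" unfolding B_def
      using y \<beta> \<open>0 \<le> c\<close> by (intro mult_left_mono divide_right_mono powr_mono2) simp_all
    finally show ?thesis by (simp add: ennreal_leI)
  qed
  have 1: "ennreal \<bar>x y - z y\<bar> \<le> ennreal (c * T powr \<gamma>)"
  proof (rule ennreal_leI)
    have "\<bar>x y - z y\<bar> \<le> c * y powr \<gamma>" using e[of 0 y] e0 y T by simp
    also have "\<dots> \<le> c * T powr \<gamma>" using y \<beta> \<open>0 \<le> c\<close> by (intro mult_left_mono powr_mono2) simp_all
    finally show "\<bar>x y - z y\<bar> \<le> c * T powr \<gamma>" .
  qed
  have "(\<integral>\<^sup>+v\<in>{0..y}. ennreal (err_incr x z v y / (y - v) powr (\<beta> + 1)) \<partial>lborel)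
      \<le> (\<integral>\<^sup>+v\<in>{0..y}. ennreal (c * (y - v) powr (\<gamma> - \<beta> - 1)) \<partial>lborel)"
  proof (rule nn_integral_mono)
    fix v
    show "ennreal (err_incr x z v y / (y - v) powr (\<beta> + 1)) * indicator {0..y} v \<le> ennreal (c * (y - v) powr (\<gamma> - \<beta> - 1)) * indicator {0..y} v"
      using quot[of v y] y by (cases "v \<in> {0..y}") (simp_all add: ennreal_leI)
  qed
  from order_trans[OF this ker]
  have 2: "(\<integral>\<^sup>+v\<in>{0..y}. ennreal (err_incr x z v y / (y - v) powr (\<beta> + 1)) \<partial>lborel) \<le> ennreal B" .
  have "(\<integral>\<^sup>+v\<in>{0..grid_floor h y}. (\<integral>\<^sup>+s\<in>{- grid_floor h v..0}.
       ennreal (err_incr x z (v + s) (y + s) / (y - v) powr (\<beta> + 1)) \<partial>lborel) \<partial>lborel)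
     \<le> (\<integral>\<^sup>+v. ennreal T * (ennreal (c * (y - v) powr (\<gamma> - \<beta> - 1)) * indicator {0..y} v) \<partial>lborel)"
  proof (rule nn_integral_mono)
    fix v
    show "(\<integral>\<^sup>+s\<in>{- grid_floor h v..0}. ennreal (err_incr x z (v + s) (y + s) / (y - v) powr (\<beta> + 1)) \<partial>lborel) * indicator {0..grid_floor h y} v
      \<le> ennreal T * (ennreal (c * (y - v) powr (\<gamma> - \<beta> - 1)) * indicator {0..y} v)"
    proof (cases "v \<in> {0..grid_floor h y}")
      case True
      then have v: "0 \<le> v" "v \<le> y" using grid_floor_le[OF h, of y] by simp_all
      have gv: "grid_floor h v \<le> v" "0 \<le> grid_floor h v" using grid_floor_le[OF h] grid_floor_nonneg[OF h v(1)] by auto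
      have "(\<integral>\<^sup>+s\<in>{- grid_floor h v..0}. ennreal (err_incr x z (v + s) (y + s) / (y - v) powr (\<beta> + 1)) \<partial>lborel)
        \<le> (\<integral>\<^sup>+s. ennreal (c * (y - v) powr (\<gamma> - \<beta> - 1)) * indicator {- grid_floor h v..0} s \<partial>lborel)"
      proof (rule nn_integral_mono)
        fix s
        show "ennreal (err_incr x z (v + s) (y + s) / (y - v) powr (\<beta> + 1)) * indicator {- grid_floor h v..0} s
          \<le> ennreal (c * (y - v) powr (\<gamma> - \<beta> - 1)) * indicator {- grid_floor h v..0} s"
          using quot[of "v + s" "y + s"] gv v y
          by (cases "s \<in> {- grid_floor h v..0}") (simp_all add: ennreal_leI)
      qed
      also have "\<dots> = ennreal (c * (y - v) powr (\<gamma> - \<beta> - 1)) * ennreal (grid_floor h v)"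
        using gv by (subst nn_integral_cmult) simp_all
      also have "\<dots> \<le> ennreal (c * (y - v) powr (\<gamma> - \<beta> - 1)) * ennreal T"
        using gv v y by (intro mult_left_mono ennreal_leI) simp_all
      finally show ?thesis using True v by (simp add: mult.commute)
    qed simp
  qed
  also have "\<dots> = ennreal T * (\<integral>\<^sup>+v\<in>{0..y}. ennreal (c * (y - v) powr (\<gamma> - \<beta> - 1)) \<partial>lborel)"
    by (rule nn_integral_cmult) measurable
  also have "\<dots> \<le> ennreal T * ennreal B" by (rule mult_left_mono[OF ker]) simp
  also have "\<dots> = ennreal (T * B)" using T by (simp add: ennreal_mult')
  finally have 3: "(\<integral>\<^sup>+v\<in>{0..grid_floor h y}. (\<integral>\<^sup>+s\<in>{- grid_floor h v..0}.
       ennreal (err_incr x z (v + s) (y + s) / (y - v) powr (\<beta> + 1)) \<partial>lborel) \<partial>lborel) \<le> ennreal (T * B)" .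
  have "c * (T powr \<gamma> + T powr (\<gamma> - \<beta>) / (\<gamma> - \<beta>) + T * (T powr (\<gamma> - \<beta>) / (\<gamma> - \<beta>))) = c * T powr \<gamma> + B + T * B"
    by (simp add: B_def algebra_simps)
  then have "ennreal (c * (T powr \<gamma> + T powr (\<gamma> - \<beta>) / (\<gamma> - \<beta>) + T * (T powr (\<gamma> - \<beta>) / (\<gamma> - \<beta>)))) = ennreal (c * T powr \<gamma>) + ennreal B + ennreal (T * B)"
    using B0 T \<open>0 \<le> c\<close> by (simp add: ennreal_plus)
  then show "ennreal \<bar>x y - z y\<bar> + (\<integral>\<^sup>+v\<in>{0..y}. ennreal (err_incr x z v y / (y - v) powr (\<beta> + 1)) \<partial>lborel)
        + (\<integral>\<^sup>+v\<in>{0..grid_floor h y}. (\<integral>\<^sup>+s\<in>{- grid_floor h v..0}.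
             ennreal (err_incr x z (v + s) (y + s) / (y - v) powr (\<beta> + 1)) \<partial>lborel) \<partial>lborel)
     \<le> ennreal (c * (T powr \<gamma> + T powr (\<gamma> - \<beta>) / (\<gamma> - \<beta>) + T * (T powr (\<gamma> - \<beta>) / (\<gamma> - \<beta>))))"
    using add_mono[OF add_mono[OF 1 2] 3] by simp
qed

context delay_frechet
begin

text \<open>Inside a cell the scheme has frozen coefficients, so the error increment is the remainder of the
  expansion at \<open>s\<close> plus coefficient differences times increments of time and driver.  The coefficient
  differences consist of the error at the node and of the variation of the exact coefficients within
  the cell; both are of order \<open>h powr (\<mu> - \<gamma>)\<close>.\<close>

lemma cell_estimate:
  assumes \<gamma>: "0 < \<gamma>" "\<gamma> \<le> \<mu>" and \<mu>: "1/2 < \<mu>" "\<mu> < H" and "0 \<le> C"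
    and err: "\<And>N n. 0 < N \<Longrightarrow> 0 \<le> n \<Longrightarrow> n < int N \<Longrightarrow>
       \<bar>drift_error N n\<bar> \<le> C * mesh N powr (\<mu> - \<gamma>) \<and> \<bar>diffusion_error N n\<bar> \<le> C * mesh N powr (\<mu> - \<gamma>)"
  obtains C1 where "0 \<le> C1"
    "\<And>N n s t. 0 < N \<Longrightarrow> 0 \<le> n \<Longrightarrow> n < int N \<Longrightarrow> node N n \<le> s \<Longrightarrow> s \<le> t \<Longrightarrow> t \<le> node N (n + 1) \<Longrightarrow>
       \<bar>(x t - euler N t) - (x s - euler N s)\<bar> \<le> C1 * mesh N powr (\<mu> - \<gamma>) * (t - s) powr \<gamma>"
proof -
  have \<mu>0: "0 < \<mu>" "\<mu> \<le> 1" "\<gamma> \<le> 1" "1 < \<mu> + \<mu>" using \<gamma> \<mu> H by auto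
  obtain Lx where Lx: "0 \<le> Lx" "hoelder_bound {-T..T} Lx \<mu> x" using x_hoelder[OF \<mu>0(1) \<mu>(2)] by auto
  obtain W where W: "0 \<le> W" "hoelder_bound {0..T} W \<mu> w" using w_hoelder[OF \<mu>0(1) \<mu>(2)] by auto
  obtain CR where CR: "0 \<le> CR" "\<And>s t. 0 \<le> s \<Longrightarrow> s \<le> t \<Longrightarrow> t \<le> T \<Longrightarrow>
    \<bar>x t - x s - (drift s * (t - s) + diffusion s * (w t - w s))\<bar> \<le> CR * (t - s) powr (\<mu> + \<mu>)"
    using expansion[OF Lx(2) \<mu>0(1) Lx(1) \<mu>0(2) \<mu>0(1) \<mu>(2) \<mu>0(4)] by blast
  obtain L' where L': "0 \<le> L'" "hoelder_bound {0..T} L' \<mu> drift" "hoelder_bound {0..T} L' \<mu> diffusion"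
    using coefficients_hoelder[OF Lx(2) \<mu>0(1) Lx(1) \<mu>0(2)] .
  define p where "p = T powr (\<mu> - \<gamma>)"
  define q where "q = T powr (1 - \<gamma>)"
  define r0 where "r0 = T powr \<gamma>"
  have pqr: "0 \<le> p" "0 \<le> q" "0 \<le> r0" by (simp_all add: p_def q_def r0_def)
  define C1 where "C1 = CR * r0 * p + (L' * r0 + C) * q + (L' * r0 + C) * (W * p)"
  show thesis
  proof
    show "0 \<le> C1" using CR L' W pqr \<open>0 \<le> C\<close> by (simp add: C1_def)
    fix N n s t assume N: "0 < N" and n: "0 \<le> n" "n < int N"
      and st0: "node N n \<le> s" "s \<le> t" "t \<le> node N (n + 1)"
    define h where "h = mesh N"
    define tn where "tn = of_int n * h"
    have st: "tn \<le> s" "s \<le> t" "t \<le> of_int (n + 1) * h" using st0 by (simp_all only: tn_def h_def)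
    have next_h: "of_int (n + 1) * h - tn = h" by (simp add: tn_def algebra_simps)
    have tn: "tn \<in> {0..T}" and tn1: "of_int (n + 1) * h \<in> {0..T}"
      unfolding tn_def h_def using n by (intro grid_mem[OF N]; simp)+
    have s: "s \<in> {0..T}" and t: "t \<in> {0..T}" using st tn tn1 by auto
    have h: "0 < h" "h \<le> T" using N T by (simp_all add: h_def field_simps)
    define \<kappa> where "\<kappa> = h powr (\<mu> - \<gamma>)"
    have \<kappa>: "0 \<le> \<kappa>" by (simp add: \<kappa>_def)
    have h\<mu>: "h powr \<mu> \<le> \<kappa> * r0"
    proof -
      have "h powr \<mu> = \<kappa> * h powr \<gamma>" by (simp add: \<kappa>_def flip: powr_add)
      also have "\<dots> \<le> \<kappa> * r0" unfolding r0_def using h \<gamma> \<kappa> by (intro mult_left_mono powr_mono2) simp_all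
      finally show ?thesis .
    qed
    define d where "d = t - s"
    have d: "0 \<le> d" "d \<le> h" "d \<le> T" using st next_h h by (simp_all add: d_def)
    define g where "g = d powr \<gamma>"
    have g0: "0 \<le> g" by (simp add: g_def)
    have d1: "d \<le> q * g" using powr_le_scale[OF d(1,3), of \<gamma> 1] \<mu>0 d by (simp add: q_def g_def)
    have d2: "d powr \<mu> \<le> p * g" unfolding p_def g_def by (rule powr_le_scale[OF d(1,3) \<gamma>(2)])
    have wd: "\<bar>w t - w s\<bar> \<le> W * (p * g)"
    proof -
      have "\<bar>w t - w s\<bar> \<le> W * d powr \<mu>" using hoelder_boundD[OF W(2) s t] st by (simp add: d_def)
      then show ?thesis using mult_left_mono[OF d2 W(1)] by linarith
    qed
    have b1: "\<bar>x t - x s - (drift s * d + diffusion s * (w t - w s))\<bar> \<le> CR * ((\<kappa> * r0) * (p * g))"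
    proof -
      have "\<bar>x t - x s - (drift s * d + diffusion s * (w t - w s))\<bar> \<le> CR * (d powr \<mu> * d powr \<mu>)"
        using CR(2)[of s t, unfolded powr_add] s t st by (simp add: d_def)
      moreover have "d powr \<mu> \<le> h powr \<mu>" using d \<mu>0 by (intro powr_mono2) simp_all
      then have "d powr \<mu> * d powr \<mu> \<le> (\<kappa> * r0) * (p * g)"
        using d2 h\<mu> \<kappa> pqr by (intro mult_mono) simp_all
      then have "CR * (d powr \<mu> * d powr \<mu>) \<le> CR * ((\<kappa> * r0) * (p * g))" using CR(1) by (rule mult_left_mono)
      ultimately show ?thesis by linarith
    qed
    have near: "L' * \<bar>s - tn\<bar> powr \<mu> \<le> L' * (\<kappa> * r0)"
    proof (rule mult_left_mono[OF _ L'(1)])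
      have "\<bar>s - tn\<bar> powr \<mu> \<le> h powr \<mu>" using st next_h \<mu>0 by (intro powr_mono2) simp_all
      then show "\<bar>s - tn\<bar> powr \<mu> \<le> \<kappa> * r0" using h\<mu> by linarith
    qed
    have e1: "\<bar>drift_error N n\<bar> \<le> C * \<kappa>" "\<bar>diffusion_error N n\<bar> \<le> C * \<kappa>"
      using err[OF N n] by (simp_all add: \<kappa>_def h_def)
    have c1: "\<bar>drift s - drift tn + drift_error N n\<bar> \<le> (L' * r0 + C) * \<kappa>"
      using hoelder_boundD[OF L'(2) tn s] near e1(1) abs_triangle_ineq[of "drift s - drift tn" "drift_error N n"] by (simp add: algebra_simps)
    have c2: "\<bar>diffusion s - diffusion tn + diffusion_error N n\<bar> \<le> (L' * r0 + C) * \<kappa>"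
      using hoelder_boundD[OF L'(3) tn s] near e1(2) abs_triangle_ineq[of "diffusion s - diffusion tn" "diffusion_error N n"] by (simp add: algebra_simps)
    have b2: "\<bar>(drift s - drift tn + drift_error N n) * d\<bar> \<le> (L' * r0 + C) * \<kappa> * (q * g)"
      unfolding abs_mult using c1 d1 d by (intro mult_mono) simp_all
    have b3: "\<bar>(diffusion s - diffusion tn + diffusion_error N n) * (w t - w s)\<bar> \<le> (L' * r0 + C) * \<kappa> * (W * (p * g))"
      unfolding abs_mult using c2 wd by (intro mult_mono) simp_all
    have "euler N t - euler N s = euler_drift N n * d + euler_diffusion N n * (w t - w s)"
      using euler_step[OF n, of t] euler_step[OF n, of s] st unfolding tn_def h_def d_def by (simp add: algebra_simps)
    then have "(x t - euler N t) - (x s - euler N s) = (x t - x s - (drift s * d + diffusion s * (w t - w s)))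
        + (drift s - drift tn + drift_error N n) * d + (diffusion s - diffusion tn + diffusion_error N n) * (w t - w s)"
      unfolding drift_error_def diffusion_error_def h_def[symmetric] tn_def[symmetric] by (simp add: algebra_simps)
    then have "\<bar>(x t - euler N t) - (x s - euler N s)\<bar> \<le> CR * ((\<kappa> * r0) * (p * g)) + (L' * r0 + C) * \<kappa> * (q * g) + (L' * r0 + C) * \<kappa> * (W * (p * g))"
      using b1 b2 b3 by linarith
    also have "\<dots> = C1 * \<kappa> * g" by (simp add: C1_def algebra_simps)
    finally show "\<bar>(x t - euler N t) - (x s - euler N s)\<bar> \<le> C1 * mesh N powr (\<mu> - \<gamma>) * (t - s) powr \<gamma>"
      by (simp add: \<kappa>_def g_def d_def h_def)
  qed
qed

lemma cell_cover:
  assumes N: "0 < N" and s: "s \<in> {0..T}"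
  obtains n where "0 \<le> n" "n < int N" "node N n \<le> s" "s \<le> node N (n + 1)"
proof -
  have h: "0 < mesh N" using N T by simp
  have "s - T \<in> {- (real N * mesh N)..0}" using s N by simp
  from grid_cover[OF h N this] obtain j where j: "j \<in> {- int N..-1}" "s - T \<in> {node N j..node N (j + 1)}" .
  have shift: "node N (i + int N) = node N i + T" for i :: int
    using N by (simp add: distrib_right add_divide_distrib)
  show thesis
  proof (rule that[of "j + int N"])
    show "0 \<le> j + int N" "j + int N < int N" using j(1) by simp_all
    show "node N (j + int N) \<le> s"
      unfolding shift using j(2) by (simp only: atLeastAtMost_iff le_diff_eq)
    have "j + int N + 1 = (j + 1) + int N" by simp
    then show "s \<le> node N (j + int N + 1)"
      using j(2) shift[of "j + 1"] by (simp only: atLeastAtMost_iff diff_le_eq)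
  qed
qed

text \<open>Two times in different cells are joined through the nodes between them: two partial cells and one
  increment between nodes.\<close>

lemma error_hoelder:
  assumes \<gamma>: "0 < \<gamma>" "\<gamma> \<le> \<mu>" and \<mu>: "1/2 < \<mu>" "\<mu> < H" and \<gamma>\<mu>: "1 < \<gamma> + \<mu>"
  obtains C where "0 \<le> C" "\<And>N s t. 0 < N \<Longrightarrow> s \<in> {0..T} \<Longrightarrow> t \<in> {0..T} \<Longrightarrow>
      \<bar>(x t - euler N t) - (x s - euler N s)\<bar> \<le> C * mesh N powr (\<mu> - \<gamma>) * \<bar>t - s\<bar> powr \<gamma>"
proof -
  obtain C where C: "0 \<le> C"
    "\<And>N j k. 0 < N \<Longrightarrow> - int N \<le> j \<Longrightarrow> j \<le> k \<Longrightarrow> k \<le> int N \<Longrightarrow>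
       \<bar>grid_error N k - grid_error N j\<bar> \<le> C * mesh N powr (\<mu> - \<gamma>) * (mesh N * of_int (k - j)) powr \<gamma>"
    "\<And>N n. 0 < N \<Longrightarrow> 0 \<le> n \<Longrightarrow> n < int N \<Longrightarrow>
       \<bar>drift_error N n\<bar> \<le> C * mesh N powr (\<mu> - \<gamma>) \<and> \<bar>diffusion_error N n\<bar> \<le> C * mesh N powr (\<mu> - \<gamma>)"
    using grid_error_estimate[OF \<gamma> \<mu> \<gamma>\<mu>] by blast
  obtain C1 where C1: "0 \<le> C1"
    "\<And>N n s t. 0 < N \<Longrightarrow> 0 \<le> n \<Longrightarrow> n < int N \<Longrightarrow> node N n \<le> s \<Longrightarrow> s \<le> t \<Longrightarrow> t \<le> node N (n + 1) \<Longrightarrow>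
       \<bar>(x t - euler N t) - (x s - euler N s)\<bar> \<le> C1 * mesh N powr (\<mu> - \<gamma>) * (t - s) powr \<gamma>"
    using cell_estimate[OF \<gamma> \<mu> C(1) C(3)] by blast
  define C' where "C' = 2 * C1 + C"
  have main: "\<bar>(x t - euler N t) - (x s - euler N s)\<bar> \<le> C' * mesh N powr (\<mu> - \<gamma>) * (t - s) powr \<gamma>"
    if N: "0 < N" and st: "s \<in> {0..T}" "t \<in> {0..T}" "s < t" for N s t
  proof -
    define h where "h = mesh N"
    have h: "0 < h" using N T by (simp add: h_def)
    define \<kappa> where "\<kappa> = h powr (\<mu> - \<gamma>)"
    have \<kappa>: "0 \<le> \<kappa>" by (simp add: \<kappa>_def)
    define e where "e u = x u - euler N u" for u
    define g where "g = (t - s) powr \<gamma>"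
    have g0: "0 \<le> g" by (simp add: g_def)
    have cell: "\<bar>e v - e u\<bar> \<le> C1 * \<kappa> * (v - u) powr \<gamma>"
      if "0 \<le> n" "n < int N" "of_int n * h \<le> u" "u \<le> v" "v \<le> of_int (n + 1) * h" for n u v
      using C1(2)[OF N that(1,2), of u v] that by (simp add: e_def \<kappa>_def h_def)
    have shrink: "B * \<kappa> * (v - u) powr \<gamma> \<le> B * \<kappa> * g" if "0 \<le> B" "s \<le> u" "u \<le> v" "v \<le> t" for B u v
      unfolding g_def using that \<kappa> \<gamma> by (intro mult_left_mono powr_mono2) simp_all
    obtain n where n: "0 \<le> n" "n < int N" "of_int n * h \<le> s" "s \<le> of_int (n + 1) * h"
      using cell_cover[OF N st(1)] unfolding h_def .
    obtain m where m: "0 \<le> m" "m < int N" "of_int m * h \<le> t" "t \<le> of_int (m + 1) * h"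
      using cell_cover[OF N st(2)] unfolding h_def .
    have mono: "of_int i * h \<le> of_int j * h" if "i \<le> j" for i j :: int using that h by (intro mult_right_mono) simp_all
    have "\<bar>e t - e s\<bar> \<le> C' * \<kappa> * g"
    proof (cases "m \<le> n")
      case True
      then have "t \<le> of_int (n + 1) * h" using m(4) mono[of "m + 1" "n + 1"] by linarith
      then have "\<bar>e t - e s\<bar> \<le> C1 * \<kappa> * g" using cell[OF n(1-3)] st by (simp add: g_def)
      also have "\<dots> \<le> C' * \<kappa> * g" using C1 C \<kappa> g0 by (intro mult_right_mono) (simp_all add: C'_def)
      finally show ?thesis .
    next
      case False
      define u v where "u = of_int (n + 1) * h" and "v = of_int m * h"
      have uv: "s \<le> u" "u \<le> v" "v \<le> t" using n m mono[of "n + 1" m] False by (simp_all add: u_def v_def)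
      have "\<bar>e u - e s\<bar> \<le> C1 * \<kappa> * (u - s) powr \<gamma>" by (rule cell[OF n(1-3)]) (use n in \<open>simp_all add: u_def\<close>)
      moreover have "\<bar>e t - e v\<bar> \<le> C1 * \<kappa> * (t - v) powr \<gamma>" by (rule cell[OF m(1,2)]) (use m in \<open>simp_all add: v_def\<close>)
      moreover have "\<bar>e v - e u\<bar> \<le> C * \<kappa> * (v - u) powr \<gamma>"
      proof -
        have vu: "h * of_int (m - (n + 1)) = v - u" by (simp add: u_def v_def algebra_simps)
        have "\<bar>grid_error N m - grid_error N (n + 1)\<bar> \<le> C * \<kappa> * (h * of_int (m - (n + 1))) powr \<gamma>"
          unfolding \<kappa>_def h_def using n m False by (intro C(2)[OF N]) simp_all
        then show ?thesis unfolding vu grid_error_def e_def u_def v_def h_def[symmetric] .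
      qed
      ultimately have "\<bar>e t - e s\<bar> \<le> C1 * \<kappa> * g + C * \<kappa> * g + C1 * \<kappa> * g"
        using shrink[of C1 s u] shrink[of C1 v t] shrink[of C u v] uv C C1 by linarith
      then show ?thesis by (simp add: C'_def algebra_simps)
    qed
    then show ?thesis by (simp add: e_def \<kappa>_def g_def h_def)
  qed
  show thesis
  proof
    show "0 \<le> C'" using C C1 by (simp add: C'_def)
    fix N s t assume N: "0 < (N::nat)" and st: "s \<in> {0..T}" "t \<in> {0..T}"
    consider "s < t" | "t < s" | "s = t" by linarith
    then show "\<bar>(x t - euler N t) - (x s - euler N s)\<bar> \<le> C' * mesh N powr (\<mu> - \<gamma>) * \<bar>t - s\<bar> powr \<gamma>"
    proof cases
      case 1 then show ?thesis using main[OF N st] by simp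
    next
      case 2 then show ?thesis using main[OF N st(2,1)] by (simp add: abs_minus_commute)
    qed simp
  qed
qed

text \<open>Both bounds on \<open>\<delta>\<close> have a purpose: \<open>2 * \<delta> \<le> H - 1/2\<close> gives \<open>\<mu> > 1/2\<close> and \<open>\<gamma> \<le> \<mu>\<close>, and
  \<open>2 * \<delta> \<le> 1 - H\<close> is \<open>\<mu> - \<gamma> \<ge> 2 * H - 1 - \<beta>\<close>.\<close>

theorem pathwise_euler_rate:
  assumes \<beta>: "1 - H < \<beta>" "\<beta> < 1/2"
  shows "\<exists>C. \<forall>N>0. euler_error T \<beta> (mesh N) x (euler N) \<le> ennreal (C * mesh N powr (2 * H - 1 - \<beta>))"
proof -
  define \<delta> where "\<delta> = min ((1 - H) / 2) ((H - 1/2) / 2)"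
  define \<gamma> where "\<gamma> = \<beta> + \<delta>"
  define \<mu> where "\<mu> = H - \<delta>"
  have \<delta>: "0 < \<delta>" "2 * \<delta> \<le> 1 - H" "2 * \<delta> \<le> H - 1/2" using H by (auto simp: \<delta>_def min_def)
  have \<gamma>\<mu>: "0 < \<gamma>" "\<gamma> \<le> \<mu>" "1/2 < \<mu>" "\<mu> < H" "1 < \<gamma> + \<mu>" and exponent: "2 * H - 1 - \<beta> \<le> \<mu> - \<gamma>" and \<beta>0: "0 < \<beta>" "\<beta> < \<gamma>"
    using \<delta> \<beta> H unfolding \<gamma>_def \<mu>_def by linarith+
  obtain C where C: "0 \<le> C" "\<And>N s t. 0 < N \<Longrightarrow> s \<in> {0..T} \<Longrightarrow> t \<in> {0..T} \<Longrightarrow>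
      \<bar>(x t - euler N t) - (x s - euler N s)\<bar> \<le> C * mesh N powr (\<mu> - \<gamma>) * \<bar>t - s\<bar> powr \<gamma>"
    using error_hoelder[OF \<gamma>\<mu>] by blast
  define F where "F = T powr \<gamma> + T powr (\<gamma> - \<beta>) / (\<gamma> - \<beta>) + T * (T powr (\<gamma> - \<beta>) / (\<gamma> - \<beta>))"
  have F: "0 \<le> F" using T \<beta>0 by (simp add: F_def)
  show ?thesis
  proof (intro exI allI impI)
    fix N :: nat assume N: "0 < N"
    define h where "h = mesh N"
    have h: "0 < h" "h \<le> T" using N T by (simp_all add: h_def field_simps)
    have "x 0 = euler N 0" using x_initial[of 0] euler_initial[of 0 N] T by simp
    from euler_error_le[OF T \<beta>0 _ h(1) C(2)[OF N] this]
    have "euler_error T \<beta> h x (euler N) \<le> ennreal (C * h powr (\<mu> - \<gamma>) * F)"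
      using C(1) by (simp add: F_def h_def)
    also have "\<dots> \<le> ennreal ((C * F * T powr ((\<mu> - \<gamma>) - (2 * H - 1 - \<beta>))) * h powr (2 * H - 1 - \<beta>))"
    proof (rule ennreal_leI)
      have "h powr (\<mu> - \<gamma>) \<le> T powr ((\<mu> - \<gamma>) - (2 * H - 1 - \<beta>)) * h powr (2 * H - 1 - \<beta>)"
        using h exponent by (intro powr_le_scale) simp_all
      from mult_left_mono[OF this, of "C * F"] C(1) F
      show "C * h powr (\<mu> - \<gamma>) * F \<le> (C * F * T powr ((\<mu> - \<gamma>) - (2 * H - 1 - \<beta>))) * h powr (2 * H - 1 - \<beta>)"
        by (simp add: mult_ac)
    qed
    finally show "euler_error T \<beta> (mesh N) x (euler N) \<le> ennreal ((C * F * T powr ((\<mu> - \<gamma>) - (2 * H - 1 - \<beta>))) * mesh N powr (2 * H - 1 - \<beta>))"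
      unfolding h_def .
  qed
qed

end

theorem theorem3:
  fixes M :: "'a measure" and F :: "real \<Rightarrow> 'a measure"
    and r T H \<beta> :: real
    and b \<sigma> K :: "real \<Rightarrow> real \<Rightarrow> real \<Rightarrow> real"
    and \<phi> :: "real \<Rightarrow> real"
    and B X :: "real \<Rightarrow> 'a \<Rightarrow> real"
    and D :: "real \<Rightarrow> (real \<Rightarrow> real) \<Rightarrow> (real \<Rightarrow> real) \<Rightarrow> real"
    and L1 L2 L3 M1 M2 M3 K1 K2 K3 :: real
  assumes "prob_space M" and "complete_measure M" and "usual_filtration M F"
    and "0 < r" and "T = r" and "1/2 < H" and "H < 1"
    and "fractional_brownian_motion M H B"
    and "continuous_on ({0..T} \<times> UNIV \<times> UNIV) (\<lambda>(t, x, y). b t x y)"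
    and "continuous_on ({0..T} \<times> UNIV \<times> UNIV) (\<lambda>(t, x, y). \<sigma> t x y)"
    and "continuous_on ({0..T} \<times> {-r..0} \<times> UNIV) (\<lambda>(t, s, x). K t s x)"
    and "\<And>\<rho>. 0 < \<rho> \<Longrightarrow> \<rho> < H \<Longrightarrow> hoelder_on {-r..0} (H - \<rho>) \<phi>"
    and "delay_sde_solution M H r T b \<sigma> K \<phi> B X"
    and "0 < L1" and "0 < L2" and "0 < L3"
    and "\<And>s t x y. s \<in> {0..T} \<Longrightarrow> t \<in> {0..T} \<Longrightarrow>
           \<bar>b t x y - b s x y\<bar> + \<bar>\<sigma> t x y - \<sigma> s x y\<bar> \<le> L1 * \<bar>t - s\<bar>"
    and "\<And>t x1 y1 x2 y2. t \<in> {0..T} \<Longrightarrow>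
           \<bar>b t x1 y1 - b t x2 y2\<bar> + \<bar>\<sigma> t x1 y1 - \<sigma> t x2 y2\<bar> \<le> L2 * (\<bar>x1 - x2\<bar> + \<bar>y1 - y2\<bar>)"
    and "\<And>t x y. t \<in> {0..T} \<Longrightarrow> \<bar>b t x y\<bar> + \<bar>\<sigma> t x y\<bar> \<le> L3 * (1 + \<bar>x\<bar> + \<bar>y\<bar>)"
    and "0 < M1" and "0 < M2" and "0 < M3"
    and "\<And>t \<xi>. t \<in> {0..T} \<Longrightarrow> \<xi> \<in> seg_space r \<Longrightarrow>
           has_frechet_derivative_seg r (sigma_hat r \<sigma> K t) (D t \<xi>) \<xi>"
    and "\<And>t \<xi>. t \<in> {0..T} \<Longrightarrow> \<xi> \<in> seg_space r \<Longrightarrow> seg_dual_norm r (D t \<xi>) \<le> M1"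
    and "\<And>t \<xi> \<eta>. t \<in> {0..T} \<Longrightarrow> \<xi> \<in> seg_space r \<Longrightarrow> \<eta> \<in> seg_space r \<Longrightarrow>
           seg_dual_norm r (\<lambda>\<zeta>. D t \<xi> \<zeta> - D t \<eta> \<zeta>) \<le> M2 * seg_norm r (\<lambda>u. \<xi> u - \<eta> u)"
    and "\<And>s t \<xi>. s \<in> {0..T} \<Longrightarrow> t \<in> {0..T} \<Longrightarrow> \<xi> \<in> seg_space r \<Longrightarrow>
           seg_dual_norm r (\<lambda>\<zeta>. D t \<xi> \<zeta> - D s \<xi> \<zeta>) \<le> M3 * \<bar>t - s\<bar>"
    and "0 < K1" and "0 < K2" and "0 < K3"
    and "\<And>t s x. t \<in> {0..T} \<Longrightarrow> s \<in> {-r..0} \<Longrightarrow> (\<lambda>z. K t s z) differentiable (at x)"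
    and "\<And>t u s v x. t \<in> {0..T} \<Longrightarrow> u \<in> {0..T} \<Longrightarrow> s \<in> {-r..0} \<Longrightarrow> v \<in> {-r..0} \<Longrightarrow>
           \<bar>K t s x - K u v x\<bar> \<le> K1 * (\<bar>t - u\<bar> + \<bar>s - v\<bar>)"
    and "\<And>t s x y. t \<in> {0..T} \<Longrightarrow> s \<in> {-r..0} \<Longrightarrow> \<bar>K t s x - K t s y\<bar> \<le> K2 * \<bar>x - y\<bar>"
    and "\<And>t s x. t \<in> {0..T} \<Longrightarrow> s \<in> {-r..0} \<Longrightarrow> \<bar>K t s x\<bar> \<le> K3 * (1 + \<bar>x\<bar>)"
    and "1 - H < \<beta>" and "\<beta> < 1/2"
  shows "\<exists>\<rho>0::real. 0 < \<rho>0 \<and> (\<forall>\<rho>::real. 0 < \<rho> \<and> \<rho> < \<rho>0 \<longrightarrow>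
           (\<exists>C :: 'a \<Rightarrow> real. \<forall>\<epsilon>>0. \<exists>h0>0. \<exists>\<Omega>0 \<in> sets M.
              measure M \<Omega>0 > 1 - \<epsilon> \<and>
              (\<forall>\<omega>\<in>\<Omega>0. \<forall>N\<ge>1. \<forall>h. h = T / real N \<and> h < h0 \<longrightarrow>
                 euler_error T \<beta> h (\<lambda>t. X t \<omega>) (euler_scheme b \<sigma> K \<phi> T N (\<lambda>t. B t \<omega>))
                   \<le> ennreal (C \<omega> * h powr (2 * H - 1 - \<beta>)))))"
proof (intro exI[of _ 1] conjI allI impI)
  interpret M: prob_space M by fact
  have T0: "0 < T" using \<open>0 < r\<close> \<open>T = r\<close> by simp
  have H0: "0 < H" using \<open>1/2 < H\<close> by simp
  have coeffs: "delay_coefficients T b \<sigma> K L1 L2 L3 K1 K2 K3"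
    using assms unfolding \<open>T = r\<close> by unfold_locales simp_all
  have B_hoelder: "AE \<omega> in M. \<forall>\<mu>. 0 < \<mu> \<and> \<mu> < H \<longrightarrow> (\<exists>C\<ge>0. hoelder_bound {0..T} C \<mu> (\<lambda>t. B t \<omega>))"
    by (rule M.fbm_hoelder[OF \<open>fractional_brownian_motion M H B\<close> T0])
  have phi: "\<exists>L\<ge>0. hoelder_bound {-T..0} L \<mu> \<phi>" if "0 < \<mu>" "\<mu> < H" for \<mu>
  proof -
    have "hoelder_on {-r..0} (H - (H - \<mu>)) \<phi>" using that by (intro assms(12)) simp_all
    then show ?thesis using \<open>T = r\<close> unfolding hoelder_on_def hoelder_bound_def by (auto intro: less_imp_le)
  qed
  let ?solves = "\<lambda>\<omega>. (\<exists>\<nu>>1 - H. hoelder_on {-r..T} \<nu> (\<lambda>t. X t \<omega>)) \<and> (\<forall>t\<in>{-r..0}. X t \<omega> = \<phi> t) \<and>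
        (\<forall>t\<in>{0..T}. \<exists>I.
           has_gls_integral (\<lambda>s. \<sigma> s (X s \<omega>) (delay_term r K (\<lambda>u. X u \<omega>) s)) (\<lambda>s. B s \<omega>) 0 t I \<and>
           X t \<omega> = X 0 \<omega> + (LBINT s:{0..t}. b s (X s \<omega>) (delay_term r K (\<lambda>u. X u \<omega>) s)) + I)"
  let ?rate = "\<lambda>\<omega> C. \<forall>N>0. euler_error T \<beta> (T / real N) (\<lambda>t. X t \<omega>) (euler_scheme b \<sigma> K \<phi> T N (\<lambda>t. B t \<omega>))
      \<le> ennreal (C * (T / real N) powr (2 * H - 1 - \<beta>))"
  have sol: "AE \<omega> in M. ?solves \<omega>"
    using \<open>delay_sde_solution M H r T b \<sigma> K \<phi> B X\<close> unfolding delay_sde_solution_def by blast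
  have "AE \<omega> in M. \<exists>C. ?rate \<omega> C"
    using B_hoelder sol
  proof eventually_elim
    fix \<omega>
    assume w: "\<forall>\<mu>. 0 < \<mu> \<and> \<mu> < H \<longrightarrow> (\<exists>C\<ge>0. hoelder_bound {0..T} C \<mu> (\<lambda>t. B t \<omega>))"
      and s: "?solves \<omega>"
    have rough: "\<exists>\<nu>>1 - H. \<exists>L\<ge>0. hoelder_bound {-T..T} L \<nu> (\<lambda>t. X t \<omega>)"
      using s \<open>T = r\<close> unfolding hoelder_on_def hoelder_bound_def by (metis less_imp_le)
    interpret delay_coefficients T b \<sigma> K L1 L2 L3 K1 K2 K3 by (rule coeffs)
    interpret delay_path T b \<sigma> K L1 L2 L3 K1 K2 K3 H \<phi> "\<lambda>t. X t \<omega>" "\<lambda>t. B t \<omega>"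
    proof unfold_locales
      show "\<exists>L\<ge>0. hoelder_bound {0..T} L \<mu> (\<lambda>t. B t \<omega>)" if "0 < \<mu>" "\<mu> < H" for \<mu> using w that by blast
      show "X t \<omega> = \<phi> t" if "t \<in> {-T..0}" for t using s that \<open>T = r\<close> by blast
      show "\<exists>I. has_gls_integral (\<lambda>s. \<sigma> s (X s \<omega>) (delay_term T K (\<lambda>t. X t \<omega>) s)) (\<lambda>t. B t \<omega>) 0 t I \<and>
           X t \<omega> = X 0 \<omega> + (LBINT s:{0..t}. b s (X s \<omega>) (delay_term T K (\<lambda>t. X t \<omega>) s)) + I"
        if "t \<in> {0..T}" for t using s that \<open>T = r\<close> by blast
    qed (fact assms(6,7) phi rough)+
    interpret delay_frechet T b \<sigma> K L1 L2 L3 K1 K2 K3 H \<phi> "\<lambda>t. X t \<omega>" "\<lambda>t. B t \<omega>" D M1 M2 M3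
      using assms(20-26) \<open>T = r\<close> by unfold_locales simp_all
    show "\<exists>C. ?rate \<omega> C"
      using pathwise_euler_rate[OF \<open>1 - H < \<beta>\<close> \<open>\<beta> < 1/2\<close>] unfolding euler_def .
  qed
  then obtain Z where Z: "Z \<in> null_sets M" "\<And>\<omega>. \<omega> \<in> space M - Z \<Longrightarrow> \<exists>C. ?rate \<omega> C"
    by (auto elim!: AE_E3)
  define C where "C \<omega> = (SOME C. ?rate \<omega> C)" for \<omega>
  have C: "?rate \<omega> (C \<omega>)" if "\<omega> \<in> space M - Z" for \<omega>
    unfolding C_def by (rule someI_ex[OF Z(2)[OF that]])
  \<comment> \<open>The complement of one null set is the event for every \<open>\<epsilon>\<close>; the bound there holds for all step sizes.\<close>
  have full: "space M - Z \<in> sets M" "measure M (space M - Z) = 1"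
  proof -
    show "space M - Z \<in> sets M" using Z(1) by auto
    have "measure M Z = 0" using Z(1) by (simp add: measure_eq_0_null_sets)
    then show "measure M (space M - Z) = 1" using Z(1) by (subst M.prob_compl) auto
  qed
  fix \<rho> :: real assume "0 < \<rho> \<and> \<rho> < 1"
  show "\<exists>C :: 'a \<Rightarrow> real. \<forall>\<epsilon>>0. \<exists>h0>0. \<exists>\<Omega>0 \<in> sets M.
              measure M \<Omega>0 > 1 - \<epsilon> \<and>
              (\<forall>\<omega>\<in>\<Omega>0. \<forall>N\<ge>1. \<forall>h. h = T / real N \<and> h < h0 \<longrightarrow>
                 euler_error T \<beta> h (\<lambda>t. X t \<omega>) (euler_scheme b \<sigma> K \<phi> T N (\<lambda>t. B t \<omega>))
                   \<le> ennreal (C \<omega> * h powr (2 * H - 1 - \<beta>)))"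
    using full C by (intro exI[of _ C] allI impI exI[of _ 1] conjI bexI[of _ "space M - Z"]) auto
qed simp

end
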